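(* Let $\varepsilon=(\varepsilon_n)_{n\ge 1}$ be a sequence in $[0,1)$ and let $X=(X_n)_{n\ge 0}$ be the random walk on $\mathbb{Z}$ with drift sequence $\varepsilon$ under the measure $P$, and let $\mathbb{P}$ be the law of the simple symmetric random walk on $\mathbb{Z}$ started at $0$. (i) Assume that $\lim_{n\to\infty} n\varepsilon_n=0$. Then $X$ satisfies the invariance principle, i.e. the processes $(\mathcal{I}^X_n(t))_{t\ge 0}$ converge weakly in $C(\mathbb{R}_+,\mathbb{R})$, as $n\to\infty$, to standard Brownian motion. (ii) The distribution of $X$ under $P$ is either equivalent (mutually absolutely continuous) or orthogonal (mutually singular) to the law $\mathbb{P}$ of the simple random walk, according to whether $\sum_{n=1}^\infty\varepsilon_n$ is finite or not.
   Context: The walk: under $P$, $X_0=0$, $\eta_0=1$, and $\eta_n=\eta_0+\#\{i\in(0,n]: X_i=0\}$ for $n\ge1$. The pair $(X_n,\eta_n)_{n\ge 0}$ is a Markov chain with $|X_{n+1}-X_n|=1$ and: given $X_n=0$, $X_{n+1}=\pm1$ with probability $\frac12$ each; given $X_n=i\neq 0$ and $\eta_n=m$, $X_{n+1}=i+1$ with probability $\frac12(1-\mathrm{sign}(i)\varepsilon_m)$ and $X_{n+1}=i-1$ with probability $\frac12(1+\mathrm{sign}(i)\varepsilon_m)$. If $\varepsilon_n=0$ for all $n$, $P$ is denoted $\mathbb{P}$ (simple random walk). $C(\mathbb{R}_+,\mathbb{R})$ is equipped with the topology of uniform convergence on compact sets. $[x]$ denotes the integer part of $x$. For a sequence $Z=(Z_n)_{n\ge0}$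 of random variables, $\mathcal{I}^Z_n(t)=\frac{1}{\sqrt n}\bigl(([nt]+1-nt)Z_{[nt]}+(nt-[nt])Z_{[nt]+1}\bigr)$. *)

theory Defs
  imports "HOL-Probability.Probability"
begin

text \<open>\<open>visits X n \<omega>\<close> is the counter \<open>\<eta>\<^sub>n\<close>, which starts at \<open>1\<close>.\<close>

definition visits :: "(nat \<Rightarrow> 'a \<Rightarrow> int) \<Rightarrow> nat \<Rightarrow> 'a \<Rightarrow> nat" where
  "visits X n \<omega> = 1 + card {i \<in> {0<..n}. X i \<omega> = 0}"

definition step_prob :: "(nat \<Rightarrow> real) \<Rightarrow> nat \<Rightarrow> int \<Rightarrow> int \<Rightarrow> real" where
  "step_prob \<epsilon> m i j =
     (if i = 0 then (if j = 1 \<or> j = - 1 then 1 / 2 else 0)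
      else if j = i + 1 then (1 - of_int (sgn i) * \<epsilon> m) / 2
      else if j = i - 1 then (1 + of_int (sgn i) * \<epsilon> m) / 2
      else 0)"

text \<open>
  The Markov property of the pair \<open>(X, \<eta>)\<close> is stated through elementary conditioning on
  histories \<open>(x 0, m 0), \<dots>, (x n, m n)\<close> of positive probability. Only the next position
  needs to be specified: \<open>\<eta>\<close> at time \<open>n + 1\<close> is determined by it and \<open>\<eta>\<close> at time \<open>n\<close>.
\<close>

definition drift_walk :: "'a measure \<Rightarrow> (nat \<Rightarrow> real) \<Rightarrow> (nat \<Rightarrow> 'a \<Rightarrow> int) \<Rightarrow> bool" where
  "drift_walk M \<epsilon> X \<longleftrightarrow>
     prob_space M \<and>
     (\<forall>n. X n \<in> measurable M (count_space UNIV)) \<and>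
     (AE \<omega> in M. X 0 \<omega> = 0) \<and>
     (\<forall>n x m j.
        \<P>(\<omega> in M. \<forall>k\<le>n. X k \<omega> = x k \<and> visits X k \<omega> = m k) > 0 \<longrightarrow>
        \<P>(\<omega> in M. X (Suc n) \<omega> = j \<bar> \<forall>k\<le>n. X k \<omega> = x k \<and> visits X k \<omega> = m k)
          = step_prob \<epsilon> (m n) (x n) j)"

abbreviation simple_random_walk :: "'a measure \<Rightarrow> (nat \<Rightarrow> 'a \<Rightarrow> int) \<Rightarrow> bool" where
  "simple_random_walk M S \<equiv> drift_walk M (\<lambda>_. 0) S"

definition walk_law :: "'a measure \<Rightarrow> (nat \<Rightarrow> 'a \<Rightarrow> int) \<Rightarrow> (nat \<Rightarrow> int) measure" where
  "walk_law M X = distr M (\<Pi>\<^sub>M n\<in>UNIV. count_space UNIV) (\<lambda>\<omega> n. X n \<omega>)"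

definition equivalent_measures :: "'a measure \<Rightarrow> 'a measure \<Rightarrow> bool" where
  "equivalent_measures M N \<longleftrightarrow>
     sets M = sets N \<and> absolutely_continuous M N \<and> absolutely_continuous N M"

definition orthogonal_measures :: "'a measure \<Rightarrow> 'a measure \<Rightarrow> bool" where
  "orthogonal_measures M N \<longleftrightarrow>
     sets M = sets N \<and>
     (\<exists>A\<in>sets M. emeasure M A = 0 \<and> emeasure N (space N - A) = 0)"

text \<open>
  A continuous function on \<open>[0, \<infinity>)\<close> is represented by the unique function on the reals
  extending it that is \<open>undefined\<close> at negative arguments.
\<close>

typedef cpath = "{f :: real \<Rightarrow> real. continuous_on {0..} f \<and> f \<in> extensional {0..}}"
  morphisms path_at Cpath
proof -
  have "continuous_on {0..} (restrict (\<lambda>_. 0 :: real) {0 :: real..})"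
    by (subst continuous_on_cong[OF refl, where g = "\<lambda>_. 0"]) auto
  then have "restrict (\<lambda>_. 0) {0..} \<in> {f :: real \<Rightarrow> real. continuous_on {0..} f \<and> f \<in> extensional {0..}}"
    by simp
  then show ?thesis by (rule exI[of _ "restrict (\<lambda>_. 0) {0..}"])
qed

definition to_path :: "(real \<Rightarrow> real) \<Rightarrow> cpath" where
  "to_path f = Cpath (restrict f {0..})"

lemma path_at_to_path:
  assumes "continuous_on {0..} f" "t \<ge> 0"
  shows "path_at (to_path f) t = f t"
proof -
  have "continuous_on {0..} (restrict f {0..})"
    by (subst continuous_on_cong[OF refl, where g = f]) (use assms in auto)
  then show ?thesis
    using assms(2) by (simp add: to_path_def Cpath_inverse)
qed

text \<open>The topology of uniform convergence on compact sets.\<close>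

instantiation cpath :: topological_space
begin

definition open_cpath :: "cpath set \<Rightarrow> bool" where
  "open_cpath U \<longleftrightarrow>
     (\<forall>f\<in>U. \<exists>K e. compact K \<and> K \<subseteq> {0..} \<and> e > 0 \<and>
        {g. \<forall>t\<in>K. \<bar>path_at g t - path_at f t\<bar> < e} \<subseteq> U)"

instance
proof
  show "open (UNIV :: cpath set)"
    unfolding open_cpath_def by (intro ballI exI[of _ "{}"] exI[of _ "1 :: real"]) simp
next
  fix S T :: "cpath set"
  assume S: "open S" and T: "open T"
  show "open (S \<inter> T)"
    unfolding open_cpath_def
  proof
    fix f assume "f \<in> S \<inter> T"
    then have f: "f \<in> S" "f \<in> T" by auto
    from S[unfolded open_cpath_def, THEN bspec, OF f(1)] obtain K e where 1: "compact K" "K \<subseteq> {0..}" "e > 0"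
        "{g. \<forall>t\<in>K. \<bar>path_at g t - path_at f t\<bar> < e} \<subseteq> S"
      by (elim exE conjE)
    from T[unfolded open_cpath_def, THEN bspec, OF f(2)] obtain L d where 2: "compact L" "L \<subseteq> {0..}" "d > 0"
        "{g. \<forall>t\<in>L. \<bar>path_at g t - path_at f t\<bar> < d} \<subseteq> T"
      by (elim exE conjE)
    show "\<exists>K e. compact K \<and> K \<subseteq> {0..} \<and> e > 0 \<and>
        {g. \<forall>t\<in>K. \<bar>path_at g t - path_at f t\<bar> < e} \<subseteq> S \<inter> T"
    proof (intro exI conjI)
      show "compact (K \<union> L)" using 1 2 by auto
      show "K \<union> L \<subseteq> {0..}" using 1 2 by auto
      show "min e d > 0" using 1 2 by auto
      have "{g. \<forall>t\<in>K \<union> L. \<bar>path_at g t - path_at f t\<bar> < min e d}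
          \<subseteq> {g. \<forall>t\<in>K. \<bar>path_at g t - path_at f t\<bar> < e}"
        by auto
      moreover have "{g. \<forall>t\<in>K \<union> L. \<bar>path_at g t - path_at f t\<bar> < min e d}
          \<subseteq> {g. \<forall>t\<in>L. \<bar>path_at g t - path_at f t\<bar> < d}"
        by auto
      ultimately show "{g. \<forall>t\<in>K \<union> L. \<bar>path_at g t - path_at f t\<bar> < min e d} \<subseteq> S \<inter> T"
        using 1(4) 2(4) by (meson Int_greatest order_trans)
    qed
  qed
next
  fix A :: "cpath set set"
  assume A: "\<forall>S\<in>A. open S"
  show "open (\<Union> A)"
    unfolding open_cpath_def
  proof
    fix f assume "f \<in> \<Union> A"
    then obtain S where S: "S \<in> A" "f \<in> S" by blast
    from A[THEN bspec, OF S(1), unfolded open_cpath_def, THEN bspec, OF S(2)] obtain K e where "compact K" "K \<subseteq> {0..}" "e > 0"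
        "{g. \<forall>t\<in>K. \<bar>path_at g t - path_at f t\<bar> < e} \<subseteq> S"
      by (elim exE conjE)
    moreover from this(4) S(1)
    have "{g. \<forall>t\<in>K. \<bar>path_at g t - path_at f t\<bar> < e} \<subseteq> \<Union> A"
      by (meson Sup_upper order_trans)
    ultimately show "\<exists>K e. compact K \<and> K \<subseteq> {0..} \<and> e > 0 \<and>
        {g. \<forall>t\<in>K. \<bar>path_at g t - path_at f t\<bar> < e} \<subseteq> \<Union> A"
      by (intro exI conjI)
  qed
qed

end

definition weakly_converges :: "(nat \<Rightarrow> 'a::topological_space measure) \<Rightarrow> 'a measure \<Rightarrow> bool" where
  "weakly_converges \<mu> \<nu> \<longleftrightarrow>
     (\<forall>F :: 'a \<Rightarrow> real. continuous_on UNIV F \<longrightarrow> bounded (range F) \<longrightarrow>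
        (\<lambda>n. integral\<^sup>L (\<mu> n) F) \<longlonglongrightarrow> integral\<^sup>L \<nu> F)"

text \<open>
  Measurability is part of the definition because \<open>distr\<close> is the null measure at a
  non-measurable function.
\<close>

definition converges_in_law ::
  "'a measure \<Rightarrow> (nat \<Rightarrow> 'a \<Rightarrow> 'c::topological_space) \<Rightarrow> 'b measure \<Rightarrow> ('b \<Rightarrow> 'c) \<Rightarrow> bool" where
  "converges_in_law M Y W Z \<longleftrightarrow>
     (\<forall>n. Y n \<in> borel_measurable M) \<and> Z \<in> borel_measurable W \<and>
     weakly_converges (\<lambda>n. distr M borel (Y n)) (distr W borel Z)"

definition standard_brownian_motion :: "'b measure \<Rightarrow> (real \<Rightarrow> 'b \<Rightarrow> real) \<Rightarrow> bool" where
  "standard_brownian_motion W B \<longleftrightarrow>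
     prob_space W \<and>
     (\<forall>t\<ge>0. B t \<in> borel_measurable W) \<and>
     (AE \<omega> in W. B 0 \<omega> = 0) \<and>
     (\<forall>n (t :: nat \<Rightarrow> real). 0 \<le> t 0 \<and> (\<forall>i<n. t i < t (Suc i)) \<longrightarrow>
        prob_space.indep_vars W (\<lambda>_. borel) (\<lambda>i \<omega>. B (t (Suc i)) \<omega> - B (t i) \<omega>) {..<n}) \<and>
     (\<forall>s t. 0 \<le> s \<and> s < t \<longrightarrow>
        distributed W lborel (\<lambda>\<omega>. B t \<omega> - B s \<omega>) (normal_density 0 (sqrt (t - s)))) \<and>
     (\<forall>\<omega>\<in>space W. continuous_on {0..} (\<lambda>t. B t \<omega>))"

definition interp :: "(nat \<Rightarrow> real) \<Rightarrow> nat \<Rightarrow> real \<Rightarrow> real" where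
  "interp z n t =
     ((real_of_int \<lfloor>real n * t\<rfloor> + 1 - real n * t) * z (nat \<lfloor>real n * t\<rfloor>)
      + (real n * t - real_of_int \<lfloor>real n * t\<rfloor>) * z (nat \<lfloor>real n * t\<rfloor> + 1)) / sqrt (real n)"

lemma continuous_on_interp: "continuous_on {0..} (interp z n)"
proof -
  define g where "g = (\<lambda>x :: real. (real_of_int \<lfloor>x\<rfloor> + 1 - x) * z (nat \<lfloor>x\<rfloor>)
      + (x - real_of_int \<lfloor>x\<rfloor>) * z (nat \<lfloor>x\<rfloor> + 1))"
  have seg: "continuous_on {real k..real k + 1} g" for k
  proof -
    have "g x = (real k + 1 - x) * z k + (x - real k) * z (k + 1)"
      if "x \<in> {real k..real k + 1}" for x
    proof (cases "x = real k + 1")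
      case True
      then have "\<lfloor>x\<rfloor> = int k + 1" by simp
      then show ?thesis using True by (simp add: g_def nat_add_distrib)
    next
      case False
      with that have "\<lfloor>x\<rfloor> = int k" by (intro floor_unique) auto
      then show ?thesis by (simp add: g_def)
    qed
    then show ?thesis
      by (subst continuous_on_cong[OF refl,
            where g = "\<lambda>x. (real k + 1 - x) * z k + (x - real k) * z (k + 1)"])
         (simp, intro continuous_intros)
  qed
  have init: "continuous_on {0..real N} g" for N
  proof (induction N)
    case (Suc N)
    have "{0..real (Suc N)} = {0..real N} \<union> {real N..real N + 1}" by auto
    then show ?case using continuous_on_closed_Un[OF _ _ Suc seg[of N]] by simp
  qed simp
  have g: "continuous_on {0..} g"
    unfolding continuous_on_eq_continuous_within
  proof
    fix x :: real assume x: "x \<in> {0..}"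
    obtain N where N: "x < real N" using reals_Archimedean2 by blast
    have "at x within {0..} = at x within {0..real N}"
      by (rule at_within_nhd[OF _ open_lessThan[of "real N"]]) (use N in auto)
    moreover have "continuous (at x within {0..real N}) g"
      using init[of N] x N unfolding continuous_on_eq_continuous_within by simp
    ultimately show "continuous (at x within {0..}) g" by simp
  qed
  have "continuous_on {0..} (\<lambda>t. g (real n * t) / sqrt (real n))"
  proof (cases "n = 0")
    case False
    have "continuous_on {0..} (\<lambda>t. g (real n * t))"
      by (rule continuous_on_compose2[OF g continuous_on_mult_const]) auto
    then show ?thesis
      by (rule continuous_on_divide[OF _ continuous_on_const]) (use False in auto)
  qed simp
  then show ?thesis by (simp add: interp_def[abs_def] g_def)
qed

definition rescaled_path :: "(nat \<Rightarrow> 'a \<Rightarrow> int) \<Rightarrow> nat \<Rightarrow> 'a \<Rightarrow> cpath" where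
  "rescaled_path X n \<omega> = to_path (interp (\<lambda>k. real_of_int (X k \<omega>)) n)"

end

theory Submission
  imports Defs "HOL-Real_Asymp.Real_Asymp"
begin

text \<open>
  Part (i). During its \<open>m\<close>-th excursion the walk is pushed towards the origin with strength
  \<open>\<epsilon>\<^sub>m\<close>. Up to time \<open>n\<close> it starts about \<open>\<surd>n\<close> excursions, so after an initial stretch of length
  \<open>n/p\<close> every drift is at most \<open>sup {\<epsilon>\<^sub>j | j \<ge> b \<surd>n} = o(1/\<surd>n)\<close> with probability close to one
  (\<open>few_visits\<close>), and the \<open>O(n)\<close> remaining steps are displaced by \<open>o(\<surd>n)\<close> in total, which the
  scaling makes invisible: exchanging the transition probabilities of the walk for those of the
  simple walk in one step changes the mean of a Lipschitz functional by at most the drift times the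
  Lipschitz constant (\<open>mean_from_diff_simple\<close>). On the initial stretch the drifts may be large, but they point to the
  origin, so that the walk does not move farther than a simple random walk
  (\<open>displacement_from_origin\<close>); there it is replaced by the constant path.

  What remains is Donsker's theorem. Weak convergence in \<open>C(\<real>\<^sub>+, \<real>)\<close> has to be tested only on bounded
  functionals that are Lipschitz for the supremum over a compact interval
  (\<open>converges_in_law_by_lipschitz\<close>). Exponential maximal inequalities for blocks of \<open>n/p\<close> steps
  allow the path to be replaced by the polygon through the block end points; its increments are sums
  of independent signs, which converge jointly to independent normal variables
  (\<open>block_sums_weak_conv\<close>). Letting \<open>p \<rightarrow> \<infinity>\<close> recovers Brownian motion, whose paths are the
  limits of their own polygons (\<open>brownian_increment_functional_tendsto\<close>).

  Part (ii). Let \<open>L\<close> be the likelihood ratio of the first \<open>n\<close> steps with respect to the simple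
  random walk. Under the simple walk the mean of \<open>L\<^sup>\<beta>\<close> is controlled by the functions
  \<open>\<rho>\<^sub>m\<^bsup>\<bar>x\<bar>\<^esup>\<close>, where \<open>\<rho>\<^sub>m\<close> is the mean of the factor of \<open>L\<^sup>\<beta>\<close> that belongs to the \<open>m\<close>-th excursion
  (\<open>tilted_mean_le\<close>, \<open>tilted_mean_ge\<close>). A single step contributes only to the order \<open>\<epsilon>\<^sub>m\<^sup>2\<close>, but
  excursions are so long that \<open>1 - \<rho>\<^sub>m\<close> has the exact order \<open>\<epsilon>\<^sub>m\<close>: this is why \<open>\<Sum>\<epsilon>\<^sub>m\<close>, and not
  \<open>\<Sum>\<epsilon>\<^sub>m\<^sup>2\<close>, decides. If the sum diverges, the mean of \<open>\<surd>L\<close> tends to \<open>0\<close>, which separates the two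
  laws. If it converges, the second moment of \<open>L\<close> is bounded, so the law of \<open>X\<close> is absolutely
  continuous. Negative moments of \<open>L\<close> are not bounded in \<open>n\<close>, so the converse rests instead on the fact that
  the mean of \<open>L\<^sup>\<beta>\<close> tends to \<open>1\<close> as \<open>\<beta> \<rightarrow> 0\<close>, uniformly in \<open>n\<close>: hence \<open>L\<close> is unlikely to be small.
\<close>

section \<open>Lipschitz functionals of continuous paths\<close>

lemma continuous_on_path_at: "continuous_on {0..} (path_at f)"
  using path_at[of f] by simp

text \<open>
  One parameter \<open>k\<close> serves both as the length of the time interval and as the Lipschitz constant; the
  inequality is quantified over all upper bounds \<open>c\<close> of the distance, so that no supremum occurs.
\<close>

definition path_lipschitz :: "nat \<Rightarrow> (cpath \<Rightarrow> real) \<Rightarrow> bool" where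
  "path_lipschitz k G \<longleftrightarrow>
     (\<forall>f g c. (\<forall>t\<in>{0..real k}. \<bar>path_at f t - path_at g t\<bar> \<le> c) \<longrightarrow> \<bar>G f - G g\<bar> \<le> real k * c)"

lemma path_lipschitzD:
  "path_lipschitz k G \<Longrightarrow> (\<And>t. 0 \<le> t \<Longrightarrow> t \<le> real k \<Longrightarrow> \<bar>path_at f t - path_at g t\<bar> \<le> c) \<Longrightarrow>
     \<bar>G f - G g\<bar> \<le> real k * c"
  unfolding path_lipschitz_def by auto

text \<open>
  The infimal convolution of \<open>F\<close> with \<open>k\<close> times the supremum distance on \<open>[0, k]\<close>.
\<close>

definition lipschitz_minorant :: "(cpath \<Rightarrow> real) \<Rightarrow> nat \<Rightarrow> cpath \<Rightarrow> real" where
  "lipschitz_minorant F k f =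
     Inf {F g + real k * c | g c. \<forall>t\<in>{0..real k}. \<bar>path_at f t - path_at g t\<bar> \<le> c}"

context
  fixes F :: "cpath \<Rightarrow> real" and C :: real
  assumes bounded_F: "\<And>f. \<bar>F f\<bar> \<le> C"
begin

private lemma candidate_ge:
  assumes "\<forall>t\<in>{0..real k}. \<bar>path_at f t - path_at g t\<bar> \<le> c"
  shows "- C \<le> F g + real k * c"
proof -
  have "0 \<le> c" using assms[THEN bspec, of 0] by simp
  then show ?thesis using bounded_F[of g] by (smt (verit) mult_nonneg_nonneg of_nat_0_le_iff)
qed

private lemma candidates_bdd_below:
  "bdd_below {F g + real k * c | g c. \<forall>t\<in>{0..real k}. \<bar>path_at f t - path_at g t\<bar> \<le> c}"
  by (rule bdd_belowI[of _ "- C"]) (use candidate_ge in blast)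

lemma lipschitz_minorant_lower:
  assumes "\<forall>t\<in>{0..real k}. \<bar>path_at f t - path_at g t\<bar> \<le> c"
  shows "lipschitz_minorant F k f \<le> F g + real k * c"
  unfolding lipschitz_minorant_def by (rule cInf_lower[OF _ candidates_bdd_below]) (use assms in blast)

lemma lipschitz_minorant_greatest:
  assumes "\<And>g c. \<forall>t\<in>{0..real k}. \<bar>path_at f t - path_at g t\<bar> \<le> c \<Longrightarrow> y \<le> F g + real k * c"
  shows "y \<le> lipschitz_minorant F k f"
  unfolding lipschitz_minorant_def
proof (rule cInf_greatest)
  have "F f + real k * 0 \<in> {F g + real k * c | g c. \<forall>t\<in>{0..real k}. \<bar>path_at f t - path_at g t\<bar> \<le> c}"
    by (intro CollectI exI[of _ f] exI[of _ 0]) auto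
  then show "{F g + real k * c | g c. \<forall>t\<in>{0..real k}. \<bar>path_at f t - path_at g t\<bar> \<le> c} \<noteq> {}"
    by blast
qed (use assms in blast)

lemma lipschitz_minorant_le: "lipschitz_minorant F k f \<le> F f"
  using lipschitz_minorant_lower[where f = f and g = f and c = 0] by simp

lemma lipschitz_minorant_bounded: "\<bar>lipschitz_minorant F k f\<bar> \<le> C"
proof -
  have "- C \<le> lipschitz_minorant F k f"
    by (rule lipschitz_minorant_greatest) (rule candidate_ge)
  then show ?thesis using lipschitz_minorant_le[of k f] bounded_F[of f] by linarith
qed

lemma path_lipschitz_lipschitz_minorant: "path_lipschitz k (lipschitz_minorant F k)"
  unfolding path_lipschitz_def
proof (intro allI impI)
  fix f g c assume fg: "\<forall>t\<in>{0..real k}. \<bar>path_at f t - path_at g t\<bar> \<le> c"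
  have *: "lipschitz_minorant F k f - real k * c \<le> lipschitz_minorant F k g"
    if fg: "\<forall>t\<in>{0..real k}. \<bar>path_at f t - path_at g t\<bar> \<le> c" for f g
  proof (rule lipschitz_minorant_greatest)
    fix u d assume gu: "\<forall>t\<in>{0..real k}. \<bar>path_at g t - path_at u t\<bar> \<le> d"
    have "\<forall>t\<in>{0..real k}. \<bar>path_at f t - path_at u t\<bar> \<le> c + d"
      using fg gu by (smt (verit, best))
    from lipschitz_minorant_lower[OF this]
    show "lipschitz_minorant F k f - real k * c \<le> F u + real k * d"
      by (simp add: algebra_simps)
  qed
  have "\<forall>t\<in>{0..real k}. \<bar>path_at g t - path_at f t\<bar> \<le> c"
    using fg by (simp add: abs_minus_commute)
  from *[OF fg] *[OF this] show "\<bar>lipschitz_minorant F k f - lipschitz_minorant F k g\<bar> \<le> real k * c"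
    by linarith
qed

text \<open>
  By lower semicontinuity \<open>F\<close> is at least \<open>F f - e/2\<close> on a neighbourhood of \<open>f\<close>, that is, as long as
  \<open>\<bar>g - f\<bar> < d\<close> on a compact set. A competitor \<open>g\<close> outside this neighbourhood pays the penalty \<open>k d\<close>,
  which exceeds the oscillation \<open>2 C\<close> of \<open>F\<close> once \<open>k\<close> is large.
\<close>

lemma lipschitz_minorant_tendsto:
  assumes lsc: "\<And>y. open {f. y < F f}"
  shows "(\<lambda>k. lipschitz_minorant F k f) \<longlonglongrightarrow> F f"
proof (rule tendstoI)
  fix e :: real assume e: "e > 0"
  have f: "f \<in> {g. F f - e / 2 < F g}" using e by simp
  from lsc[of "F f - e / 2", unfolded open_cpath_def, THEN bspec, OF f] obtain K d where K: "compact K" "K \<subseteq> {0..}" "d > 0"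
    "{g. \<forall>t\<in>K. \<bar>path_at g t - path_at f t\<bar> < d} \<subseteq> {g. F f - e / 2 < F g}"
    by (elim exE conjE)
  obtain T where T: "\<And>x. x \<in> K \<Longrightarrow> \<bar>x\<bar> \<le> T"
    using compact_imp_bounded[OF K(1)] unfolding bounded_iff by auto
  obtain N :: nat where N: "T \<le> real N" "2 * C / d \<le> real N"
    using real_arch_simple[of "max T (2 * C / d)"] by auto
  have "dist (lipschitz_minorant F k f) (F f) < e" if "k \<ge> N" for k
  proof -
    have k: "T \<le> real k" using N(1) that by (meson of_nat_mono order_trans)
    have "2 * C / d \<le> real k" using N(2) that by (meson of_nat_mono order_trans)
    then have kd: "2 * C \<le> real k * d" using K(3) by (simp add: pos_divide_le_eq)
    have "F f - e / 2 \<le> lipschitz_minorant F k f"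
    proof (rule lipschitz_minorant_greatest)
      fix g c assume c: "\<forall>t\<in>{0..real k}. \<bar>path_at f t - path_at g t\<bar> \<le> c"
      have c0: "0 \<le> c" using c[THEN bspec, of 0] by simp
      show "F f - e / 2 \<le> F g + real k * c"
      proof (cases "c < d")
        case True
        have "\<bar>path_at g t - path_at f t\<bar> < d" if "t \<in> K" for t
          using c[THEN bspec, of t] T[OF that] K(2) that k True by (force simp: abs_minus_commute)
        then have "F f - e / 2 < F g" using K(4) by blast
        then show ?thesis using c0 by (smt (verit) mult_nonneg_nonneg of_nat_0_le_iff)
      next
        case False
        then have "real k * d \<le> real k * c" by (intro mult_left_mono) auto
        then show ?thesis using kd bounded_F[of f] bounded_F[of g] e by linarith
      qed
    qed
    then show ?thesis using lipschitz_minorant_le[of k f] e by (simp add: dist_real_def)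
  qed
  then show "\<forall>\<^sub>F k in sequentially. dist (lipschitz_minorant F k f) (F f) < e"
    unfolding eventually_sequentially by blast
qed

end

lemma convex_combination_dist_le:
  fixes a b x y z :: real
  assumes "0 \<le> a" "0 \<le> b" "a + b = 1" "\<bar>x - z\<bar> \<le> c" "\<bar>y - z\<bar> \<le> c"
  shows "\<bar>a * x + b * y - z\<bar> \<le> c"
proof -
  have z: "z = a * z + b * z" using assms(3) by (metis distrib_right mult_1)
  have "\<bar>a * x + b * y - z\<bar> = \<bar>a * (x - z) + b * (y - z)\<bar>"
    by (subst z) (simp add: algebra_simps)
  also have "\<dots> \<le> a * \<bar>x - z\<bar> + b * \<bar>y - z\<bar>"
    using assms(1,2) by (metis abs_mult abs_of_nonneg abs_triangle_ineq)
  also have "\<dots> \<le> a * c + b * c" using assms by (intro add_mono mult_left_mono) auto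
  also have "\<dots> = c" using assms(3) by (metis distrib_right mult_1)
  finally show ?thesis .
qed

text \<open>
  The polygon with the value \<open>v i\<close> at time \<open>i / p\<close>. The factor cancels the scaling in \<open>interp\<close>.
\<close>

definition polygon :: "nat \<Rightarrow> (nat \<Rightarrow> real) \<Rightarrow> cpath" where
  "polygon p v = to_path (interp (\<lambda>i. sqrt (real p) * v i) p)"

lemma path_at_polygon:
  assumes "p > 0" "t \<ge> 0"
  shows "path_at (polygon p v) t =
    (1 - frac (real p * t)) * v (nat \<lfloor>real p * t\<rfloor>) + frac (real p * t) * v (nat \<lfloor>real p * t\<rfloor> + 1)"
proof -
  have "path_at (polygon p v) t = interp (\<lambda>i. sqrt (real p) * v i) p t"
    unfolding polygon_def by (rule path_at_to_path[OF continuous_on_interp assms(2)])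
  also have "\<dots> = (1 - frac (real p * t)) * v (nat \<lfloor>real p * t\<rfloor>) + frac (real p * t) * v (nat \<lfloor>real p * t\<rfloor> + 1)"
    using assms(1) by (simp add: interp_def frac_def field_simps)
  finally show ?thesis .
qed

text \<open>
  Both estimates below hold because a polygon takes, between two grid points, convex combinations
  of its values there.
\<close>

lemma polygon_dist_le:
  assumes p: "p > 0" and t: "0 \<le> t"
    and near: "\<And>i. i = nat \<lfloor>real p * t\<rfloor> \<or> i = nat \<lfloor>real p * t\<rfloor> + 1 \<Longrightarrow> \<bar>v i - x\<bar> \<le> c"
  shows "\<bar>path_at (polygon p v) t - x\<bar> \<le> c"
  unfolding path_at_polygon[OF p t]
  by (rule convex_combination_dist_le) (use near frac_lt_1[of "real p * t"] in \<open>auto intro: less_imp_le\<close>)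

lemma polygon_diff_le:
  assumes p: "p > 0" and t: "0 \<le> t" "t \<le> real k"
    and near: "\<And>i. i \<le> p * k + 1 \<Longrightarrow> \<bar>v i - w i\<bar> \<le> c"
  shows "\<bar>path_at (polygon p v) t - path_at (polygon p w) t\<bar> \<le> c"
proof -
  let ?j = "nat \<lfloor>real p * t\<rfloor>"
  have "real p * t \<le> real (p * k)" using t by (simp add: mult_left_mono)
  then have j: "?j \<le> p * k" by linarith
  have "path_at (polygon p v) t - path_at (polygon p w) t = path_at (polygon p (\<lambda>i. v i - w i)) t"
    unfolding path_at_polygon[OF p t(1)] by (simp add: algebra_simps)
  moreover have "\<bar>path_at (polygon p (\<lambda>i. v i - w i)) t - 0\<bar> \<le> c"
    by (rule polygon_dist_le[OF p t(1)]) (use near j in auto)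
  ultimately show ?thesis by simp
qed

lemma grid_floor_near:
  assumes p: "p > 0" and t: "0 \<le> t" "t \<le> real k"
    and i: "i = nat \<lfloor>real p * t\<rfloor> \<or> i = nat \<lfloor>real p * t\<rfloor> + 1"
  shows "\<bar>real i / real p - t\<bar> \<le> 1 / real p" "i \<le> p * k + 1"
proof -
  define j where "j = nat \<lfloor>real p * t\<rfloor>"
  have pt: "0 \<le> real p * t" using t by simp
  then have j: "real j \<le> real p * t" "real p * t \<le> real j + 1" unfolding j_def by linarith+
  have "real i = real j \<or> real i = real j + 1" using i by (auto simp: j_def)
  then have "\<bar>real i - real p * t\<bar> \<le> 1" using j by linarith
  moreover have "real i / real p - t = (real i - real p * t) / real p" using p by (simp add: field_simps)
  ultimately show "\<bar>real i / real p - t\<bar> \<le> 1 / real p" using p by (simp add: divide_right_mono)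
  have "real p * t \<le> real (p * k)" using t by (simp add: mult_left_mono)
  then have "j \<le> p * k" unfolding j_def by linarith
  with i show "i \<le> p * k + 1" by (auto simp: j_def)
qed

lemma path_modulus_tendsto:
  assumes "e > 0"
  obtains P :: nat where "P > 0" "\<And>s t. 0 \<le> s \<Longrightarrow> s \<le> real k \<Longrightarrow> 0 \<le> t \<Longrightarrow> t \<le> real k \<Longrightarrow>
    \<bar>s - t\<bar> \<le> 1 / real P \<Longrightarrow> \<bar>path_at f s - path_at f t\<bar> \<le> e"
proof -
  have "continuous_on {0..real k} (path_at f)"
    by (rule continuous_on_subset[OF continuous_on_path_at]) auto
  then have "uniformly_continuous_on {0..real k} (path_at f)"
    by (intro compact_uniformly_continuous) auto
  then obtain d where d: "d > 0" "\<And>s t. s \<in> {0..real k} \<Longrightarrow> t \<in> {0..real k} \<Longrightarrow> dist s t < d \<Longrightarrow>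
      dist (path_at f s) (path_at f t) < e"
    unfolding uniformly_continuous_on_def using assms by metis
  obtain P :: nat where P: "P > 0" "1 / real P < d"
    using d(1) nat_approx_posE[of d] by (metis zero_less_Suc)
  show ?thesis
    by (rule that[OF P(1)]) (use d(2) P(2) in \<open>force simp: dist_real_def\<close>)
qed

text \<open>
  The range \<open>[0, k + 1]\<close> of the modulus of continuity covers the one grid point that may lie beyond
  \<open>k\<close>.
\<close>

lemma polygon_approximates:
  assumes p: "p > 0" and G: "path_lipschitz k G"
    and modulus: "\<And>s t. 0 \<le> s \<Longrightarrow> s \<le> real (k + 1) \<Longrightarrow> 0 \<le> t \<Longrightarrow> t \<le> real (k + 1) \<Longrightarrow>
      \<bar>s - t\<bar> \<le> 1 / real p \<Longrightarrow> \<bar>path_at f s - path_at f t\<bar> \<le> b"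
    and near: "\<And>i. i \<le> p * k + 1 \<Longrightarrow> \<bar>v i - path_at f (real i / real p)\<bar> \<le> a"
  shows "\<bar>G (polygon p v) - G f\<bar> \<le> real k * (a + b)"
proof (rule path_lipschitzD[OF G])
  fix t :: real assume t: "0 \<le> t" "t \<le> real k"
  show "\<bar>path_at (polygon p v) t - path_at f t\<bar> \<le> a + b"
  proof (rule polygon_dist_le[OF p t(1)])
    fix i assume i: "i = nat \<lfloor>real p * t\<rfloor> \<or> i = nat \<lfloor>real p * t\<rfloor> + 1"
    note g = grid_floor_near[OF p t i]
    have "real i \<le> real p * real k + 1" using g(2) by (metis of_nat_1 of_nat_add of_nat_le_iff of_nat_mult)
    moreover have "1 \<le> real p" using p by simp
    ultimately have "real i \<le> real p * (real k + 1)" by (simp add: distrib_left)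
    then have "real i / real p \<le> real (k + 1)" using p by (simp add: field_simps)
    then have "\<bar>path_at f (real i / real p) - path_at f t\<bar> \<le> b"
      using modulus[of "real i / real p" t] t g(1) by simp
    then show "\<bar>v i - path_at f t\<bar> \<le> a + b" using near[OF g(2)] by linarith
  qed
qed

text \<open>
  A path is the uniform limit on compact sets of its polygons; this reduces questions on functionals
  of paths to functions of finitely many coordinates.
\<close>

lemma polygon_tendsto:
  assumes G: "path_lipschitz k G"
  shows "(\<lambda>p. G (polygon (Suc p) (\<lambda>i. path_at f (real i / real (Suc p))))) \<longlonglongrightarrow> G f"
proof (rule tendstoI)
  fix e :: real assume e: "e > 0"
  define b where "b = e / (2 * (real k + 1))"
  have b: "b > 0" "real k * b < e" using e by (auto simp: b_def field_simps intro: add_nonneg_pos)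
  obtain P where P: "P > 0" "\<And>s t. 0 \<le> s \<Longrightarrow> s \<le> real (k + 1) \<Longrightarrow> 0 \<le> t \<Longrightarrow> t \<le> real (k + 1) \<Longrightarrow>
    \<bar>s - t\<bar> \<le> 1 / real P \<Longrightarrow> \<bar>path_at f s - path_at f t\<bar> \<le> b"
    using path_modulus_tendsto[OF b(1), where k = "k + 1" and f = f] by metis
  have "dist (G (polygon (Suc p) (\<lambda>i. path_at f (real i / real (Suc p))))) (G f) < e" if "p \<ge> P" for p
  proof -
    have le: "1 / real (Suc p) \<le> 1 / real P" using that P(1) by (simp add: frac_le)
    have "\<bar>G (polygon (Suc p) (\<lambda>i. path_at f (real i / real (Suc p)))) - G f\<bar> \<le> real k * (0 + b)"
      by (rule polygon_approximates[OF _ G]) (use P(2) le in \<open>auto intro: order_trans\<close>)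
    then show ?thesis using b by (simp add: dist_real_def)
  qed
  then show "\<forall>\<^sub>F p in sequentially. dist (G (polygon (Suc p) (\<lambda>i. path_at f (real i / real (Suc p))))) (G f) < e"
    unfolding eventually_sequentially by blast
qed

lemma continuous_on_polygon_functional:
  assumes G: "path_lipschitz k G" and p: "p > 0"
  shows "continuous_on UNIV (\<lambda>v. G (polygon p v))"
  unfolding continuous_on_def
proof (intro ballI tendstoI)
  fix v :: "nat \<Rightarrow> real" and e :: real assume e: "e > 0"
  define d where "d = e / (2 * (real k + 1))"
  have d: "d > 0" "real k * d < e" using e by (auto simp: d_def field_simps intro: add_nonneg_pos)
  have "((\<lambda>w. w i) \<longlongrightarrow> v i) (at v)" for i
    using continuous_on_product_coordinates[of i] unfolding continuous_on_def by blast
  then have "\<forall>\<^sub>F w in at v. dist (w i) (v i) < d" for i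
    using d(1) by (rule tendstoD)
  then have "\<forall>\<^sub>F w in at v. \<forall>i\<in>{..p * k + 1}. dist (w i) (v i) < d"
    by (intro eventually_ball_finite) auto
  then show "\<forall>\<^sub>F w in at v within UNIV. dist (G (polygon p w)) (G (polygon p v)) < e"
  proof eventually_elim
    case (elim w)
    have "\<bar>G (polygon p w) - G (polygon p v)\<bar> \<le> real k * d"
      by (rule path_lipschitzD[OF G], rule polygon_diff_le[OF p])
         (use elim in \<open>auto simp: dist_real_def intro: less_imp_le\<close>)
    then show ?case using d by (simp add: dist_real_def)
  qed
qed

lemma borel_measurable_path_lipschitz:
  assumes G: "path_lipschitz k G"
    and Z: "\<And>t. t \<ge> 0 \<Longrightarrow> (\<lambda>\<omega>. path_at (Z \<omega>) t) \<in> borel_measurable N"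
  shows "(\<lambda>\<omega>. G (Z \<omega>)) \<in> borel_measurable N"
proof (rule borel_measurable_LIMSEQ_real)
  show "(\<lambda>p. G (polygon (Suc p) (\<lambda>i. path_at (Z \<omega>) (real i / real (Suc p))))) \<longlonglongrightarrow> G (Z \<omega>)" for \<omega>
    by (rule polygon_tendsto[OF G])
  fix p
  have "(\<lambda>v. G (polygon (Suc p) v)) \<in> borel_measurable borel"
    by (intro borel_measurable_continuous_onI continuous_on_polygon_functional[OF G]) simp
  moreover have "(\<lambda>\<omega> i. path_at (Z \<omega>) (real i / real (Suc p))) \<in> borel_measurable N"
    by (rule measurable_coordinatewise_then_product) (rule Z, simp)
  ultimately show "(\<lambda>\<omega>. G (polygon (Suc p) (\<lambda>i. path_at (Z \<omega>) (real i / real (Suc p))))) \<in> borel_measurable N"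
    by (rule measurable_compose_rev)
qed

text \<open>
  The indicator of an open set \<open>U\<close> is lower semicontinuous, hence the limit of its Lipschitz minorants,
  and these are limits of functions of finitely many coordinates. So measurability of
  the coordinates passes to the Borel sets of uniform convergence on compact sets.
\<close>

lemma borel_measurable_cpath:
  assumes Z: "\<And>t. t \<ge> 0 \<Longrightarrow> (\<lambda>\<omega>. path_at (Z \<omega>) t) \<in> borel_measurable N"
  shows "Z \<in> borel_measurable N"
proof (rule borel_measurableI)
  fix U :: "cpath set" assume U: "open U"
  have bd: "\<bar>indicator U f :: real\<bar> \<le> 1" for f :: cpath by (simp add: indicator_def)
  have lsc: "open {f. y < (indicator U f :: real)}" for y
  proof -
    have "{f. y < (indicator U f :: real)} = (if y < 0 then UNIV else if y < 1 then U else {})"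
      by (auto simp: indicator_def)
    then show ?thesis using U by simp
  qed
  have "(\<lambda>\<omega>. indicator U (Z \<omega>) :: real) \<in> borel_measurable N"
    by (rule borel_measurable_LIMSEQ_real[OF lipschitz_minorant_tendsto[OF bd lsc]])
       (rule borel_measurable_path_lipschitz[OF path_lipschitz_lipschitz_minorant[OF bd] Z])
  then have "(\<lambda>\<omega>. indicator U (Z \<omega>) :: real) -` {1} \<inter> space N \<in> sets N"
    by (rule measurable_sets) auto
  also have "(\<lambda>\<omega>. indicator U (Z \<omega>) :: real) -` {1} \<inter> space N = Z -` U \<inter> space N"
    by (auto simp: indicator_def split: if_splits)
  finally show "Z -` U \<inter> space N \<in> sets N" .
qed

lemma bounded_integrable:
  assumes "prob_space N" "F \<in> borel_measurable N" "\<And>\<omega>. \<bar>F \<omega>\<bar> \<le> (C::real)"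
  shows "integrable N F"
proof -
  interpret prob_space N by fact
  show ?thesis
    by (rule integrable_const_bound[where B = C, OF AE_I2 assms(2)]) (simp add: assms(3))
qed

text \<open>
  For bounded continuous \<open>F\<close> the Lipschitz minorants give \<open>liminf E F (Y n) \<ge> E F Z\<close>, because they lie
  below \<open>F\<close> and converge to it; the same argument for \<open>- F\<close> bounds the upper limit.
\<close>

lemma converges_in_law_by_lipschitz:
  assumes M: "prob_space M" and W: "prob_space W"
    and Y: "\<And>n t. t \<ge> 0 \<Longrightarrow> (\<lambda>\<omega>. path_at (Y n \<omega>) t) \<in> borel_measurable M"
    and Z: "\<And>t. t \<ge> 0 \<Longrightarrow> (\<lambda>\<omega>. path_at (Z \<omega>) t) \<in> borel_measurable W"
    and conv: "\<And>k G C. path_lipschitz k G \<Longrightarrow> (\<And>f. \<bar>G f\<bar> \<le> C) \<Longrightarrow>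
       (\<lambda>n. \<integral>\<omega>. G (Y n \<omega>) \<partial>M) \<longlonglongrightarrow> (\<integral>\<omega>. G (Z \<omega>) \<partial>W)"
  shows "converges_in_law M Y W Z"
proof -
  note mY = borel_measurable_cpath[OF Y] and mZ = borel_measurable_cpath[OF Z]
  interpret M: prob_space M by fact
  interpret W: prob_space W by fact
  have lower: "\<forall>\<^sub>F n in sequentially. (\<integral>\<omega>. F (Z \<omega>) \<partial>W) - e < (\<integral>\<omega>. F (Y n \<omega>) \<partial>M)"
    if F: "continuous_on UNIV F" and C: "\<And>f. \<bar>F f\<bar> \<le> C" and e: "e > 0" for F :: "cpath \<Rightarrow> real" and C e
  proof -
    have lsc: "open {f. y < F f}" for y
      using open_Collect_less[OF continuous_on_const F, of y] by simp
    have mF: "F \<in> borel_measurable borel" by (rule borel_measurable_continuous_onI[OF F])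
    have "(\<lambda>k. \<integral>\<omega>. lipschitz_minorant F k (Z \<omega>) \<partial>W) \<longlonglongrightarrow> (\<integral>\<omega>. F (Z \<omega>) \<partial>W)"
    proof (rule integral_dominated_convergence[where w = "\<lambda>_. C"])
      show "AE \<omega> in W. (\<lambda>k. lipschitz_minorant F k (Z \<omega>)) \<longlonglongrightarrow> F (Z \<omega>)"
        using lipschitz_minorant_tendsto[OF C lsc] by simp
      show "(\<lambda>\<omega>. F (Z \<omega>)) \<in> borel_measurable W" by (rule measurable_compose[OF mZ mF])
      show "(\<lambda>\<omega>. lipschitz_minorant F k (Z \<omega>)) \<in> borel_measurable W" for k
        by (rule borel_measurable_path_lipschitz[OF path_lipschitz_lipschitz_minorant[OF C] Z])
      show "AE \<omega> in W. norm (lipschitz_minorant F k (Z \<omega>)) \<le> C" for k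
        using lipschitz_minorant_bounded[OF C] by simp
    qed simp
    from order_tendstoD(1)[OF this, of "(\<integral>\<omega>. F (Z \<omega>) \<partial>W) - e"] e
    obtain k where k: "(\<integral>\<omega>. F (Z \<omega>) \<partial>W) - e < (\<integral>\<omega>. lipschitz_minorant F k (Z \<omega>) \<partial>W)"
      by (auto simp: eventually_sequentially)
    from order_tendstoD(1)[OF conv[OF path_lipschitz_lipschitz_minorant[OF C] lipschitz_minorant_bounded[OF C]] k]
    show ?thesis
    proof eventually_elim
      case (elim n)
      have "(\<integral>\<omega>. lipschitz_minorant F k (Y n \<omega>) \<partial>M) \<le> (\<integral>\<omega>. F (Y n \<omega>) \<partial>M)"
        by (intro integral_mono bounded_integrable[OF M, where C = C] lipschitz_minorant_le[OF C]
              borel_measurable_path_lipschitz[OF path_lipschitz_lipschitz_minorant[OF C] Y]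
              measurable_compose[OF mY mF] lipschitz_minorant_bounded[OF C] C)
      with elim show ?case by linarith
    qed
  qed
  have "weakly_converges (\<lambda>n. distr M borel (Y n)) (distr W borel Z)"
    unfolding weakly_converges_def
  proof (intro allI impI)
    fix F :: "cpath \<Rightarrow> real" assume F: "continuous_on UNIV F" "bounded (range F)"
    then obtain C where C: "\<And>f. \<bar>F f\<bar> \<le> C" unfolding bounded_iff by auto
    have mF: "F \<in> borel_measurable borel" by (rule borel_measurable_continuous_onI[OF F(1)])
    have "(\<lambda>n. \<integral>\<omega>. F (Y n \<omega>) \<partial>M) \<longlonglongrightarrow> (\<integral>\<omega>. F (Z \<omega>) \<partial>W)"
    proof (rule tendstoI)
      fix e :: real assume e: "e > 0"
      have F': "continuous_on UNIV (\<lambda>f. - F f)" using F(1) by (intro continuous_intros)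
      have C': "\<bar>- F f\<bar> \<le> C" for f using C[of f] by simp
      have "\<forall>\<^sub>F n in sequentially. (\<integral>\<omega>. - F (Z \<omega>) \<partial>W) - e < (\<integral>\<omega>. - F (Y n \<omega>) \<partial>M)"
        by (rule lower[OF F' C' e])
      with lower[OF F(1) C e]
      show "\<forall>\<^sub>F n in sequentially. dist (\<integral>\<omega>. F (Y n \<omega>) \<partial>M) (\<integral>\<omega>. F (Z \<omega>) \<partial>W) < e"
        by eventually_elim (simp add: dist_real_def)
    qed
    then show "(\<lambda>n. integral\<^sup>L (distr M borel (Y n)) F) \<longlonglongrightarrow> integral\<^sup>L (distr W borel Z) F"
      using mF by (simp add: integral_distr[OF mY] integral_distr[OF mZ])
  qed
  then show ?thesis unfolding converges_in_law_def using mY mZ by blast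
qed

section \<open>The law of the walk as a finite Markov chain of histories\<close>

text \<open>
  The signed drift after the history \<open>h\<close>, a list of positions with the most recent one first. As the
  walk starts at the origin, the visit counter is the number of zeros in \<open>h\<close>. The sign vanishes at the
  origin, so that one formula covers all transition probabilities.
\<close>

definition drift :: "(nat \<Rightarrow> real) \<Rightarrow> int list \<Rightarrow> real" where
  "drift e h = of_int (sgn (hd h)) * e (count_list h 0)"

definition step_pmf :: "(nat \<Rightarrow> real) \<Rightarrow> int list \<Rightarrow> int list pmf" where
  "step_pmf e h =
     map_pmf (\<lambda>b. (if b then hd h + 1 else hd h - 1) # h) (bernoulli_pmf ((1 - drift e h) / 2))"

primrec walk_from :: "(nat \<Rightarrow> real) \<Rightarrow> nat \<Rightarrow> int list \<Rightarrow> int list pmf" where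
  "walk_from e 0 h = return_pmf h"
| "walk_from e (Suc n) h = bind_pmf (step_pmf e h) (walk_from e n)"

abbreviation mean_from :: "(nat \<Rightarrow> real) \<Rightarrow> nat \<Rightarrow> int list \<Rightarrow> (int list \<Rightarrow> real) \<Rightarrow> real" where
  "mean_from e n h f \<equiv> measure_pmf.expectation (walk_from e n h) f"

definition step_mean :: "(nat \<Rightarrow> real) \<Rightarrow> int list \<Rightarrow> (int list \<Rightarrow> real) \<Rightarrow> real" where
  "step_mean e h f = (1 - drift e h) / 2 * f ((hd h + 1) # h) + (1 + drift e h) / 2 * f ((hd h - 1) # h)"

lemma finite_set_step_pmf [simp]: "finite (set_pmf (step_pmf e h))"
  unfolding step_pmf_def by (simp add: finite_subset[OF subset_UNIV])

lemma finite_set_walk_from [simp]: "finite (set_pmf (walk_from e n h))"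
  by (induction n arbitrary: h) simp_all

lemma integrable_walk_from [simp]: "integrable (measure_pmf (walk_from e n h)) (f :: int list \<Rightarrow> real)"
  by (rule integrable_measure_pmf_finite) simp

lemma walk_from_add: "walk_from e (n + m) h = bind_pmf (walk_from e n h) (walk_from e m)"
proof (induction n arbitrary: h)
  case (Suc n)
  have "walk_from e (n + m) = (\<lambda>h. bind_pmf (walk_from e n h) (walk_from e m))"
    by (rule ext) (rule Suc.IH)
  then show ?case by (simp add: bind_assoc_pmf)
qed (simp add: bind_return_pmf)

lemma walk_from_Suc_right: "walk_from e (Suc n) h = bind_pmf (walk_from e n h) (step_pmf e)"
proof -
  have "walk_from e 0 = return_pmf" by (rule ext) simp
  then have "walk_from e (Suc 0) = step_pmf e" by (intro ext) (simp add: bind_return_pmf')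
  then show ?thesis using walk_from_add[of e n "Suc 0" h] by simp
qed

lemma set_pmf_step: "h' \<in> set_pmf (step_pmf e h) \<Longrightarrow> \<exists>x. h' = x # h \<and> (x = hd h + 1 \<or> x = hd h - 1)"
  by (auto simp: step_pmf_def)

lemma set_pmf_walk_from: "h' \<in> set_pmf (walk_from e n h) \<Longrightarrow> \<exists>g. h' = g @ h \<and> length g = n"
proof (induction n arbitrary: h)
  case (Suc n)
  then obtain h1 where h1: "h1 \<in> set_pmf (step_pmf e h)" "h' \<in> set_pmf (walk_from e n h1)" by auto
  from Suc.IH[OF h1(2)] obtain g where "h' = g @ h1" "length g = n" by blast
  moreover from set_pmf_step[OF h1(1)] obtain x where "h1 = x # h" by blast
  ultimately show ?case by (intro exI[of _ "g @ [x]"]) simp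
qed simp

lemma mean_bind_finite:
  fixes f :: "'b \<Rightarrow> 'c::{banach, second_countable_topology}"
  assumes "finite (set_pmf p)" "\<And>x. finite (set_pmf (q x))"
  shows "measure_pmf.expectation (bind_pmf p q) f =
    measure_pmf.expectation p (\<lambda>x. measure_pmf.expectation (q x) f)"
  using assms by (simp add: pmf_expectation_bind[of "set_pmf p"] integral_measure_pmf[of "set_pmf p"])

lemma mean_pmf_cong:
  fixes f g :: "'b \<Rightarrow> 'c::{banach, second_countable_topology}"
  assumes "\<And>x. x \<in> set_pmf p \<Longrightarrow> f x = g x"
  shows "measure_pmf.expectation p f = measure_pmf.expectation p g"
  by (rule integral_cong_AE) (use assms in \<open>simp_all add: AE_measure_pmf_iff\<close>)

lemma abs_mean_pmf_le:
  fixes f :: "'b \<Rightarrow> real"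
  assumes fin: "finite (set_pmf p)" and C: "\<And>x. x \<in> set_pmf p \<Longrightarrow> \<bar>f x\<bar> \<le> C"
  shows "\<bar>measure_pmf.expectation p f\<bar> \<le> C"
proof -
  have "\<bar>measure_pmf.expectation p f\<bar> \<le> measure_pmf.expectation p (\<lambda>x. \<bar>f x\<bar>)" by (rule integral_abs_bound)
  also have "\<dots> \<le> measure_pmf.expectation p (\<lambda>_. C)"
    by (rule integral_mono_AE) (simp_all add: integrable_measure_pmf_finite[OF fin] AE_measure_pmf_iff C)
  finally show ?thesis by simp
qed

lemma mean_from_0 [simp]: "mean_from e 0 h f = f h"
  by (simp add: integral_measure_pmf[of "{h}"])

lemma mean_from_add: "mean_from e (n + m) h f = mean_from e n h (\<lambda>h'. mean_from e m h' f)"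
  unfolding walk_from_add by (rule mean_bind_finite) simp_all

lemma mean_from_mono:
  assumes "\<And>h'. h' \<in> set_pmf (walk_from e n h) \<Longrightarrow> f h' \<le> g h'"
  shows "mean_from e n h f \<le> mean_from e n h g"
  by (rule integral_mono_AE) (use assms in \<open>simp_all add: AE_measure_pmf_iff\<close>)

locale drift_sequence =
  fixes e :: "nat \<Rightarrow> real"
  assumes nonneg: "0 \<le> e n" and less_1: "e n < 1"
begin

lemma abs_drift_le: "\<bar>drift e h\<bar> \<le> e (count_list h 0)"
  using nonneg[of "count_list h 0"] by (auto simp: drift_def abs_mult sgn_if)

lemma abs_drift_less_1: "\<bar>drift e h\<bar> < 1"
  using abs_drift_le[of h] less_1[of "count_list h 0"] by linarith

lemma drift_bounds: "- 1 < drift e h" "drift e h < 1"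
  using abs_drift_less_1[of h] by linarith+

lemma mean_step: "measure_pmf.expectation (step_pmf e h) f = step_mean e h f"
  unfolding step_pmf_def step_mean_def using drift_bounds[of h]
  by (simp add: field_simps)

lemma mean_from_Suc: "mean_from e (Suc n) h f = step_mean e h (\<lambda>h'. mean_from e n h' f)"
  unfolding walk_from.simps by (subst mean_bind_finite) (simp_all add: mean_step)

lemma mean_from_Suc_right: "mean_from e (Suc n) h f = mean_from e n h (\<lambda>h'. step_mean e h' f)"
  unfolding walk_from_Suc_right by (subst mean_bind_finite) (simp_all add: mean_step)

lemma step_mean_mono:
  assumes "f ((hd h + 1) # h) \<le> g ((hd h + 1) # h)" "f ((hd h - 1) # h) \<le> g ((hd h - 1) # h)"
  shows "step_mean e h f \<le> step_mean e h g"
  unfolding step_mean_def using assms drift_bounds[of h] by (intro add_mono mult_left_mono) auto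

text \<open>
  The optional stopping arguments below are all of this form: stopping is built into the function
  \<open>Z\<close>, which becomes constant on the histories that have reached the target.
\<close>

lemma mean_from_supermartingale:
  assumes "\<And>l h'. l < n \<Longrightarrow> h' \<in> set_pmf (walk_from e l h) \<Longrightarrow> step_mean e h' (Z (Suc l)) \<le> Z l h'"
  shows "mean_from e n h (Z n) \<le> Z 0 h"
  using assms
proof (induction n)
  case (Suc n)
  have "mean_from e (Suc n) h (Z (Suc n)) \<le> mean_from e n h (Z n)"
    unfolding mean_from_Suc_right by (rule mean_from_mono) (simp add: Suc.prems)
  also have "\<dots> \<le> Z 0 h" by (rule Suc.IH) (simp add: Suc.prems)
  finally show ?case .
qed simp

lemma mean_from_submartingale:
  assumes "\<And>l h'. l < n \<Longrightarrow> h' \<in> set_pmf (walk_from e l h) \<Longrightarrow> Z l h' \<le> step_mean e h' (Z (Suc l))"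
  shows "Z 0 h \<le> mean_from e n h (Z n)"
  using assms
proof (induction n)
  case (Suc n)
  have "Z 0 h \<le> mean_from e n h (Z n)" by (rule Suc.IH) (simp add: Suc.prems)
  also have "\<dots> \<le> mean_from e (Suc n) h (Z (Suc n))"
    unfolding mean_from_Suc_right by (rule mean_from_mono) (simp add: Suc.prems)
  finally show ?case .
qed simp

end

definition history :: "(nat \<Rightarrow> 'a \<Rightarrow> int) \<Rightarrow> nat \<Rightarrow> 'a \<Rightarrow> int list" where
  "history X n \<omega> = rev (map (\<lambda>k. X k \<omega>) [0..<Suc n])"

lemma history_0: "history X 0 \<omega> = [X 0 \<omega>]"
  by (simp add: history_def)

lemma history_Suc: "history X (Suc n) \<omega> = X (Suc n) \<omega> # history X n \<omega>"
  by (simp add: history_def)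

lemma length_history [simp]: "length (history X n \<omega>) = Suc n"
  by (simp add: history_def)

lemma history_nth: "k \<le> n \<Longrightarrow> rev (history X n \<omega>) ! k = X k \<omega>"
  by (simp add: history_def del: upt_Suc)

lemma history_eq_iff:
  assumes "length h = Suc n"
  shows "history X n \<omega> = h \<longleftrightarrow> (\<forall>k\<le>n. X k \<omega> = rev h ! k)"
proof
  assume "history X n \<omega> = h"
  then show "\<forall>k\<le>n. X k \<omega> = rev h ! k" using history_nth by metis
next
  assume *: "\<forall>k\<le>n. X k \<omega> = rev h ! k"
  have "rev (history X n \<omega>) = rev h"
    by (rule nth_equalityI) (use assms * in \<open>auto simp: history_nth\<close>)
  then show "history X n \<omega> = h" by simp
qed

lemma measurable_history:
  assumes "\<And>n. X n \<in> measurable M (count_space UNIV)"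
  shows "history X n \<in> measurable M (count_space UNIV)"
proof (induction n)
  case 0
  show ?case unfolding history_0[abs_def]
    by (rule measurable_compose[OF assms]) simp
next
  case (Suc n)
  have "(\<lambda>\<omega>. (X (Suc n) \<omega>, history X n \<omega>)) \<in> measurable M (count_space UNIV \<Otimes>\<^sub>M count_space UNIV)"
    using assms Suc by (intro measurable_Pair)
  then have *: "(\<lambda>\<omega>. (X (Suc n) \<omega>, history X n \<omega>)) \<in> measurable M (count_space UNIV)"
    by (simp add: pair_measure_countable)
  show ?case unfolding history_Suc[abs_def]
    using measurable_compose[OF *, of "\<lambda>(x, h). x # h" "count_space UNIV"] by simp
qed

text \<open>
  The counter \<open>\<eta>\<^sub>n\<close> omits time \<open>0\<close> but starts at \<open>1\<close>; for a path from the origin this agrees with the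
  number of all zeros.
\<close>

lemma card_zeros_eq_count_list:
  assumes "length h = Suc n" "last h = 0"
  shows "1 + card {i \<in> {0<..n}. rev h ! i = 0} = count_list h (0::int)"
proof -
  have "count_list h 0 = count_list (rev h) 0" by simp
  also have "\<dots> = card {i. i < length (rev h) \<and> rev h ! i = 0}"
    by (simp only: count_list_eq_length_filter length_filter_conv_card) (metis (lifting))
  also have "{i. i < length (rev h) \<and> rev h ! i = 0} = insert 0 {i \<in> {0<..n}. rev h ! i = 0}"
  proof -
    have "rev h ! 0 = 0"
      using assms by (cases h rule: rev_cases) simp_all
    then show ?thesis using assms(1) by (auto simp: less_Suc_eq_le)
  qed
  also have "card \<dots> = Suc (card {i \<in> {0<..n}. rev h ! i = 0})" by (subst card_insert_disjoint) auto
  finally show ?thesis by simp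
qed

lemma (in drift_sequence) pmf_walk_from_Suc:
  assumes "length h = Suc n" "last h = 0"
  shows "pmf (walk_from e (Suc n) [0]) (j # h) =
    pmf (walk_from e n [0]) h * step_prob e (count_list h 0) (hd h) j"
proof -
  have "pmf (walk_from e (Suc n) [0]) (j # h) = mean_from e (Suc n) [0] (indicator {j # h})"
    by (simp add: measure_pmf_single)
  also have "\<dots> = mean_from e n [0] (\<lambda>h'. step_mean e h' (indicator {j # h}))"
    by (rule mean_from_Suc_right)
  also have "\<dots> = mean_from e n [0] (\<lambda>h'. indicator {h} h' * step_prob e (count_list h 0) (hd h) j)"
    by (rule mean_pmf_cong)
       (auto simp: step_mean_def step_prob_def drift_def indicator_def)
  also have "\<dots> = pmf (walk_from e n [0]) h * step_prob e (count_list h 0) (hd h) j"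
    by (simp add: measure_pmf_single)
  finally show ?thesis .
qed

text \<open>
  The elementary conditional probabilities determine the law of each finite history, so that
  all further estimates are computations with finitely supported distributions.
\<close>

theorem (in drift_sequence) distr_history:
  assumes walk: "drift_walk M e X"
  shows "distr M (count_space UNIV) (history X n) = measure_pmf (walk_from e n [0])"
proof -
  interpret prob_space M using walk by (simp add: drift_walk_def)
  have X: "X n \<in> measurable M (count_space UNIV)" for n using walk by (simp add: drift_walk_def)
  note hX[measurable] = measurable_history[OF X]
  note X[measurable]
  have X0: "AE \<omega> in M. X 0 \<omega> = 0" using walk by (simp add: drift_walk_def)
  have cond: "\<P>(\<omega> in M. X (Suc n) \<omega> = j \<bar> \<forall>k\<le>n. X k \<omega> = x k \<and> visits X k \<omega> = m k) = step_prob e (m n) (x n) j"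
    if "\<P>(\<omega> in M. \<forall>k\<le>n. X k \<omega> = x k \<and> visits X k \<omega> = m k) > 0" for n x m j
    using walk that unfolding drift_walk_def by blast
  have point: "\<P>(\<omega> in M. history X n \<omega> = h) = pmf (walk_from e n [0]) h" for n h
  proof (induction n arbitrary: h)
    case 0
    have "\<P>(\<omega> in M. history X 0 \<omega> = h) = \<P>(\<omega> in M. [0] = h)"
      by (rule finite_measure_eq_AE) (use X0 in \<open>auto simp: history_0\<close>)
    also have "\<dots> = pmf (walk_from e 0 [0]) h" by (simp add: prob_space indicator_def)
    finally show ?case .
  next
    case (Suc n)
    show ?case
    proof (cases "\<exists>j h'. h = j # h' \<and> h' \<in> set_pmf (walk_from e n [0])")
      case False
      have "h \<notin> set_pmf (walk_from e (Suc n) [0])"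
      proof
        assume "h \<in> set_pmf (walk_from e (Suc n) [0])"
        then obtain h' where h': "h' \<in> set_pmf (walk_from e n [0])" "h \<in> set_pmf (step_pmf e h')"
          unfolding walk_from_Suc_right by auto
        with set_pmf_step[OF h'(2)] False show False by blast
      qed
      then have 0: "pmf (walk_from e (Suc n) [0]) h = 0" by (simp only: set_pmf_iff not_not)
      show ?thesis
      proof (cases h)
        case Nil
        then have "\<P>(\<omega> in M. history X (Suc n) \<omega> = h) = 0" by (simp add: history_Suc)
        with 0 show ?thesis by simp
      next
        case (Cons j h')
        with False have "pmf (walk_from e n [0]) h' = 0" by (simp add: set_pmf_iff)
        then have "\<P>(\<omega> in M. history X n \<omega> = h') = 0" using Suc by simp
        moreover have "\<P>(\<omega> in M. history X (Suc n) \<omega> = h) \<le> \<P>(\<omega> in M. history X n \<omega> = h')"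
          by (rule finite_measure_mono) (auto simp: history_Suc Cons)
        ultimately show ?thesis using 0 measure_nonneg by (metis antisym)
      qed
    next
      case True
      then obtain j h' where h: "h = j # h'" and h': "h' \<in> set_pmf (walk_from e n [0])" by blast
      from set_pmf_walk_from[OF h'] have len: "length h' = Suc n" "last h' = 0" by auto
      define x where "x = (\<lambda>k. rev h' ! k)"
      define m where "m = (\<lambda>k. 1 + card {i \<in> {0<..k}. x i = 0})"
      have ev: "(\<forall>k\<le>n. X k \<omega> = x k \<and> visits X k \<omega> = m k) \<longleftrightarrow> history X n \<omega> = h'" for \<omega>
      proof -
        have "visits X k \<omega> = m k" if "\<forall>k\<le>n. X k \<omega> = x k" "k \<le> n" for k
        proof -
          have "{i \<in> {0<..k}. X i \<omega> = 0} = {i \<in> {0<..k}. x i = 0}" using that by auto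
          then show ?thesis by (simp add: visits_def m_def)
        qed
        then show ?thesis unfolding history_eq_iff[OF len(1)] x_def by blast
      qed
      have pos: "\<P>(\<omega> in M. \<forall>k\<le>n. X k \<omega> = x k \<and> visits X k \<omega> = m k) > 0"
        unfolding ev Suc using h' by (simp add: pmf_positive)
      have xn: "x n = hd h'" using len(1) by (cases h') (simp_all add: x_def nth_append)
      have "\<P>(\<omega> in M. history X (Suc n) \<omega> = h) = \<P>(\<omega> in M. X (Suc n) \<omega> = j \<and> history X n \<omega> = h')"
        by (simp add: h history_Suc)
      also have "\<dots> = \<P>(\<omega> in M. X (Suc n) \<omega> = j \<bar> history X n \<omega> = h') * \<P>(\<omega> in M. history X n \<omega> = h')"
        using pos unfolding ev by (simp add: cond_prob_def)
      also have "\<dots> = step_prob e (m n) (x n) j * pmf (walk_from e n [0]) h'"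
        using cond[OF pos, of j] unfolding ev Suc by simp
      also have "\<dots> = pmf (walk_from e (Suc n) [0]) h"
        using card_zeros_eq_count_list[OF len] unfolding h pmf_walk_from_Suc[OF len] xn
        by (simp add: m_def x_def)
      finally show ?thesis .
    qed
  qed
  show ?thesis
  proof (rule measure_eqI_countable[where A = UNIV])
    fix h
    have "emeasure (distr M (count_space UNIV) (history X n)) {h} = ennreal \<P>(\<omega> in M. history X n \<omega> = h)"
      by (subst emeasure_distr[OF hX]) (auto simp: emeasure_eq_measure intro!: arg_cong[where f = "measure M"])
    then show "emeasure (distr M (count_space UNIV) (history X n)) {h} = emeasure (measure_pmf (walk_from e n [0])) {h}"
      by (simp add: point emeasure_pmf_single)
  qed simp_all
qed

lemma (in drift_sequence) expectation_history:
  assumes walk: "drift_walk M e X"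
  shows "(\<integral>\<omega>. f (history X n \<omega>) \<partial>M) = mean_from e n [0] f"
proof -
  have X: "history X n \<in> measurable M (count_space UNIV)"
    by (rule measurable_history) (use walk in \<open>simp add: drift_walk_def\<close>)
  show ?thesis
    unfolding distr_history[OF walk, symmetric] by (subst integral_distr[OF X]) simp_all
qed

text \<open>
  The visit counter is at least \<open>1\<close> from the start.
\<close>

lemma drift_walk_cong:
  assumes walk: "drift_walk M e X" and eq: "\<And>n. n \<ge> 1 \<Longrightarrow> e n = e' n"
  shows "drift_walk M e' X"
  unfolding drift_walk_def
proof (intro conjI allI impI)
  fix n x m j
  assume pos: "\<P>(\<omega> in M. \<forall>k\<le>n. X k \<omega> = x k \<and> visits X k \<omega> = m k) > 0"
  then have "{\<omega> \<in> space M. \<forall>k\<le>n. X k \<omega> = x k \<and> visits X k \<omega> = m k} \<noteq> {}" by (metis less_irrefl measure_empty)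
  then obtain \<omega> where "visits X n \<omega> = m n" by blast
  then have "e (m n) = e' (m n)" by (intro eq) (simp add: visits_def)
  then have "step_prob e' (m n) (x n) j = step_prob e (m n) (x n) j" by (simp add: step_prob_def)
  then show "\<P>(\<omega> in M. X (Suc n) \<omega> = j \<bar> \<forall>k\<le>n. X k \<omega> = x k \<and> visits X k \<omega> = m k) = step_prob e' (m n) (x n) j"
    using walk pos unfolding drift_walk_def by simp
qed (use walk in \<open>simp_all add: drift_walk_def\<close>)

section \<open>Visits to the origin, displacements, and comparison with the simple walk\<close>

lemma cosh_lower: 
  fixes x :: real assumes "0 \<le> x" shows "1 + x\<^sup>2 / 4 \<le> cosh x"
  using exp_lower_Taylor_quadratic[OF assms] exp_ge_add_one_self[of "- x"]
  by (simp add: cosh_def power2_eq_square)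

lemma exp_minus_upper:
  fixes x :: real assumes "0 \<le> x" shows "exp (- x) \<le> 1 - x + x\<^sup>2"
proof -
  have "(1 - x + x\<^sup>2) * (1 + x + x\<^sup>2 / 2) = 1 + (x ^ 2 + x ^ 3 + x ^ 4) / 2"
    by (simp add: field_simps power2_eq_square power3_eq_cube power4_eq_xxxx)
  then have "1 \<le> (1 - x + x\<^sup>2) * (1 + x + x\<^sup>2 / 2)" using assms by simp
  also have "\<dots> \<le> (1 - x + x\<^sup>2) * exp x"
  proof (rule mult_left_mono[OF exp_lower_Taylor_quadratic[OF assms]])
    have "1 - x + x\<^sup>2 = (1 - x / 2)\<^sup>2 + 3 / 4 * x\<^sup>2" by (simp add: power2_eq_square algebra_simps)
    then show "0 \<le> 1 - x + x\<^sup>2" by simp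
  qed
  finally show ?thesis by (simp add: exp_minus field_simps)
qed

lemma cosh_upper:
  fixes x :: real assumes "0 \<le> x" "x \<le> 1" shows "cosh x \<le> 1 + x\<^sup>2"
  using exp_bound[OF assms] exp_minus_upper[OF assms(1)] by (simp add: cosh_def)

lemma sinh_upper:
  fixes x :: real assumes "0 \<le> x" "x \<le> 1" shows "sinh x \<le> 2 * x"
proof -
  have "x\<^sup>2 \<le> x" using assms by (simp add: power2_eq_square mult_left_le)
  then show ?thesis
    using exp_bound[OF assms] exp_ge_add_one_self[of "- x"] assms(1) by (simp add: sinh_def)
qed

lemma abs_sinh_le_cosh: "\<bar>sinh (x::real)\<bar> \<le> cosh x"
  by (simp add: sinh_def cosh_def abs_le_iff)

lemma cosh_le_exp: "0 \<le> x \<Longrightarrow> cosh (x::real) \<le> exp x"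
  by (simp add: cosh_def)

lemma half_exp_le_cosh: "exp x / 2 \<le> cosh (x::real)"
  by (simp add: cosh_def)

lemma cosh_abs_mono:
  fixes x y :: real assumes "0 \<le> x" "x \<le> \<bar>y\<bar>" shows "cosh x \<le> cosh y"
proof -
  have "cosh x \<le> cosh \<bar>y\<bar>" using assms cosh_real_nonneg_le_iff[of x "\<bar>y\<bar>"] by simp
  then show ?thesis by (simp add: abs_if split: if_splits)
qed

context drift_sequence
begin

text \<open>
  A drift towards the origin can only increase the mean of a decreasing function of the distance.
\<close>

lemma step_exp_neg_abs:
  fixes \<theta> :: real
  assumes "0 \<le> \<theta>" "hd h \<noteq> 0"
  shows "cosh \<theta> * exp (- \<theta> * of_int \<bar>hd h\<bar>) \<le> step_mean e h (\<lambda>h'. exp (- \<theta> * of_int \<bar>hd h'\<bar>))"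
proof -
  define a where "a = e (count_list h 0)"
  have a: "0 \<le> a" using nonneg by (simp add: a_def)
  have split: "exp (- \<theta> * of_int (n + 1)) = exp (- \<theta> * of_int n) * exp (- \<theta>)"
    "exp (- \<theta> * of_int (n - 1)) = exp (- \<theta> * of_int n) * exp \<theta>" for n :: int
    by (simp_all add: exp_add[symmetric] algebra_simps)
  have "step_mean e h (\<lambda>h'. exp (- \<theta> * of_int \<bar>hd h'\<bar>))
      = exp (- \<theta> * of_int \<bar>hd h\<bar>) * ((1 - a) / 2 * exp (- \<theta>) + (1 + a) / 2 * exp \<theta>)"
  proof (cases "hd h > 0")
    case True
    then have eqs: "\<bar>hd h + 1\<bar> = \<bar>hd h\<bar> + 1" "\<bar>hd h - 1\<bar> = \<bar>hd h\<bar> - 1" "drift e h = a"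
      by (auto simp: drift_def a_def)
    have "(1 - a) / 2 * (x * y) + (1 + a) / 2 * (x * z) = x * ((1 - a) / 2 * y + (1 + a) / 2 * z)"
      for x y z :: real by (simp add: algebra_simps)
    then show ?thesis unfolding step_mean_def list.sel eqs split .
  next
    case False
    with assms(2) have eqs: "\<bar>hd h + 1\<bar> = \<bar>hd h\<bar> - 1" "\<bar>hd h - 1\<bar> = \<bar>hd h\<bar> + 1" "drift e h = - a"
      by (auto simp: drift_def a_def)
    have "(1 - - a) / 2 * (x * z) + (1 + - a) / 2 * (x * y) = x * ((1 - a) / 2 * y + (1 + a) / 2 * z)"
      for x y z :: real by (simp add: algebra_simps)
    then show ?thesis unfolding step_mean_def list.sel eqs split .
  qed
  also have "(1 - a) / 2 * exp (- \<theta>) + (1 + a) / 2 * exp \<theta> = cosh \<theta> + a / 2 * (exp \<theta> - exp (- \<theta>))"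
    by (simp add: cosh_def field_simps)
  also have "exp (- \<theta> * of_int \<bar>hd h\<bar>) * \<dots> \<ge> exp (- \<theta> * of_int \<bar>hd h\<bar>) * cosh \<theta>"
    using a assms(1) by (intro mult_left_mono) auto
  finally show ?thesis by (simp add: mult.commute)
qed

text \<open>
  Let \<open>T\<close> be the time at which the counter exceeds \<open>m\<close>. An excursion of the simple walk is started by
  one step and returns from distance \<open>1\<close>, so \<open>lam\<^sup>T\<close> has mean \<open>kap\<^sup>m\<close> there, and the drift makes
  excursions shorter. Hence the mean is at least \<open>kap\<^sup>m\<close>, which is incompatible with a large
  probability of \<open>T > n\<close>.
\<close>

lemma few_visits_exp:
  fixes \<theta> :: real
  assumes \<theta>: "0 \<le> \<theta>" and m: "1 \<le> m"
  defines "lam \<equiv> 1 / cosh \<theta>" and "kap \<equiv> exp (- \<theta>) / cosh \<theta>"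
  shows "kap ^ m \<le> 1 - (1 - lam ^ n) * mean_from e n [0] (indicator {h. count_list h 0 \<le> m})"
proof -
  have cosh: "1 \<le> cosh \<theta>" by (rule cosh_real_ge_1)
  have lam: "0 < lam" "lam \<le> 1" "lam * cosh \<theta> = 1" using cosh by (auto simp: lam_def)
  have kap: "0 < kap" "kap \<le> 1" "kap = lam * exp (- \<theta>)"
    using cosh \<theta> by (auto simp: kap_def lam_def field_simps) (meson exp_le_one_iff cosh order_trans neg_le_0_iff_le)
  \<comment> \<open>The value \<open>1\<close> at the stopping time, instead of \<open>lam\<^sup>T\<close>, can only increase the mean.\<close>
  define Z where "Z = (\<lambda>n h. if m < count_list h (0::int) then 1 else
    lam ^ n * exp (- \<theta> * of_int \<bar>hd h\<bar>) * kap ^ (m - count_list h 0 + (if hd h = 0 then 1 else 0)))"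
  have "Z 0 [0] \<le> mean_from e n [0] (Z n)"
  proof (rule mean_from_submartingale)
    fix l h
    let ?c = "count_list h (0::int)"
    show "Z l h \<le> step_mean e h (Z (Suc l))"
    proof (cases "m < ?c")
      case True
      then have "Z l h = 1" "\<And>y. Z (Suc l) (y # h) = 1" by (auto simp: Z_def)
      then show ?thesis by (simp add: step_mean_def field_simps)
    next
      case c: False
      show ?thesis
      proof (cases "hd h = 0")
        case True
        then have "Z (Suc l) ((hd h + 1) # h) = lam ^ Suc l * exp (- \<theta>) * kap ^ (m - ?c)"
          "Z (Suc l) ((hd h - 1) # h) = lam ^ Suc l * exp (- \<theta>) * kap ^ (m - ?c)"
          "Z l h = lam ^ Suc l * exp (- \<theta>) * kap ^ (m - ?c)"
          using c by (simp_all add: Z_def kap(3))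
        then show ?thesis by (simp add: step_mean_def field_simps)
      next
        case False
        have next_le: "lam ^ Suc l * kap ^ (m - ?c) * exp (- \<theta> * of_int \<bar>y\<bar>) \<le> Z (Suc l) (y # h)" for y
        proof (cases "y = 0")
          case y: True
          show ?thesis
          proof (cases "?c = m")
            case True
            then show ?thesis using y lam by (simp add: Z_def power_le_one mult_le_one)
          next
            case False
            with c have "m - ?c = Suc (m - Suc ?c)" by simp
            then show ?thesis using y c False by (simp add: Z_def)
          qed
        next
          case False
          then show ?thesis using c by (simp add: Z_def mult_ac)
        qed
        have "Z l h = lam ^ Suc l * kap ^ (m - ?c) * (cosh \<theta> * exp (- \<theta> * of_int \<bar>hd h\<bar>))"
          using c False lam(3) by (simp add: Z_def mult_ac)
        also have "\<dots> \<le> lam ^ Suc l * kap ^ (m - ?c) * step_mean e h (\<lambda>h'. exp (- \<theta> * of_int \<bar>hd h'\<bar>))"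
          using step_exp_neg_abs[OF \<theta> False] lam kap by (intro mult_left_mono) auto
        also have "\<dots> = step_mean e h (\<lambda>h'. lam ^ Suc l * kap ^ (m - ?c) * exp (- \<theta> * of_int \<bar>hd h'\<bar>))"
          by (simp add: step_mean_def algebra_simps)
        also have "\<dots> \<le> step_mean e h (Z (Suc l))"
          by (rule step_mean_mono) (unfold list.sel, rule next_le, rule next_le)
        finally show ?thesis .
      qed
    qed
  qed
  also have "mean_from e n [0] (Z n) \<le>
      mean_from e n [0] (\<lambda>h. 1 - (1 - lam ^ n) * indicator {h. count_list h 0 \<le> m} h)"
  proof (rule mean_from_mono)
    fix h
    have "exp (- \<theta> * of_int \<bar>hd h\<bar>) * kap ^ j \<le> 1" for j
      using \<theta> kap by (intro mult_le_one power_le_one) auto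
    then have "lam ^ n * (exp (- \<theta> * of_int \<bar>hd h\<bar>) * kap ^ j) \<le> lam ^ n" for j
      using lam by (intro mult_left_le) auto
    then show "Z n h \<le> 1 - (1 - lam ^ n) * indicator {h. count_list h 0 \<le> m} h"
      by (simp add: Z_def indicator_def mult.assoc not_less)
  qed
  also have "\<dots> = 1 - (1 - lam ^ n) * mean_from e n [0] (indicator {h. count_list h 0 \<le> m})"
    by simp
  finally show ?thesis using m by (simp add: Z_def)
qed

text \<open>
  The choice \<open>\<theta> = 2 / \<surd>n\<close> makes \<open>cosh \<theta>\<^sup>n\<close> at least \<open>2\<close> while \<open>\<theta> m\<close> is of the order \<open>m / \<surd>n\<close>.
\<close>

proposition few_visits:
  assumes m: "1 \<le> m" and n: "1 \<le> n"
  shows "mean_from e n [0] (indicator {h. count_list h 0 \<le> m}) \<le> 8 * real m / sqrt (real n)"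
proof -
  define \<theta> where "\<theta> = 2 / sqrt (real n)"
  have \<theta>: "0 \<le> \<theta>" "real n * \<theta>\<^sup>2 = 4" using n by (auto simp: \<theta>_def power_divide)
  define p where "p = mean_from e n [0] (indicator {h. count_list h 0 \<le> m})"
  have p: "0 \<le> p" unfolding p_def by (rule integral_nonneg_AE) simp
  have "2 = 1 + real n * (\<theta>\<^sup>2 / 4)" using \<theta>(2) by simp
  also have "\<dots> \<le> (1 + \<theta>\<^sup>2 / 4) ^ n" by (rule Bernoulli_inequality) (rule order_trans[of _ 0], auto)
  also have "\<dots> \<le> cosh \<theta> ^ n" by (rule power_mono[OF cosh_lower[OF \<theta>(1)]]) auto
  finally have "(1 / cosh \<theta>) ^ n \<le> 1 / 2" by (simp add: power_divide frac_le)
  then have "1 / 2 * p \<le> (1 - (1 / cosh \<theta>) ^ n) * p" using p by (intro mult_right_mono) auto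
  moreover have "(exp (- \<theta>) / cosh \<theta>) ^ m \<le> 1 - (1 - (1 / cosh \<theta>) ^ n) * p"
    unfolding p_def by (rule few_visits_exp[OF \<theta>(1) m])
  moreover have "1 - 2 * \<theta> * real m \<le> (exp (- \<theta>) / cosh \<theta>) ^ m"
  proof -
    have "1 - 2 * \<theta> * real m \<le> exp (- (2 * \<theta> * real m))" using exp_ge_add_one_self[of "- (2 * \<theta> * real m)"] by simp
    also have "\<dots> = (exp (- \<theta>) / exp \<theta>) ^ m"
      by (simp add: exp_of_nat_mult[symmetric] exp_diff[symmetric] mult_ac)
    also have "\<dots> \<le> (exp (- \<theta>) / cosh \<theta>) ^ m"
      by (intro power_mono divide_left_mono cosh_le_exp \<theta>) auto
    finally show ?thesis .
  qed
  ultimately have "p \<le> 4 * \<theta> * real m" by linarith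
  then show ?thesis by (simp add: p_def \<theta>_def)
qed

text \<open>
  Doob's maximal inequality for \<open>cosh (\<theta> (X - x\<^sub>0))\<close>, which in one step is multiplied on average by at
  most \<open>cosh \<theta> + E sinh \<theta>\<close>. The hypothesis is stated for the product of the drift with the hyperbolic
  sine because it holds with \<open>E = 0\<close>, however large the drift, if \<open>x\<^sub>0\<close> is the origin.
\<close>

proposition maximal_displacement:
  fixes \<theta> E r :: real and h\<^sub>0 :: "int list"
  assumes \<theta>: "0 \<le> \<theta>" and E: "0 \<le> E" and r: "0 < r"
    and drift: "\<And>l h. h \<in> set_pmf (walk_from e l h\<^sub>0) \<Longrightarrow>
      - drift e h * sinh (\<theta> * of_int (hd h - hd h\<^sub>0)) \<le> E * cosh (\<theta> * of_int (hd h - hd h\<^sub>0))"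
  shows "mean_from e n h\<^sub>0 (indicator {h. \<exists>y\<in>set (take n h). r \<le> of_int \<bar>y - hd h\<^sub>0\<bar>}) * cosh (\<theta> * r)
    \<le> (cosh \<theta> + E * sinh \<theta>) ^ n"
proof -
  define b where "b = cosh \<theta> + E * sinh \<theta>"
  have b: "1 \<le> b" using cosh_real_ge_1[of \<theta>] E \<theta> by (simp add: b_def add_increasing2)
  define hit where "hit = (\<lambda>l h. \<exists>y\<in>set (take l h). r \<le> of_int \<bar>y - hd h\<^sub>0\<bar>)"
  define Z where "Z = (\<lambda>l h. if hit l h then cosh (\<theta> * r)
    else cosh (\<theta> * of_int (hd h - hd h\<^sub>0)) * b ^ (n - l))"
  have "mean_from e n h\<^sub>0 (Z n) \<le> Z 0 h\<^sub>0"
  proof (rule mean_from_supermartingale)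
    fix l h assume l: "l < n" and h: "h \<in> set_pmf (walk_from e l h\<^sub>0)"
    show "step_mean e h (Z (Suc l)) \<le> Z l h"
    proof (cases "hit l h")
      case True
      then have "\<And>y. hit (Suc l) (y # h)" by (auto simp: hit_def)
      then show ?thesis using True by (simp add: Z_def step_mean_def field_simps)
    next
      case False
      let ?u = "\<theta> * of_int (hd h - hd h\<^sub>0)"
      have next_le: "Z (Suc l) (y # h) \<le> cosh (\<theta> * of_int (y - hd h\<^sub>0)) * b ^ (n - Suc l)" for y
      proof (cases "hit (Suc l) (y # h)")
        case True
        with False have "r \<le> of_int \<bar>y - hd h\<^sub>0\<bar>" by (auto simp: hit_def)
        then have "\<theta> * r \<le> \<bar>\<theta> * of_int (y - hd h\<^sub>0)\<bar>"
          using \<theta> by (simp add: abs_mult mult_left_mono)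
        then have "cosh (\<theta> * r) \<le> cosh (\<theta> * of_int (y - hd h\<^sub>0))"
          using \<theta> r by (intro cosh_abs_mono) auto
        also have "\<dots> \<le> \<dots> * b ^ (n - Suc l)"
          using mult_left_mono[OF one_le_power[OF b, of "n - Suc l"], of "cosh (\<theta> * of_int (y - hd h\<^sub>0))"]
          by simp
        finally show ?thesis using True by (simp add: Z_def)
      qed (simp add: Z_def)
      have "step_mean e h (Z (Suc l)) \<le>
          step_mean e h (\<lambda>h'. cosh (\<theta> * of_int (hd h' - hd h\<^sub>0)) * b ^ (n - Suc l))"
        by (rule step_mean_mono) (unfold list.sel, rule next_le, rule next_le)
      also have "\<dots> = (cosh ?u * cosh \<theta> - drift e h * sinh ?u * sinh \<theta>) * b ^ (n - Suc l)"
      proof -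
        have *: "\<theta> * of_int (hd h + 1 - hd h\<^sub>0) = ?u + \<theta>" "\<theta> * of_int (hd h - 1 - hd h\<^sub>0) = ?u - \<theta>"
          by (simp_all add: algebra_simps)
        show ?thesis unfolding step_mean_def list.sel * cosh_add cosh_diff by (simp add: field_simps)
      qed
      also have "\<dots> \<le> (cosh ?u * b) * b ^ (n - Suc l)"
      proof (rule mult_right_mono)
        have "(- drift e h * sinh ?u) * sinh \<theta> \<le> (E * cosh ?u) * sinh \<theta>"
          using drift[OF h] \<theta> by (intro mult_right_mono) auto
        then show "cosh ?u * cosh \<theta> - drift e h * sinh ?u * sinh \<theta> \<le> cosh ?u * b"
          by (simp add: b_def algebra_simps)
      qed (use b in simp)
      also have "\<dots> = Z l h"
      proof -
        have "n - l = Suc (n - Suc l)" using l by simp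
        then show ?thesis using False by (simp add: Z_def)
      qed
      finally show ?thesis .
    qed
  qed
  moreover have "Z 0 h\<^sub>0 = b ^ n" by (simp add: Z_def hit_def)
  moreover have "mean_from e n h\<^sub>0 (\<lambda>h. indicator {h. hit n h} h * cosh (\<theta> * r)) \<le> mean_from e n h\<^sub>0 (Z n)"
    by (rule mean_from_mono) (simp add: Z_def indicator_def)
  ultimately show ?thesis by (simp add: b_def hit_def)
qed

corollary displacement_bound:
  fixes \<theta> E r :: real
  assumes \<theta>: "0 \<le> \<theta>" "\<theta> \<le> 1" and E: "0 \<le> E" and r: "0 < r"
    and drift: "\<And>l h. h \<in> set_pmf (walk_from e l h\<^sub>0) \<Longrightarrow>
      - drift e h * sinh (\<theta> * of_int (hd h - hd h\<^sub>0)) \<le> E * cosh (\<theta> * of_int (hd h - hd h\<^sub>0))"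
  shows "mean_from e n h\<^sub>0 (indicator {h. \<exists>y\<in>set (take n h). r \<le> of_int \<bar>y - hd h\<^sub>0\<bar>})
    \<le> 2 * exp (real n * (\<theta>\<^sup>2 + 2 * E * \<theta>) - \<theta> * r)" (is "?p \<le> _")
proof -
  have "0 \<le> ?p" by (rule integral_nonneg_AE) simp
  then have "?p * (exp (\<theta> * r) / 2) \<le> ?p * cosh (\<theta> * r)"
    by (intro mult_left_mono half_exp_le_cosh)
  also have "\<dots> \<le> (cosh \<theta> + E * sinh \<theta>) ^ n" by (rule maximal_displacement[OF \<theta>(1) E r drift])
  also have "\<dots> \<le> exp (\<theta>\<^sup>2 + 2 * E * \<theta>) ^ n"
  proof (rule power_mono)
    have "cosh \<theta> + E * sinh \<theta> \<le> 1 + \<theta>\<^sup>2 + E * (2 * \<theta>)"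
      by (intro add_mono mult_left_mono cosh_upper sinh_upper \<theta> E)
    also have "\<dots> \<le> exp (\<theta>\<^sup>2 + 2 * E * \<theta>)"
      using exp_ge_add_one_self[of "\<theta>\<^sup>2 + 2 * E * \<theta>"] by (simp add: algebra_simps)
    finally show "cosh \<theta> + E * sinh \<theta> \<le> exp (\<theta>\<^sup>2 + 2 * E * \<theta>)" .
  qed (use E \<theta> cosh_real_ge_1[of \<theta>] in \<open>simp add: add_nonneg_nonneg\<close>)
  also have "\<dots> = exp (real n * (\<theta>\<^sup>2 + 2 * E * \<theta>))" by (simp add: exp_of_nat_mult)
  finally have "?p * (exp (\<theta> * r) / 2) * (2 / exp (\<theta> * r)) \<le> exp (real n * (\<theta>\<^sup>2 + 2 * E * \<theta>)) * (2 / exp (\<theta> * r))"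
    by (rule mult_right_mono) simp
  then show ?thesis by (simp add: exp_diff mult.commute)
qed

text \<open>
  A drift towards the starting point does not help to move away from it.
\<close>

lemma displacement_from_origin:
  fixes \<theta> r :: real
  assumes "0 \<le> \<theta>" "\<theta> \<le> 1" "0 < r"
  shows "mean_from e n [0] (indicator {h. \<exists>y\<in>set (take n h). r \<le> of_int \<bar>y\<bar>})
    \<le> 2 * exp (real n * \<theta>\<^sup>2 - \<theta> * r)"
proof -
  have "0 \<le> drift e h * sinh (\<theta> * of_int (hd h))" for h
    using nonneg[of "count_list h 0"] assms(1)
    by (auto simp: drift_def sgn_if mult_nonneg_nonpos intro!: mult_nonneg_nonneg)
  then show ?thesis
    using displacement_bound[where E = 0 and h\<^sub>0 = "[0]", OF assms(1,2) _ assms(3)] by simp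
qed

lemma displacement_small_drift:
  fixes \<theta> r E :: real
  assumes "0 \<le> \<theta>" "\<theta> \<le> 1" "0 < r" and h\<^sub>0: "m \<le> count_list h\<^sub>0 0" and E: "\<And>j. m \<le> j \<Longrightarrow> e j \<le> E"
  shows "mean_from e n h\<^sub>0 (indicator {h. \<exists>y\<in>set (take n h). r \<le> of_int \<bar>y - hd h\<^sub>0\<bar>})
    \<le> 2 * exp (real n * (\<theta>\<^sup>2 + 2 * E * \<theta>) - \<theta> * r)"
proof (rule displacement_bound[OF assms(1,2) _ assms(3)])
  show E0: "0 \<le> E" using E[of m] nonneg[of m] by simp
  fix l h assume "h \<in> set_pmf (walk_from e l h\<^sub>0)"
  then obtain g where "h = g @ h\<^sub>0" using set_pmf_walk_from by blast
  then have "m \<le> count_list h 0" using h\<^sub>0 by simp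
  from E[OF this] abs_drift_le[of h] have d: "\<bar>drift e h\<bar> \<le> E" by simp
  let ?u = "\<theta> * of_int (hd h - hd h\<^sub>0)"
  have "- drift e h * sinh ?u \<le> \<bar>drift e h\<bar> * \<bar>sinh ?u\<bar>" by (metis abs_ge_self abs_minus_cancel abs_mult)
  also have "\<dots> \<le> E * cosh ?u" by (intro mult_mono d abs_sinh_le_cosh E0) simp
  finally show "- drift e h * sinh ?u \<le> E * cosh ?u" .
qed

end

definition coin :: "int pmf" where
  "coin = map_pmf (\<lambda>b. if b then 1 else - 1) (bernoulli_pmf (1 / 2))"

abbreviation coin_mean :: "nat \<Rightarrow> (int list \<Rightarrow> 'a) \<Rightarrow> 'a :: {banach, second_countable_topology}" where
  "coin_mean n \<equiv> measure_pmf.expectation (replicate_pmf n coin)"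

primrec extend :: "int list \<Rightarrow> int list \<Rightarrow> int list" where
  "extend [] h = h"
| "extend (c # cs) h = extend cs ((hd h + c) # h)"

lemma finite_set_coin [simp]: "finite (set_pmf coin)"
  by (simp add: coin_def finite_subset[OF subset_UNIV])

lemma finite_set_coins [simp]: "finite (set_pmf (replicate_pmf n coin))"
  by (induction n) simp_all

interpretation simple: drift_sequence "\<lambda>_. 0"
  by unfold_locales auto

abbreviation simple_mean :: "nat \<Rightarrow> int list \<Rightarrow> (int list \<Rightarrow> real) \<Rightarrow> real" where
  "simple_mean \<equiv> mean_from (\<lambda>_. 0)"

lemma drift_zero [simp]: "drift (\<lambda>_. 0) h = 0"
  by (simp add: drift_def)

lemma walk_from_simple:
  "walk_from (\<lambda>_. 0) n h = map_pmf (\<lambda>cs. extend cs h) (replicate_pmf n coin)"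
proof (induction n arbitrary: h)
  case (Suc n)
  have "step_pmf (\<lambda>_. 0) h = map_pmf (\<lambda>c. (hd h + c) # h) coin"
    unfolding step_pmf_def coin_def by (auto simp: pmf.map_comp o_def intro!: map_pmf_cong)
  then show ?case
    by (simp add: Suc map_pmf_def bind_assoc_pmf bind_return_pmf)
qed simp

lemma mean_from_simple:
  "simple_mean n h f = coin_mean n (\<lambda>cs. f (extend cs h))"
  by (simp add: walk_from_simple)

lemma length_extend [simp]: "length (extend cs h) = length cs + length h"
  by (induction cs arbitrary: h) simp_all

text \<open>
  \<open>rev h ! k\<close> is the position at time \<open>k\<close>.
\<close>

lemma rev_extend_old: "k < length h \<Longrightarrow> rev (extend cs h) ! k = rev h ! k"
  by (induction cs arbitrary: h) (simp_all add: nth_append)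

lemma rev_extend_new:
  assumes "length h = Suc m" "k \<le> length cs"
  shows "rev (extend cs h) ! (m + k) = hd h + sum_list (take k cs)"
  using assms
proof (induction cs arbitrary: h m k)
  case Nil
  then show ?case by (cases h) (simp_all add: nth_append)
next
  case (Cons c cs)
  show ?case
  proof (cases k)
    case 0
    have "rev (extend cs ((hd h + c) # h)) ! m = rev ((hd h + c) # h) ! m"
      by (rule rev_extend_old) (use Cons.prems in simp)
    also have "\<dots> = hd h" using Cons.prems(1) by (cases h) (simp_all add: nth_append)
    finally show ?thesis using 0 by simp
  next
    case (Suc k')
    then show ?thesis
      using Cons.IH[of "(hd h + c) # h" "Suc m" k'] Cons.prems by (simp add: add.assoc)
  qed
qed

context drift_sequence
begin

text \<open>
  Replace the transition probabilities by symmetric ones, one step after the other. In each step the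
  two probabilities change by half the drift, and the two continuations that they weigh can be
  driven by the same signs: they then differ by a shift of \<open>2\<close>, which \<open>f\<close> feels by at most \<open>2 c\<close>.
\<close>

proposition mean_from_diff_simple:
  assumes h: "m \<le> count_list h 0" and E: "\<And>j. m \<le> j \<Longrightarrow> e j \<le> E" and c: "0 \<le> c"
    and shift: "\<And>h' cs. length h \<le> length h' \<Longrightarrow> Suc (length h' + length cs) = length h + n \<Longrightarrow>
      \<bar>f (extend cs ((hd h' + 1) # h')) - f (extend cs ((hd h' - 1) # h'))\<bar> \<le> 2 * c"
  shows "\<bar>mean_from e n h f - simple_mean n h f\<bar> \<le> real n * (E * c)"
  using h shift
proof (induction n arbitrary: h)
  case (Suc n)
  have E0: "0 \<le> E" using E[of m] nonneg[of m] by simp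
  let ?f = "\<lambda>h'. mean_from e n h' f" and ?g = "\<lambda>h'. simple_mean n h' f"
  let ?u = "(hd h + 1) # h" and ?v = "(hd h - 1) # h" and ?d = "drift e h"
  have IH: "\<bar>?f (x # h) - ?g (x # h)\<bar> \<le> real n * (E * c)" for x
    by (rule Suc.IH) (use Suc.prems in auto)
  have "\<bar>?g ?u - ?g ?v\<bar> = \<bar>coin_mean n (\<lambda>cs. f (extend cs ?u) - f (extend cs ?v))\<bar>"
    unfolding mean_from_simple by (subst Bochner_Integration.integral_diff) (simp_all add: integrable_measure_pmf_finite)
  also have "\<dots> \<le> 2 * c"
    by (rule abs_mean_pmf_le[OF finite_set_coins]) (use Suc.prems(2)[of h] in \<open>auto simp: set_replicate_pmf\<close>)
  finally have uv: "\<bar>?g ?u - ?g ?v\<bar> \<le> 2 * c" .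
  define fu fv gu gv where "fu = ?f ?u" and "fv = ?f ?v" and "gu = ?g ?u" and "gv = ?g ?v"
  note fg = fu_def[symmetric] fv_def[symmetric] gu_def[symmetric] gv_def[symmetric]
  have d: "\<bar>?d\<bar> \<le> E" using abs_drift_le[of h] E[OF Suc.prems(1)] by simp
  have "mean_from e (Suc n) h f - simple_mean (Suc n) h f =
      (1 - ?d) / 2 * (fu - gu) + (1 + ?d) / 2 * (fv - gv) + - ?d / 2 * (gu - gv)"
    unfolding mean_from_Suc simple.mean_from_Suc step_mean_def drift_zero fg by (simp add: field_simps)
  also have "\<bar>\<dots>\<bar> \<le> \<bar>(1 - ?d) / 2 * (fu - gu)\<bar> + \<bar>(1 + ?d) / 2 * (fv - gv)\<bar> + \<bar>- ?d / 2 * (gu - gv)\<bar>"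
    by (rule abs_triangle_ineq[THEN order_trans]) (intro add_right_mono abs_triangle_ineq)
  also have "\<dots> \<le> (1 - ?d) / 2 * (real n * (E * c)) + (1 + ?d) / 2 * (real n * (E * c)) + E / 2 * (2 * c)"
  proof (intro add_mono)
    show "\<bar>(1 - ?d) / 2 * (fu - gu)\<bar> \<le> (1 - ?d) / 2 * (real n * (E * c))"
      "\<bar>(1 + ?d) / 2 * (fv - gv)\<bar> \<le> (1 + ?d) / 2 * (real n * (E * c))"
      unfolding abs_mult using drift_bounds[of h]
        IH[of "hd h + 1", unfolded fg] IH[of "hd h - 1", unfolded fg]
      by (simp_all add: mult_left_mono)
    show "\<bar>- ?d / 2 * (gu - gv)\<bar> \<le> E / 2 * (2 * c)"
      unfolding abs_mult by (rule mult_mono) (use uv[unfolded fg] d E0 in auto)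
  qed
  also have "\<dots> = real (Suc n) * (E * c)" by (simp add: field_simps)
  finally show ?case .
qed simp

end

section \<open>Joint normal limit of the block sums of the simple walk\<close>

lemma mean_coin: "measure_pmf.expectation coin f = (f 1 + f (- 1)) / 2" for f :: "int \<Rightarrow> complex"
  unfolding coin_def integral_map_pmf
  by (subst integral_measure_pmf[of UNIV]) (auto simp: UNIV_bool scaleR_conv_of_real field_simps)

lemma replicate_coin_Suc:
  "replicate_pmf (Suc n) coin = bind_pmf coin (\<lambda>c. map_pmf ((#) c) (replicate_pmf n coin))"
  by (simp add: map_pmf_def)

lemma char_coin_sum:
  "coin_mean n (\<lambda>cs. iexp (s * of_int (sum_list cs))) = of_real (cos s ^ n)"
proof (induction n)
  case (Suc n)
  have "coin_mean (Suc n) (\<lambda>cs. iexp (s * of_int (sum_list cs)))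
    = measure_pmf.expectation coin (\<lambda>c. coin_mean n
        (\<lambda>cs. iexp (s * of_int c) * iexp (s * of_int (sum_list cs))))"
    unfolding replicate_coin_Suc
    by (subst mean_bind_finite) (simp_all add: exp_add[symmetric] algebra_simps)
  also have "\<dots> = (iexp s + iexp (- s)) / 2 * of_real (cos s ^ n)"
    by (simp only: integral_mult_right_zero Suc mean_coin) (simp add: field_simps)
  also have "(iexp s + iexp (- s)) / 2 = of_real (cos s)"
    by (simp add: cos_exp_eq cos_of_real[symmetric])
  finally show ?case by simp
qed (simp add: integral_measure_pmf[of "{[]}"])

definition scaled_normal :: "real \<Rightarrow> real measure" where
  "scaled_normal \<sigma> = distr std_normal_distribution borel (\<lambda>x. \<sigma> * x)"

lemma real_distribution_scaled_normal: "real_distribution (scaled_normal \<sigma>)"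
proof -
  interpret real_distribution std_normal_distribution by (rule real_dist_normal_dist)
  show ?thesis unfolding scaled_normal_def by (rule real_distribution_distr) simp
qed

lemma char_scaled_normal: "char (scaled_normal \<sigma>) t = exp (- ((\<sigma> * t)\<^sup>2) / 2)"
proof -
  have "char (scaled_normal \<sigma>) t = char std_normal_distribution (\<sigma> * t)"
    by (simp add: char_def scaled_normal_def integral_distr mult_ac)
  then show ?thesis by (simp add: char_std_normal_distribution)
qed

lemma cos_power_tendsto:
  assumes p: "p > 0"
  shows "(\<lambda>n. cos (t / sqrt (real n)) ^ (n div p)) \<longlonglongrightarrow> exp (- (t\<^sup>2 / (2 * real p)))"
proof -
  have 1: "(\<lambda>n. real n * ln (cos (t / sqrt (real n)))) \<longlonglongrightarrow> - (t\<^sup>2 / 2)"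
    unfolding power2_eq_square by real_asymp
  have 2: "(\<lambda>n. real (n div p) / real n) \<longlonglongrightarrow> 1 / real p"
  proof (rule tendsto_sandwich)
    have "1 / real p - 1 / real n \<le> real (n div p) / real n" if "n > 0" for n
    proof -
      have "n < p * (n div p) + p" using p by (metis add.commute dividend_less_times_div)
      then have "real n \<le> real p * real (n div p) + real p"
        by (metis less_imp_le of_nat_add of_nat_le_iff of_nat_mult)
      then have "(real n - real p) / (real p * real n) \<le> real p * real (n div p) / (real p * real n)"
        by (intro divide_right_mono) auto
      then show ?thesis using p that by (simp add: diff_divide_distrib)
    qed
    then show "\<forall>\<^sub>F n in sequentially. 1 / real p - 1 / real n \<le> real (n div p) / real n"
      by (auto intro: eventually_sequentiallyI[of 1])
    have "real (n div p) / real n \<le> 1 / real p" if "n > 0" for n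
    proof -
      have "real (p * (n div p)) \<le> real n" by (simp only: of_nat_le_iff times_div_less_eq_dividend)
      then show ?thesis using p that by (simp add: field_simps)
    qed
    then show "\<forall>\<^sub>F n in sequentially. real (n div p) / real n \<le> 1 / real p"
      by (auto intro: eventually_sequentiallyI[of 1])
    show "(\<lambda>n. 1 / real p - 1 / real n) \<longlonglongrightarrow> 1 / real p" by real_asymp
  qed auto
  have 3: "\<forall>\<^sub>F n in sequentially. cos (t / sqrt (real n)) > 0"
  proof -
    have "(\<lambda>n. cos (t / sqrt (real n))) \<longlonglongrightarrow> 1" by real_asymp
    from order_tendstoD(1)[OF this, of 0] show ?thesis by simp
  qed
  have "(\<lambda>n. exp (real (n div p) / real n * (real n * ln (cos (t / sqrt (real n))))))
      \<longlonglongrightarrow> exp (1 / real p * - (t\<^sup>2 / 2))"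
    by (intro tendsto_exp tendsto_mult 1 2)
  moreover have "\<forall>\<^sub>F n in sequentially.
      exp (real (n div p) / real n * (real n * ln (cos (t / sqrt (real n))))) = cos (t / sqrt (real n)) ^ (n div p)"
    using 3 eventually_gt_at_top[of 0]
    by eventually_elim (simp add: exp_of_nat_mult)
  ultimately show ?thesis by (simp add: tendsto_cong field_simps)
qed

text \<open>
  The law of the scaled displacement of the simple walk during a block of \<open>n div p\<close> steps.
\<close>

definition block_law :: "nat \<Rightarrow> nat \<Rightarrow> real measure" where
  "block_law p n = distr (replicate_pmf (n div p) coin) borel (\<lambda>cs. of_int (sum_list cs) / sqrt (real n))"

lemma real_distribution_block_law: "real_distribution (block_law p n)"
  unfolding block_law_def by (rule prob_space.real_distribution_distr[OF measure_pmf.prob_space_axioms]) simp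

lemma block_law_weak_conv:
  assumes p: "p > 0"
  shows "weak_conv_m (block_law p) (scaled_normal (1 / sqrt (real p)))"
proof (rule levy_continuity[OF real_distribution_block_law real_distribution_scaled_normal])
  fix t
  have "char (block_law p n) t = of_real (cos (t / sqrt (real n)) ^ (n div p))" for n
  proof -
    have "char (block_law p n) t = coin_mean (n div p)
        (\<lambda>cs. iexp (t / sqrt (real n) * of_int (sum_list cs)))"
      by (simp add: char_def block_law_def integral_distr mult_ac)
    then show ?thesis by (simp only: char_coin_sum)
  qed
  moreover have "char (scaled_normal (1 / sqrt (real p))) t = of_real (exp (- (t\<^sup>2 / (2 * real p))))"
    unfolding char_scaled_normal using p by (simp add: power_mult_distrib power_divide exp_of_real[symmetric] mult.commute)
  ultimately show "(\<lambda>n. char (block_law p n) t) \<longlonglongrightarrow> char (scaled_normal (1 / sqrt (real p))) t"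
    using tendsto_of_real[OF cos_power_tendsto[OF p, of t], where 'a = complex] by simp
qed

lemma continuous_on_lipschitz_real:
  fixes f :: "real \<Rightarrow> real"
  assumes "\<And>x y. \<bar>f x - f y\<bar> \<le> L * \<bar>x - y\<bar>"
  shows "continuous_on UNIV f"
proof (rule lipschitz_on_continuous_on)
  have "0 \<le> L" using assms[of 1 0] by simp
  then show "L-lipschitz_on UNIV f" using assms by (intro lipschitz_onI) (simp_all add: dist_real_def)
qed

text \<open>
  Weak convergence is uniform on a bounded class of Lipschitz functions, since in Skorohod's
  representation the integrals differ by at most the mean of \<open>min (L \<bar>Y\<^sub>n - Z\<bar>) (2 C)\<close>.
\<close>

lemma weak_conv_uniformly_lipschitz:
  fixes \<mu> :: "nat \<Rightarrow> real measure"
  assumes \<mu>: "\<And>n. real_distribution (\<mu> n)" and \<nu>: "real_distribution \<nu>" and conv: "weak_conv_m \<mu> \<nu>"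
    and L: "0 \<le> L" and C: "0 \<le> C"
  obtains \<delta> where "\<delta> \<longlonglongrightarrow> 0"
    "\<And>n f. (\<And>x. \<bar>f x\<bar> \<le> C) \<Longrightarrow> (\<And>x y. \<bar>f x - f y\<bar> \<le> L * \<bar>x - y\<bar>) \<Longrightarrow>
      \<bar>(\<integral>x. f x \<partial>\<mu> n) - (\<integral>x. f x \<partial>\<nu>)\<bar> \<le> \<delta> n"
proof -
  obtain \<Omega> :: "real measure" and Y Z where \<Omega>: "prob_space \<Omega>"
    and Y[measurable]: "\<And>n. Y n \<in> borel_measurable \<Omega>" and dY: "\<And>n. distr \<Omega> borel (Y n) = \<mu> n"
    and Z: "Z \<in> measurable \<Omega> lborel" and dZ: "distr \<Omega> borel Z = \<nu>"
    and lim: "\<And>x. x \<in> space \<Omega> \<Longrightarrow> (\<lambda>n. Y n x) \<longlonglongrightarrow> Z x"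
    using Skorohod[OF \<mu> \<nu> conv] by blast
  have Z'[measurable]: "Z \<in> borel_measurable \<Omega>" using Z by simp
  interpret prob_space \<Omega> by (rule \<Omega>)
  define \<delta> where "\<delta> = (\<lambda>n. \<integral>\<omega>. min (L * \<bar>Y n \<omega> - Z \<omega>\<bar>) (2 * C) \<partial>\<Omega>)"
  have bound: "\<bar>min (L * \<bar>Y n \<omega> - Z \<omega>\<bar>) (2 * C)\<bar> \<le> 2 * C" for n \<omega> using L C by auto
  have int: "integrable \<Omega> (\<lambda>\<omega>. min (L * \<bar>Y n \<omega> - Z \<omega>\<bar>) (2 * C))" for n
    by (rule bounded_integrable[OF \<Omega> _ bound]) measurable
  show ?thesis
  proof (rule that)
    have "\<delta> \<longlonglongrightarrow> (\<integral>\<omega>. 0 \<partial>\<Omega>)" unfolding \<delta>_def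
    proof (rule integral_dominated_convergence[where w = "\<lambda>_. 2 * C"])
      show "AE \<omega> in \<Omega>. (\<lambda>n. min (L * \<bar>Y n \<omega> - Z \<omega>\<bar>) (2 * C)) \<longlonglongrightarrow> 0"
      proof (rule AE_I2)
        fix \<omega> assume "\<omega> \<in> space \<Omega>"
        then have "(\<lambda>n. min (L * \<bar>Y n \<omega> - Z \<omega>\<bar>) (2 * C)) \<longlonglongrightarrow> min (L * \<bar>Z \<omega> - Z \<omega>\<bar>) (2 * C)"
          by (intro tendsto_intros lim)
        then show "(\<lambda>n. min (L * \<bar>Y n \<omega> - Z \<omega>\<bar>) (2 * C)) \<longlonglongrightarrow> 0" using C by simp
      qed
    qed (use bound in simp_all)
    then show "\<delta> \<longlonglongrightarrow> 0" by simp
    fix n and f :: "real \<Rightarrow> real"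
    assume fC: "\<And>x. \<bar>f x\<bar> \<le> C" and fL: "\<And>x y. \<bar>f x - f y\<bar> \<le> L * \<bar>x - y\<bar>"
    have [measurable]: "f \<in> borel_measurable borel"
      by (rule borel_measurable_continuous_onI[OF continuous_on_lipschitz_real[OF fL]])
    have intf: "integrable \<Omega> (\<lambda>\<omega>. f (Y n \<omega>))" "integrable \<Omega> (\<lambda>\<omega>. f (Z \<omega>))"
      by (rule bounded_integrable[OF \<Omega> _ fC], measurable)+
    have "(\<integral>x. f x \<partial>\<mu> n) - (\<integral>x. f x \<partial>\<nu>) = (\<integral>\<omega>. f (Y n \<omega>) - f (Z \<omega>) \<partial>\<Omega>)"
      unfolding dY[symmetric] dZ[symmetric] using intf by (simp add: integral_distr)
    also have "\<bar>\<dots>\<bar> \<le> (\<integral>\<omega>. \<bar>f (Y n \<omega>) - f (Z \<omega>)\<bar> \<partial>\<Omega>)" by (rule integral_abs_bound)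
    also have "\<dots> \<le> \<delta> n" unfolding \<delta>_def
    proof (rule integral_mono[OF _ int])
      show "integrable \<Omega> (\<lambda>\<omega>. \<bar>f (Y n \<omega>) - f (Z \<omega>)\<bar>)"
        using intf by (intro integrable_abs Bochner_Integration.integrable_diff)
      fix \<omega>
      have "\<bar>f (Y n \<omega>) - f (Z \<omega>)\<bar> \<le> 2 * C" using fC[of "Y n \<omega>"] fC[of "Z \<omega>"] by linarith
      then show "\<bar>f (Y n \<omega>) - f (Z \<omega>)\<bar> \<le> min (L * \<bar>Y n \<omega> - Z \<omega>\<bar>) (2 * C)" using fL by simp
    qed
    finally show "\<bar>(\<integral>x. f x \<partial>\<mu> n) - (\<integral>x. f x \<partial>\<nu>)\<bar> \<le> \<delta> n" .
  qed
qed

text \<open>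
  In particular \<open>h u\<close> depends only on the coordinates of \<open>u\<close> below \<open>R\<close>.
\<close>

definition coord_lipschitz :: "nat \<Rightarrow> real \<Rightarrow> ((nat \<Rightarrow> real) \<Rightarrow> real) \<Rightarrow> bool" where
  "coord_lipschitz R L h \<longleftrightarrow> (\<forall>u v. \<bar>h u - h v\<bar> \<le> L * (\<Sum>j<R. \<bar>u j - v j\<bar>))"

lemma coord_lipschitzD: "coord_lipschitz R L h \<Longrightarrow> \<bar>h u - h v\<bar> \<le> L * (\<Sum>j<R. \<bar>u j - v j\<bar>)"
  by (simp add: coord_lipschitz_def)

lemma coord_lipschitz_cong:
  assumes "coord_lipschitz R L h" "\<And>j. j < R \<Longrightarrow> u j = v j"
  shows "h u = h v"
  using coord_lipschitzD[OF assms(1), of u v] assms(2) by simp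

lemma borel_measurable_coord_lipschitz:
  assumes h: "coord_lipschitz R L h"
  shows "h \<in> borel_measurable borel"
proof (rule borel_measurable_continuous_onI, unfold continuous_on_def, intro ballI)
  fix v :: "nat \<Rightarrow> real"
  have "((\<lambda>w. w i) \<longlongrightarrow> v i) (at v)" for i
    using continuous_on_product_coordinates[of i] unfolding continuous_on_def by blast
  then have "((\<lambda>w. L * (\<Sum>j<R. \<bar>w j - v j\<bar>)) \<longlongrightarrow> L * (\<Sum>j<R. \<bar>v j - v j\<bar>)) (at v)"
    by (intro tendsto_intros)
  then have "((\<lambda>w. L * (\<Sum>j<R. \<bar>w j - v j\<bar>)) \<longlongrightarrow> 0) (at v)" by simp
  then have "((\<lambda>w. h w - h v) \<longlongrightarrow> 0) (at v)"
    by (rule Lim_null_comparison[rotated]) (use coord_lipschitzD[OF h] in simp)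
  then show "(h \<longlongrightarrow> h v) (at v within UNIV)" by (simp add: LIM_zero_iff)
qed

lemma integrable_coord_lipschitz_PiM:
  assumes h: "coord_lipschitz R L h" and C: "\<And>u. \<bar>h u\<bar> \<le> C" and \<nu>: "real_distribution \<nu>"
  shows "integrable (Pi\<^sub>M {..<R} (\<lambda>_. \<nu>)) h"
proof -
  interpret \<nu>: real_distribution \<nu> by (rule \<nu>)
  interpret product_prob_space "\<lambda>_. \<nu>" "{..<R}" by unfold_locales
  have "(\<lambda>u. u i) \<in> borel_measurable (Pi\<^sub>M {..<R} (\<lambda>_. \<nu>))" for i
  proof (cases "i < R")
    case True
    then have "(\<lambda>u. u i) \<in> measurable (Pi\<^sub>M {..<R} (\<lambda>_. \<nu>)) \<nu>" by (intro measurable_component_singleton) simp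
    then show ?thesis by (simp cong: measurable_cong_sets)
  next
    case False
    have "(\<lambda>u. u i) \<in> borel_measurable (Pi\<^sub>M {..<R} (\<lambda>_. \<nu>)) \<longleftrightarrow>
        (\<lambda>u. undefined :: real) \<in> borel_measurable (Pi\<^sub>M {..<R} (\<lambda>_. \<nu>))"
      by (rule measurable_cong) (use False in \<open>auto simp: space_PiM PiE_def extensional_def\<close>)
    then show ?thesis by simp
  qed
  then have "(\<lambda>u. u) \<in> borel_measurable (Pi\<^sub>M {..<R} (\<lambda>_. \<nu>))"
    by (rule measurable_coordinatewise_then_product)
  from measurable_compose[OF this borel_measurable_coord_lipschitz[OF h]]
  show ?thesis by (intro bounded_integrable[OF _ _ C]) (simp_all add: P.prob_space_axioms)
qed

definition block_sums :: "nat \<Rightarrow> nat \<Rightarrow> int list \<Rightarrow> nat \<Rightarrow> real" where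
  "block_sums p n cs j = of_int (sum_list (take (n div p) (drop (j * (n div p)) cs))) / sqrt (real n)"

text \<open>
  Induction on the number of blocks: the last block is integrated out. Exchanging its law for the
  normal law costs an error that is uniform in the values of the other blocks, because the functions of
  the last coordinate that occur are all Lipschitz with the same constant.
\<close>

proposition block_sums_weak_conv:
  assumes p: "p > 0" and h: "coord_lipschitz R L h" and hC: "\<And>u. \<bar>h u\<bar> \<le> C" and L: "0 \<le> L"
  shows "(\<lambda>n. coin_mean (R * (n div p)) (\<lambda>cs. h (block_sums p n cs)))
    \<longlonglongrightarrow> (\<integral>u. h u \<partial>Pi\<^sub>M {..<R} (\<lambda>_. scaled_normal (1 / sqrt (real p))))"
  using h hC
proof (induction R arbitrary: h)
  case 0
  have "h u = h v" for u v by (rule coord_lipschitz_cong[OF 0(1)]) simp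
  then obtain c where "h = (\<lambda>_. c)" by blast
  have "prob_space (Pi\<^sub>M {..<0::nat} (\<lambda>_. scaled_normal (1 / sqrt (real p))))"
    using real_distribution_scaled_normal by (intro prob_space_PiM) (simp add: real_distribution_def)
  then interpret N: prob_space "Pi\<^sub>M {..<0::nat} (\<lambda>_. scaled_normal (1 / sqrt (real p)))" .
  show ?case unfolding \<open>h = (\<lambda>_. c)\<close> using N.prob_space by simp
next
  case (Suc R)
  define \<nu> where "\<nu> = scaled_normal (1 / sqrt (real p))"
  have \<nu>: "real_distribution \<nu>" unfolding \<nu>_def by (rule real_distribution_scaled_normal)
  interpret \<nu>: real_distribution \<nu> by (rule \<nu>)
  interpret product_sigma_finite "\<lambda>_. \<nu>" by unfold_locales
  have C: "0 \<le> C" using Suc.prems(2)[of undefined] by linarith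
  have last_lip: "\<bar>h (u(R := x)) - h (u(R := y))\<bar> \<le> L * \<bar>x - y\<bar>" for u x y
  proof -
    have "(\<Sum>j<Suc R. \<bar>(u(R := x)) j - (u(R := y)) j\<bar>) = \<bar>x - y\<bar>" by simp
    with coord_lipschitzD[OF Suc.prems(1), of "u(R := x)" "u(R := y)"] show ?thesis by (simp only:)
  qed
  have meas[measurable]: "(\<lambda>y. h (u(R := y))) \<in> borel_measurable borel" for u
    by (rule borel_measurable_continuous_onI[OF continuous_on_lipschitz_real[OF last_lip]])
  have int: "integrable \<nu> (\<lambda>y. h (u(R := y)))" for u
  proof (rule bounded_integrable[OF \<nu>.prob_space_axioms _ Suc.prems(2)])
    show "(\<lambda>y. h (u(R := y))) \<in> borel_measurable \<nu>"
      using meas[of u] by (simp only: measurable_cong_sets[OF \<nu>.events_eq_borel refl])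
  qed
  define h' where "h' = (\<lambda>u. \<integral>y. h (u(R := y)) \<partial>\<nu>)"
  have h'C: "\<bar>h' u\<bar> \<le> C" for u
  proof -
    have "\<bar>h' u\<bar> \<le> (\<integral>y. \<bar>h (u(R := y))\<bar> \<partial>\<nu>)" unfolding h'_def by (rule integral_abs_bound)
    also have "\<dots> \<le> (\<integral>y. C \<partial>\<nu>)" using int Suc.prems(2) by (intro integral_mono) auto
    finally show ?thesis using \<nu>.prob_space by simp
  qed
  have h': "coord_lipschitz R L h'" unfolding coord_lipschitz_def
  proof (intro allI)
    fix u v
    have "\<bar>h' u - h' v\<bar> = \<bar>\<integral>y. h (u(R := y)) - h (v(R := y)) \<partial>\<nu>\<bar>"
      unfolding h'_def using int by simp
    also have "\<dots> \<le> (\<integral>y. \<bar>h (u(R := y)) - h (v(R := y))\<bar> \<partial>\<nu>)" by (rule integral_abs_bound)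
    also have "\<dots> \<le> (\<integral>y. L * (\<Sum>j<R. \<bar>u j - v j\<bar>) \<partial>\<nu>)"
    proof (rule integral_mono)
      fix y
      show "\<bar>h (u(R := y)) - h (v(R := y))\<bar> \<le> L * (\<Sum>j<R. \<bar>u j - v j\<bar>)"
      proof -
        have "(\<Sum>j<Suc R. \<bar>(u(R := y)) j - (v(R := y)) j\<bar>) = (\<Sum>j<R. \<bar>u j - v j\<bar>)" by simp
        with coord_lipschitzD[OF Suc.prems(1), of "u(R := y)" "v(R := y)"] show ?thesis by (simp only:)
      qed
    qed (use int in auto)
    finally show "\<bar>h' u - h' v\<bar> \<le> L * (\<Sum>j<R. \<bar>u j - v j\<bar>)" using \<nu>.prob_space by simp
  qed
  obtain \<delta> where \<delta>: "\<delta> \<longlonglongrightarrow> 0"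
    "\<And>n f. (\<And>x. \<bar>f x\<bar> \<le> C) \<Longrightarrow> (\<And>x y. \<bar>f x - f y\<bar> \<le> L * \<bar>x - y\<bar>) \<Longrightarrow>
      \<bar>(\<integral>x. f x \<partial>block_law p n) - (\<integral>x. f x \<partial>\<nu>)\<bar> \<le> \<delta> n"
    using weak_conv_uniformly_lipschitz[OF real_distribution_block_law \<nu>
        block_law_weak_conv[OF p, folded \<nu>_def] L C] by metis
  have diff: "\<bar>coin_mean (Suc R * (n div p)) (\<lambda>cs. h (block_sums p n cs))
      - coin_mean (R * (n div p)) (\<lambda>cs. h' (block_sums p n cs))\<bar> \<le> \<delta> n" for n
  proof -
    let ?q = "n div p"
    define P where "P = replicate_pmf (R * ?q) coin"
    have fin: "finite (set_pmf P)" by (simp add: P_def)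
    have dec: "replicate_pmf (Suc R * ?q) coin = bind_pmf P (\<lambda>xs. map_pmf (\<lambda>ys. xs @ ys) (replicate_pmf ?q coin))"
      unfolding P_def using replicate_pmf_distrib[of "R * ?q" ?q coin] by (simp add: map_pmf_def add.commute)
    have "coin_mean (Suc R * ?q) (\<lambda>cs. h (block_sums p n cs)) =
      measure_pmf.expectation P (\<lambda>xs. coin_mean ?q (\<lambda>ys. h (block_sums p n (xs @ ys))))"
      unfolding dec by (subst mean_bind_finite) (simp_all add: fin)
    also have "\<dots> = measure_pmf.expectation P (\<lambda>xs. \<integral>y. h ((block_sums p n xs)(R := y)) \<partial>block_law p n)"
    proof (rule mean_pmf_cong)
      fix xs assume "xs \<in> set_pmf P"
      then have len: "length xs = R * ?q" by (simp add: P_def set_replicate_pmf)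
      have "(\<integral>y. h ((block_sums p n xs)(R := y)) \<partial>block_law p n) =
        coin_mean ?q (\<lambda>ys. h ((block_sums p n xs)(R := of_int (sum_list ys) / sqrt (real n))))"
        unfolding block_law_def by (subst integral_distr) simp_all
      also have "\<dots> = coin_mean ?q (\<lambda>ys. h (block_sums p n (xs @ ys)))"
      proof (rule mean_pmf_cong)
        fix ys assume "ys \<in> set_pmf (replicate_pmf ?q coin)"
        then have ys: "length ys = ?q" by (simp add: set_replicate_pmf)
        show "h ((block_sums p n xs)(R := of_int (sum_list ys) / sqrt (real n))) = h (block_sums p n (xs @ ys))"
        proof (rule coord_lipschitz_cong[OF Suc.prems(1)])
          fix j assume j: "j < Suc R"
          show "((block_sums p n xs)(R := of_int (sum_list ys) / sqrt (real n))) j = block_sums p n (xs @ ys) j"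
          proof (cases "j = R")
            case True
            then show ?thesis using len ys by (simp add: block_sums_def)
          next
            case False
            then have "Suc j \<le> R" using j by simp
            then have "Suc j * ?q \<le> R * ?q" by (rule mult_le_mono1)
            then have "j * ?q + ?q \<le> length xs" using len by simp
            then have "?q - (length xs - j * ?q) = 0" "j * ?q - length xs = 0" by linarith+
            then show ?thesis using False by (simp add: block_sums_def)
          qed
        qed
      qed
      finally show "coin_mean ?q (\<lambda>ys. h (block_sums p n (xs @ ys))) =
        (\<integral>y. h ((block_sums p n xs)(R := y)) \<partial>block_law p n)" by simp
    qed
    also have "\<bar>\<dots> - measure_pmf.expectation P (\<lambda>xs. h' (block_sums p n xs))\<bar>
      = \<bar>measure_pmf.expectation P (\<lambda>xs. (\<integral>y. h ((block_sums p n xs)(R := y)) \<partial>block_law p n) - h' (block_sums p n xs))\<bar>"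
      by (subst Bochner_Integration.integral_diff) (simp_all add: integrable_measure_pmf_finite[OF fin])
    also have "\<dots> \<le> \<delta> n"
      by (rule abs_mean_pmf_le[OF fin]) (unfold h'_def, rule \<delta>(2), rule Suc.prems(2), rule last_lip)
    finally show ?thesis by (simp add: P_def)
  qed
  have IH: "(\<lambda>n. coin_mean (R * (n div p)) (\<lambda>cs. h' (block_sums p n cs)))
    \<longlonglongrightarrow> (\<integral>u. h' u \<partial>Pi\<^sub>M {..<R} (\<lambda>_. \<nu>))"
    unfolding \<nu>_def by (rule Suc.IH[OF h' h'C])
  have "(\<lambda>n. coin_mean (Suc R * (n div p)) (\<lambda>cs. h (block_sums p n cs))
      - coin_mean (R * (n div p)) (\<lambda>cs. h' (block_sums p n cs))) \<longlonglongrightarrow> 0"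
    by (rule Lim_null_comparison[OF _ \<delta>(1)]) (use diff in simp)
  from tendsto_add[OF this IH]
  have "(\<lambda>n. coin_mean (Suc R * (n div p)) (\<lambda>cs. h (block_sums p n cs)))
    \<longlonglongrightarrow> (\<integral>u. h' u \<partial>Pi\<^sub>M {..<R} (\<lambda>_. \<nu>))" by simp
  moreover have "(\<integral>u. h u \<partial>Pi\<^sub>M {..<Suc R} (\<lambda>_. \<nu>)) = (\<integral>u. h' u \<partial>Pi\<^sub>M {..<R} (\<lambda>_. \<nu>))"
    unfolding lessThan_Suc h'_def
    by (rule product_integral_insert)
       (use integrable_coord_lipschitz_PiM[OF Suc.prems \<nu>] in \<open>simp_all add: lessThan_Suc\<close>)
  ultimately show ?case unfolding \<nu>_def by simp
qed

section \<open>Replacing the rescaled path by a polygon with few vertices\<close>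

lemma polygon_functional_cong:
  assumes "path_lipschitz k G" "p > 0" "\<And>i. i \<le> p * k + 1 \<Longrightarrow> v i = w i"
  shows "G (polygon p v) = G (polygon p w)"
proof -
  have "\<bar>G (polygon p v) - G (polygon p w)\<bar> \<le> real k * 0"
    by (rule path_lipschitzD[OF assms(1)], rule polygon_diff_le[OF assms(2)]) (use assms(3) in auto)
  then show ?thesis by simp
qed

text \<open>
  The polygon is built from the increments over the blocks \<open>1, 2, \<dots>\<close>; on the block \<open>0\<close>, where the
  drift may be large, it vanishes. The truncated subtraction makes the sum empty at both ends of this
  block.
\<close>

definition increment_functional :: "nat \<Rightarrow> (cpath \<Rightarrow> real) \<Rightarrow> (nat \<Rightarrow> real) \<Rightarrow> real" where
  "increment_functional p G u = G (polygon p (\<lambda>i. \<Sum>j<i - 1. u j))"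

lemma coord_lipschitz_increment_functional:
  assumes G: "path_lipschitz k G" and p: "p > 0"
  shows "coord_lipschitz (p * k) (real k) (increment_functional p G)"
  unfolding coord_lipschitz_def increment_functional_def
proof (intro allI path_lipschitzD[OF G] polygon_diff_le[OF p])
  fix u v :: "nat \<Rightarrow> real" and i assume i: "i \<le> p * k + 1"
  have "\<bar>(\<Sum>j<i - 1. u j) - (\<Sum>j<i - 1. v j)\<bar> \<le> (\<Sum>j<i - 1. \<bar>u j - v j\<bar>)"
    by (simp only: sum_subtractf[symmetric] sum_abs)
  also have "\<dots> \<le> (\<Sum>j<p * k. \<bar>u j - v j\<bar>)"
    by (rule sum_mono2) (use i in auto)
  finally show "\<bar>(\<Sum>j<i - 1. u j) - (\<Sum>j<i - 1. v j)\<bar> \<le> (\<Sum>j<p * k. \<bar>u j - v j\<bar>)" .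
qed

lemma sum_block_sums:
  "(\<Sum>j<l. block_sums p n cs j) = of_int (sum_list (take (l * (n div p)) cs)) / sqrt (real n)"
proof (induction l)
  case (Suc l)
  have "take (Suc l * (n div p)) cs = take (l * (n div p)) cs @ take (n div p) (drop (l * (n div p)) cs)"
    by (simp add: take_add[symmetric] add.commute)
  then show ?case unfolding sum.lessThan_Suc Suc unfolding block_sums_def by (simp add: add_divide_distrib)
qed simp

text \<open>
  The vertices, at times that are multiples of \<open>n div p\<close>, of the path with its first block
  flattened.
\<close>

definition grid_values :: "nat \<Rightarrow> nat \<Rightarrow> (nat \<Rightarrow> int) \<Rightarrow> nat \<Rightarrow> real" where
  "grid_values p n x i =
     (if i = 0 then 0 else of_int (x (i * (n div p)) - x (n div p)) / sqrt (real n))"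

lemma rescaled_path_eq_polygon:
  assumes "n > 0"
  shows "rescaled_path X n \<omega> = polygon n (\<lambda>j. of_int (X j \<omega>) / sqrt (real n))"
  using assms by (simp add: rescaled_path_def polygon_def)

text \<open>
  The time \<open>i / p\<close> of a vertex corresponds to the step \<open>n i / p\<close>, which is ahead of \<open>i (n div p)\<close> by at
  most \<open>i\<close> steps. As the blocks have more than \<open>p k\<close> steps, the steps between two vertices lie within
  two consecutive blocks.
\<close>

lemma rescaled_path_near_grid_polygon:
  fixes x :: "nat \<Rightarrow> int"
  assumes G: "path_lipschitz k G" and p: "p > 0" and q: "p * k + 1 \<le> n div p" and x0: "x 0 = 0"
    and osc: "\<And>i l. i \<le> p * k + 1 \<Longrightarrow> l \<le> n div p \<Longrightarrow>
      \<bar>of_int (x (i * (n div p) + l) - x (i * (n div p)))\<bar> \<le> d * sqrt (real n)"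
  shows "\<bar>G (polygon n (\<lambda>j. of_int (x j) / sqrt (real n))) - G (polygon p (grid_values p n x))\<bar>
    \<le> real k * (4 * d)"
proof (rule path_lipschitzD[OF G])
  fix t :: real assume t: "0 \<le> t" "t \<le> real k"
  define q where "q = n div p"
  have q1: "p * k + 1 \<le> q" using q by (simp add: q_def)
  have n: "n > 0" using q by (cases "n = 0") auto
  then have sn: "sqrt (real n) > 0" by simp
  have osc': "\<bar>of_int (x (i * q + l)) / sqrt (real n) - of_int (x (i * q)) / sqrt (real n)\<bar> \<le> d"
    if "i \<le> p * k + 1" "l \<le> q" for i l
  proof -
    have "\<bar>of_int (x (i * q + l)) / sqrt (real n) - of_int (x (i * q)) / sqrt (real n)\<bar>
        = \<bar>of_int (x (i * q + l) - x (i * q))\<bar> / sqrt (real n)"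
      using sn by (simp add: diff_divide_distrib[symmetric])
    also have "\<dots> \<le> d" using osc[of i l, folded q_def] that sn by (simp add: divide_le_eq)
    finally show ?thesis .
  qed
  define i where "i = nat \<lfloor>real p * t\<rfloor>"
  have pt: "0 \<le> real p * t" using t by simp
  have i: "real i \<le> real p * t" "real p * t < real i + 1" using pt unfolding i_def by linarith+
  have ik: "i \<le> p * k"
  proof -
    have "real p * t \<le> real (p * k)" using t by (simp add: mult_left_mono)
    then show ?thesis unfolding i_def by linarith
  qed
  let ?c = "of_int (x (i * q)) / sqrt (real n)"
  have "\<bar>path_at (polygon n (\<lambda>j. of_int (x j) / sqrt (real n))) t - ?c\<bar> \<le> 2 * d"
  proof (rule polygon_dist_le[OF n t(1)])
    fix j assume j: "j = nat \<lfloor>real n * t\<rfloor> \<or> j = nat \<lfloor>real n * t\<rfloor> + 1"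
    have nt: "0 \<le> real n * t" using t by simp
    have jb: "real n * t < real j + 1" "real j \<le> real n * t + 1" using j nt by linarith+
    have "real i * real q \<le> real p * t * real q" using i(1) by (intro mult_right_mono) auto
    also have "\<dots> = real (p * q) * t" by simp
    also have "\<dots> \<le> real n * t" using t by (intro mult_right_mono) (simp_all only: of_nat_le_iff q_def times_div_less_eq_dividend)
    finally have "real (i * q) < real j + 1" using jb(1) by simp
    then have j1: "i * q \<le> j" by linarith
    have "n < p * (q + 1)" using dividend_less_times_div[OF p, of n] by (simp add: q_def)
    then have "real n \<le> real p * (real q + 1)" by (metis less_imp_le of_nat_1 of_nat_add of_nat_le_iff of_nat_mult)
    then have "real n * t \<le> real p * (real q + 1) * t" using t by (intro mult_right_mono) auto
    also have "\<dots> = (real p * t) * (real q + 1)" by simp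
    also have "\<dots> < (real i + 1) * (real q + 1)" using i(2) by (intro mult_strict_right_mono) auto
    finally have "real j < (real i + 1) * (real q + 1) + 1" using jb(2) by linarith
    also have "\<dots> = real ((i + 1) * q + i + 2)" by (simp add: algebra_simps)
    finally have "j < (i + 1) * q + i + 2" by (simp only: of_nat_less_iff)
    then have "j \<le> (i + 1) * q + (i + 1)" by linarith
    also have "\<dots> \<le> (i + 1) * q + q" using ik q1 by (intro add_left_mono) linarith
    finally have j2: "j \<le> (i + 1) * q + q" .
    show "\<bar>of_int (x j) / sqrt (real n) - ?c\<bar> \<le> 2 * d"
    proof (cases "j \<le> (i + 1) * q")
      case True
      then have "j - i * q \<le> q" by (simp add: algebra_simps)
      from osc'[OF _ this, of i] osc'[of 0 0] j1 ik show ?thesis by simp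
    next
      case False
      then have "j - (i + 1) * q \<le> q" using j2 by simp
      from osc'[OF _ this, of "i + 1"] osc'[of i q] False ik
      show ?thesis by (simp add: add.commute)
    qed
  qed
  moreover have "\<bar>path_at (polygon p (grid_values p n x)) t - ?c\<bar> \<le> 2 * d"
  proof (rule polygon_dist_le[OF p t(1)], fold i_def)
    fix i' assume i': "i' = i \<or> i' = i + 1"
    have d: "0 \<le> d" using osc'[of 0 0] by simp
    have x1: "\<bar>of_int (x q) / sqrt (real n)\<bar> \<le> d" using osc'[of 0 q] x0 by simp
    have x2: "\<bar>of_int (x (i' * q)) / sqrt (real n) - ?c\<bar> \<le> d"
      using i' osc'[of i q] d ik by (auto simp: add.commute)
    show "\<bar>grid_values p n x i' - ?c\<bar> \<le> 2 * d"
    proof (cases "i' = 0")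
      case True
      then show ?thesis using i' x0 d by (simp add: grid_values_def)
    next
      case False
      then have "grid_values p n x i' = of_int (x (i' * q)) / sqrt (real n) - of_int (x q) / sqrt (real n)"
        by (simp add: grid_values_def q_def diff_divide_distrib)
      with x1 x2 show ?thesis by linarith
    qed
  qed
  ultimately show "\<bar>path_at (polygon n (\<lambda>j. of_int (x j) / sqrt (real n))) t - path_at (polygon p (grid_values p n x)) t\<bar> \<le> 4 * d"
    by linarith
qed

context drift_sequence
begin

text \<open>
  After the first block either the walk has rarely visited the origin, which is unlikely, or all later
  drifts are at most \<open>E\<close>, and the comparison with the simple walk applies to the remaining blocks. The
  functional sees only increments after the first block, so for the simple walk its mean is independent
  of the past.
\<close>

lemma grid_functional_near_simple:
  assumes G: "path_lipschitz k G" and C: "\<And>f. \<bar>G f\<bar> \<le> C" and p: "p > 0" and n: "n \<ge> p"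
    and m: "m \<ge> 1" and E: "\<And>j. m \<le> j \<Longrightarrow> e j \<le> E"
  shows "\<bar>mean_from e (n div p + p * k * (n div p)) [0] (\<lambda>h. G (polygon p (grid_values p n (\<lambda>t. rev h ! t))))
      - coin_mean (p * k * (n div p))
          (\<lambda>cs. increment_functional p G (block_sums p n cs))\<bar>
    \<le> 2 * C * (8 * real m / sqrt (real (n div p))) + real (p * k * (n div p)) * (E * (real k / sqrt (real n)))"
    (is "\<bar>mean_from e _ _ ?f - ?S\<bar> \<le> _")
proof -
  define q where "q = n div p"
  define N where "N = p * k * q"
  have q1: "1 \<le> q" using n p by (simp add: q_def Suc_le_eq div_greater_zero_iff)
  have sn: "sqrt (real n) > 0" using n p by simp
  have C0: "0 \<le> C" using C[of undefined] by linarith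
  have simple: "simple_mean N h ?f = ?S" if h: "length h = Suc q" for h
    unfolding mean_from_simple q_def[symmetric] N_def[symmetric]
  proof (rule mean_pmf_cong)
    show "?f (extend cs h) = increment_functional p G (block_sums p n cs)" if "cs \<in> set_pmf (replicate_pmf N coin)" for cs
      unfolding increment_functional_def
    proof (rule polygon_functional_cong[OF G p])
      fix i assume i: "i \<le> p * k + 1"
      from that have cs: "length cs = N" by (simp add: set_replicate_pmf)
      show "grid_values p n (\<lambda>t. rev (extend cs h) ! t) i = (\<Sum>j<i - 1. block_sums p n cs j)"
      proof (cases i)
        case (Suc i')
        then have "i' * q \<le> length cs" using i by (simp add: cs N_def)
        from rev_extend_new[OF h this] rev_extend_new[OF h, of 0 cs]
        show ?thesis using Suc by (simp add: grid_values_def q_def[symmetric] sum_block_sums)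
      qed (simp add: grid_values_def)
    qed
  qed
  have close: "\<bar>mean_from e N h ?f - ?S\<bar> \<le> real N * (E * (real k / sqrt (real n)))"
    if h: "length h = Suc q" "m \<le> count_list h 0" for h
    unfolding simple[OF h(1), symmetric]
  proof (rule mean_from_diff_simple[OF h(2) E])
    fix h' cs :: "int list" assume len: "length h \<le> length h'" "Suc (length h' + length cs) = length h + N"
    let ?u = "\<lambda>t. rev (extend cs ((hd h' + 1) # h')) ! t" and ?v = "\<lambda>t. rev (extend cs ((hd h' - 1) # h')) ! t"
    have old: "?u t = ?v t" if "t < length h'" for t
      using that by (simp add: rev_extend_old nth_append)
    have new: "?u t = ?v t + 2" if "length h' \<le> t" "t \<le> q + N" for t
    proof -
      have "t - length h' \<le> length cs" using that len h(1) by linarith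
      then show ?thesis
        using rev_extend_new[of "(hd h' + 1) # h'" "length h'" "t - length h'" cs]
          rev_extend_new[of "(hd h' - 1) # h'" "length h'" "t - length h'" cs] that(1) by simp
    qed
    have qq: "?u q = ?v q" by (rule old) (use len h in simp)
    have "\<bar>G (polygon p (grid_values p n ?u)) - G (polygon p (grid_values p n ?v))\<bar> \<le> real k * (2 / sqrt (real n))"
    proof (rule path_lipschitzD[OF G], rule polygon_diff_le[OF p])
      fix i assume i: "i \<le> p * k + 1"
      have "i * q \<le> (p * k + 1) * q" using i by (rule mult_le_mono1)
      also have "\<dots> = q + N" by (simp add: N_def)
      finally have "?u (i * q) = ?v (i * q) \<or> ?u (i * q) = ?v (i * q) + 2"
        using old new by (metis not_le)
      then have "\<bar>(?u (i * q) - ?u q) - (?v (i * q) - ?v q)\<bar> \<le> 2" using qq by auto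
      then have "\<bar>of_int ((?u (i * q) - ?u q) - (?v (i * q) - ?v q)) :: real\<bar> \<le> 2" by linarith
      then have "\<bar>of_int ((?u (i * q) - ?u q) - (?v (i * q) - ?v q)) :: real\<bar> / sqrt (real n) \<le> 2 / sqrt (real n)"
        using sn by (intro divide_right_mono) auto
      then show "\<bar>grid_values p n ?u i - grid_values p n ?v i\<bar> \<le> 2 / sqrt (real n)"
        using sn by (simp add: grid_values_def q_def[symmetric] diff_divide_distrib[symmetric])
    qed
    then show "\<bar>?f (extend cs ((hd h' + 1) # h')) - ?f (extend cs ((hd h' - 1) # h'))\<bar> \<le> 2 * (real k / sqrt (real n))"
      by (simp add: mult.commute)
  qed auto
  have E0: "0 \<le> E" using E[of m] nonneg[of m] by simp
  have fC: "\<bar>mean_from e N h ?f\<bar> \<le> C" for h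
    by (rule abs_mean_pmf_le) (simp_all add: C)
  have SC: "\<bar>?S\<bar> \<le> C"
    by (rule abs_mean_pmf_le) (simp_all add: increment_functional_def C)
  have "mean_from e (n div p + p * k * (n div p)) [0] ?f - ?S = mean_from e q [0] (\<lambda>h. mean_from e N h ?f - ?S)"
    unfolding mean_from_add q_def N_def by simp
  then have "\<bar>mean_from e (n div p + p * k * (n div p)) [0] ?f - ?S\<bar> = \<bar>mean_from e q [0] (\<lambda>h. mean_from e N h ?f - ?S)\<bar>"
    by (rule arg_cong)
  also have "\<dots> \<le> mean_from e q [0] (\<lambda>h. \<bar>mean_from e N h ?f - ?S\<bar>)" by (rule integral_abs_bound)
  also have "\<dots> \<le> mean_from e q [0] (\<lambda>h. 2 * C * indicator {h. count_list h 0 \<le> m} h + real N * (E * (real k / sqrt (real n))))"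
  proof (rule mean_from_mono)
    fix h assume "h \<in> set_pmf (walk_from e q [0])"
    then have len: "length h = Suc q" using set_pmf_walk_from by fastforce
    show "\<bar>mean_from e N h ?f - ?S\<bar> \<le> 2 * C * indicator {h. count_list h 0 \<le> m} h + real N * (E * (real k / sqrt (real n)))"
    proof (cases "count_list h 0 \<le> m")
      case True
      moreover have "0 \<le> real N * (E * (real k / sqrt (real n)))" using E0 sn by simp
      ultimately show ?thesis using fC[of h] SC by (simp add: indicator_def)
    next
      case False
      then show ?thesis using close[OF len] by simp
    qed
  qed
  also have "\<dots> = 2 * C * mean_from e q [0] (indicator {h. count_list h 0 \<le> m}) + real N * (E * (real k / sqrt (real n)))"
    by simp
  also have "\<dots> \<le> 2 * C * (8 * real m / sqrt (real q)) + real N * (E * (real k / sqrt (real n)))"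
    by (intro add_right_mono mult_left_mono few_visits[OF m q1]) (use C0 in simp)
  finally show ?thesis by (simp add: N_def q_def)
qed

text \<open>
  The two mechanisms that prevent large oscillations: in the block that starts at time \<open>0\<close> the drift
  points back to the starting point, and in the others it is small unless visits were rare.
\<close>

lemma block_oscillation:
  assumes walk: "drift_walk M e X"
    and \<theta>: "0 \<le> \<theta>" "\<theta> \<le> 1" and r: "0 < r" and m: "m \<ge> 1" and E: "\<And>j. m \<le> j \<Longrightarrow> e j \<le> E" and q: "q \<ge> 1"
  shows "\<P>(\<omega> in M. \<exists>l\<le>q. r \<le> of_int \<bar>X (i * q + l) \<omega> - X (i * q) \<omega>\<bar>)
    \<le> 8 * real m / sqrt (real q) + 2 * exp (real q * (\<theta>\<^sup>2 + 2 * E * \<theta>) - \<theta> * r)"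
proof -
  interpret prob_space M using walk by (simp add: drift_walk_def)
  have [measurable]: "history X j \<in> measurable M (count_space UNIV)" for j
    by (rule measurable_history) (use walk in \<open>simp add: drift_walk_def\<close>)
  define b where "b = 2 * exp (real q * (\<theta>\<^sup>2 + 2 * E * \<theta>) - \<theta> * r)"
  define A where "A = {h. \<exists>y\<in>set (take q h). r \<le> of_int \<bar>y - h ! q\<bar>}"
  have E0: "0 \<le> E" using E[of m] nonneg[of m] by simp
  have ev: "(\<exists>l\<le>q. r \<le> of_int \<bar>X (i * q + l) \<omega> - X (i * q) \<omega>\<bar>) \<longleftrightarrow> history X (i * q + q) \<omega> \<in> A" for \<omega>
  proof -
    let ?h = "history X (i * q + q) \<omega>"
    have nth: "?h ! j = X (i * q + q - j) \<omega>" if "j \<le> i * q + q" for j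
      using history_nth[of "i * q + q - j" "i * q + q" X \<omega>] that by (simp add: rev_nth)
    have set: "set (take q ?h) = (\<lambda>j. X (i * q + q - j) \<omega>) ` {..<q}"
    proof -
      have "set (take q ?h) = (!) ?h ` {0..<q}" by (simp add: nth_image)
      also have "\<dots> = (\<lambda>j. X (i * q + q - j) \<omega>) ` {..<q}"
        by (rule image_cong) (auto simp: nth)
      finally show ?thesis .
    qed
    show ?thesis
    proof
      assume "\<exists>l\<le>q. r \<le> of_int \<bar>X (i * q + l) \<omega> - X (i * q) \<omega>\<bar>"
      then obtain l where l: "l \<le> q" "r \<le> of_int \<bar>X (i * q + l) \<omega> - X (i * q) \<omega>\<bar>" by blast
      with r have "l \<noteq> 0" by (intro notI) simp
      with l have "X (i * q + l) \<omega> \<in> set (take q ?h)"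
        unfolding set by (intro image_eqI[of _ _ "q - l"]) auto
      then show "?h \<in> A" using l(2) nth[of q] by (auto simp: A_def)
    next
      assume "?h \<in> A"
      then obtain j where "j < q" "r \<le> of_int \<bar>X (i * q + q - j) \<omega> - X (i * q) \<omega>\<bar>"
        unfolding A_def mem_Collect_eq set using nth[of q] by auto
      then show "\<exists>l\<le>q. r \<le> of_int \<bar>X (i * q + l) \<omega> - X (i * q) \<omega>\<bar>"
        by (intro exI[of _ "q - j"]) simp
    qed
  qed
  have "\<P>(\<omega> in M. \<exists>l\<le>q. r \<le> of_int \<bar>X (i * q + l) \<omega> - X (i * q) \<omega>\<bar>)
      = (\<integral>\<omega>. indicator A (history X (i * q + q) \<omega>) \<partial>M)"
  proof -
    have "(\<integral>\<omega>. indicator A (history X (i * q + q) \<omega>) \<partial>M)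
        = (\<integral>\<omega>. indicator {\<omega> \<in> space M. history X (i * q + q) \<omega> \<in> A} \<omega> \<partial>M)"
      by (rule Bochner_Integration.integral_cong) (auto simp: indicator_def)
    also have "\<dots> = prob {\<omega> \<in> space M. history X (i * q + q) \<omega> \<in> A}" by simp
    finally show ?thesis unfolding ev by (rule sym)
  qed
  also have "\<dots> = mean_from e (i * q + q) [0] (indicator A)" by (rule expectation_history[OF walk])
  also have "\<dots> = mean_from e (i * q) [0] (\<lambda>h. mean_from e q h (indicator A))"
    by (rule mean_from_add)
  also have "\<dots> = mean_from e (i * q) [0] (\<lambda>h. mean_from e q h (indicator {h'. \<exists>y\<in>set (take q h'). r \<le> of_int \<bar>y - hd h\<bar>}))"
  proof (rule mean_pmf_cong, rule mean_pmf_cong)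
    fix h h' assume "h \<in> set_pmf (walk_from e (i * q) [0])" "h' \<in> set_pmf (walk_from e q h)"
    then obtain g g' where g: "h = g @ [0]" "h' = g' @ h" "length g' = q" using set_pmf_walk_from by blast
    then have "h \<noteq> []" by simp
    then have "h' ! q = hd h" using g(2,3) by (simp add: nth_append hd_conv_nth)
    then show "indicator A h' = indicator {h'. \<exists>y\<in>set (take q h'). r \<le> of_int \<bar>y - hd h\<bar>} h'"
      by (simp add: A_def indicator_def)
  qed
  also have "\<dots> \<le> 8 * real m / sqrt (real q) + b"
  proof (cases "i = 0")
    case True
    have "mean_from e q [0] (indicator {h'. \<exists>y\<in>set (take q h'). r \<le> of_int \<bar>y\<bar>}) \<le> 2 * exp (real q * \<theta>\<^sup>2 - \<theta> * r)"
      by (rule displacement_from_origin[OF \<theta> r])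
    also have "\<dots> \<le> b" unfolding b_def using E0 \<theta> by (simp add: mult_left_mono)
    also have "\<dots> \<le> 8 * real m / sqrt (real q) + b" by simp
    finally show ?thesis using True by simp
  next
    case False
    let ?P = "\<lambda>h. mean_from e q h (indicator {h'. \<exists>y\<in>set (take q h'). r \<le> of_int \<bar>y - hd h\<bar>})"
    have "mean_from e (i * q) [0] ?P \<le> mean_from e (i * q) [0] (\<lambda>h. indicator {h. count_list h 0 \<le> m} h + b)"
    proof (rule mean_from_mono)
      fix h :: "int list"
      have P1: "?P h \<le> 1" by simp
      have b0: "0 \<le> b" by (simp add: b_def)
      show "?P h \<le> indicator {h. count_list h 0 \<le> m} h + b"
      proof (cases "count_list h 0 \<le> m")
        case True
        then show ?thesis using P1 b0 by (simp add: indicator_def add_increasing2)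
      next
        case False
        then have "m \<le> count_list h 0" by simp
        from displacement_small_drift[OF \<theta> r this E] False show ?thesis by (simp add: b_def)
      qed
    qed
    also have "\<dots> = mean_from e (i * q) [0] (indicator {h. count_list h 0 \<le> m}) + b" by simp
    also have "\<dots> \<le> 8 * real m / sqrt (real (i * q)) + b"
      using False q by (intro add_right_mono few_visits[OF m]) simp
    also have "\<dots> \<le> 8 * real m / sqrt (real q) + b"
      using False q by (intro add_right_mono divide_left_mono) (auto simp: Suc_le_eq)
    finally show ?thesis .
  qed
  finally show ?thesis by (simp add: b_def)
qed

end

section \<open>The invariance principle\<close>

lemma brownian_increments_distr:
  assumes W: "standard_brownian_motion W B" and p: "p > 0"
    and h: "coord_lipschitz R L h" and C: "\<And>u. \<bar>h u\<bar> \<le> C" and R: "R > 0"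
  shows "(\<integral>u. h u \<partial>Pi\<^sub>M {..<R} (\<lambda>_. scaled_normal (1 / sqrt (real p)))) =
    (\<integral>\<omega>. h (\<lambda>j. B (real (j + 2) / real p) \<omega> - B (real (j + 1) / real p) \<omega>) \<partial>W)"
proof -
  interpret prob_space W using W by (simp add: standard_brownian_motion_def)
  have B[measurable]: "B t \<in> borel_measurable W" if "t \<ge> 0" for t
    using W that by (simp add: standard_brownian_motion_def)
  define t where "t = (\<lambda>i. real (i + 1) / real p)"
  define D where "D = (\<lambda>i \<omega>. B (t (Suc i)) \<omega> - B (t i) \<omega>)"
  have t: "0 \<le> t i" "t i < t (Suc i)" "t (Suc i) - t i = 1 / real p" for i
    using p by (auto simp: t_def divide_strict_right_mono diff_divide_distrib[symmetric])
  have D[measurable]: "D i \<in> borel_measurable W" for i unfolding D_def using t(1) by measurable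
  have dist: "distr W borel (D i) = scaled_normal (1 / sqrt (real p))" for i
  proof -
    define \<sigma> where "\<sigma> = sqrt (1 / real p)"
    have \<sigma>: "0 < \<sigma>" "\<sigma> = 1 / sqrt (real p)" using p by (auto simp: \<sigma>_def real_sqrt_divide)
    have "\<forall>s t. 0 \<le> s \<and> s < t \<longrightarrow> distributed W lborel (\<lambda>\<omega>. B t \<omega> - B s \<omega>) (normal_density 0 (sqrt (t - s)))"
      using W by (simp add: standard_brownian_motion_def)
    then have "distributed W lborel (\<lambda>\<omega>. B (t (Suc i)) \<omega> - B (t i) \<omega>) (normal_density 0 (sqrt (t (Suc i) - t i)))"
      using t by blast
    then have "distributed W lborel (D i) (normal_density 0 \<sigma>)"
      unfolding t(3) by (simp add: D_def \<sigma>_def)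
    then have "distributed W lborel (\<lambda>\<omega>. (D i \<omega> - 0) / \<sigma>) std_normal_density"
      by (simp only: normal_standard_normal_convert[OF \<sigma>(1)])
    then have "distr W borel (\<lambda>\<omega>. D i \<omega> / \<sigma>) = std_normal_distribution"
      by (simp add: distributed_def cong: distr_cong)
    then have "scaled_normal \<sigma> = distr W borel (\<lambda>\<omega>. \<sigma> * (D i \<omega> / \<sigma>))"
      unfolding scaled_normal_def by (subst (asm) eq_commute) (simp add: distr_distr o_def)
    also have "\<dots> = distr W borel (D i)" using \<sigma> by simp
    finally show ?thesis using \<sigma>(2) by simp
  qed
  have "\<forall>n (t :: nat \<Rightarrow> real). 0 \<le> t 0 \<and> (\<forall>i<n. t i < t (Suc i)) \<longrightarrow>
        indep_vars (\<lambda>_. borel) (\<lambda>i \<omega>. B (t (Suc i)) \<omega> - B (t i) \<omega>) {..<n}"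
    using W by (simp add: standard_brownian_motion_def)
  then have "indep_vars (\<lambda>_. borel) D {..<R}" unfolding D_def using t by blast
  then have joint: "distr W (\<Pi>\<^sub>M i\<in>{..<R}. borel) (\<lambda>x. \<lambda>i\<in>{..<R}. D i x) = Pi\<^sub>M {..<R} (\<lambda>_. scaled_normal (1 / sqrt (real p)))"
    by (subst (asm) indep_vars_iff_distr_eq_PiM') (use R dist in auto)
  have m: "h \<in> borel_measurable (\<Pi>\<^sub>M i\<in>{..<R}. borel)"
  proof -
    have "sets (Pi\<^sub>M {..<R} (\<lambda>_. scaled_normal (1 / sqrt (real p)))) = sets (\<Pi>\<^sub>M i\<in>{..<R}. borel :: real measure)"
      by (rule sets_PiM_cong) (simp_all add: scaled_normal_def)
    from measurable_cong_sets[OF this refl] borel_measurable_integrable[OF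
        integrable_coord_lipschitz_PiM[OF h C real_distribution_scaled_normal]]
    show ?thesis by blast
  qed
  have "(\<integral>u. h u \<partial>Pi\<^sub>M {..<R} (\<lambda>_. scaled_normal (1 / sqrt (real p)))) = (\<integral>\<omega>. h (\<lambda>i\<in>{..<R}. D i \<omega>) \<partial>W)"
    unfolding joint[symmetric] by (rule integral_distr[OF _ m]) measurable
  also have "\<dots> = (\<integral>\<omega>. h (\<lambda>j. D j \<omega>) \<partial>W)"
    by (intro Bochner_Integration.integral_cong refl coord_lipschitz_cong[OF h]) simp
  also have "\<dots> = (\<integral>\<omega>. h (\<lambda>j. B (real (j + 2) / real p) \<omega> - B (real (j + 1) / real p) \<omega>) \<partial>W)"
    by (simp add: D_def t_def add.commute)
  finally show ?thesis .
qed

lemma brownian_path_measurable: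
  assumes W: "standard_brownian_motion W B" and t: "t \<ge> 0"
  shows "(\<lambda>\<omega>. path_at (to_path (\<lambda>t. B t \<omega>)) t) \<in> borel_measurable W"
proof -
  have "(\<lambda>\<omega>. path_at (to_path (\<lambda>t. B t \<omega>)) t) \<in> borel_measurable W \<longleftrightarrow> B t \<in> borel_measurable W"
    by (rule measurable_cong) (use W t in \<open>simp add: standard_brownian_motion_def path_at_to_path\<close>)
  then show ?thesis using W t by (simp add: standard_brownian_motion_def)
qed

text \<open>
  Flattening the first block is harmless in the limit, because Brownian motion is continuous and starts
  at \<open>0\<close>.
\<close>

lemma brownian_increment_functional_tendsto:
  assumes W: "standard_brownian_motion W B" and G: "path_lipschitz k G" and C: "\<And>f. \<bar>G f\<bar> \<le> C" and k: "k > 0"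
  shows "(\<lambda>p. \<integral>u. increment_functional (Suc p) G u \<partial>Pi\<^sub>M {..<Suc p * k} (\<lambda>_. scaled_normal (1 / sqrt (real (Suc p)))))
    \<longlonglongrightarrow> (\<integral>\<omega>. G (to_path (\<lambda>t. B t \<omega>)) \<partial>W)"
proof -
  interpret prob_space W using W by (simp add: standard_brownian_motion_def)
  have B[measurable]: "B t \<in> borel_measurable W" if "t \<ge> 0" for t
    using W that by (simp add: standard_brownian_motion_def)
  have B0: "AE \<omega> in W. B 0 \<omega> = 0" using W by (simp add: standard_brownian_motion_def)
  define D where "D = (\<lambda>p \<omega> j. B (real (j + 2) / real p) \<omega> - B (real (j + 1) / real p) \<omega>)"
  have lip: "coord_lipschitz (p * k) (real k) (increment_functional p G)" if "p > 0" for p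
    by (rule coord_lipschitz_increment_functional[OF G that])
  have C': "\<bar>increment_functional p G u\<bar> \<le> C" for p u by (simp add: increment_functional_def C)
  have "(\<lambda>p. \<integral>\<omega>. increment_functional (Suc p) G (D (Suc p) \<omega>) \<partial>W) \<longlonglongrightarrow> (\<integral>\<omega>. G (to_path (\<lambda>t. B t \<omega>)) \<partial>W)"
  proof (rule integral_dominated_convergence[where w = "\<lambda>_. C"])
    show "(\<lambda>\<omega>. G (to_path (\<lambda>t. B t \<omega>))) \<in> borel_measurable W"
      by (rule borel_measurable_path_lipschitz[OF G brownian_path_measurable[OF W]])
    fix p
    have "(\<lambda>\<omega>. D (Suc p) \<omega>) \<in> borel_measurable W"
      by (rule measurable_coordinatewise_then_product) (simp add: D_def)
    then show "(\<lambda>\<omega>. increment_functional (Suc p) G (D (Suc p) \<omega>)) \<in> borel_measurable W"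
      by (rule measurable_compose[OF _ borel_measurable_coord_lipschitz[OF lip]]) simp
  next
    show "AE \<omega> in W. (\<lambda>p. increment_functional (Suc p) G (D (Suc p) \<omega>)) \<longlonglongrightarrow> G (to_path (\<lambda>t. B t \<omega>))"
      using B0 AE_space
    proof eventually_elim
      case (elim \<omega>)
      have cont: "continuous_on {0..} (\<lambda>t. B t \<omega>)" using W elim(2) by (simp add: standard_brownian_motion_def)
      define f where "f = to_path (\<lambda>t. B t \<omega>)"
      have f: "path_at f t = B t \<omega>" if "t \<ge> 0" for t
        unfolding f_def by (rule path_at_to_path[OF cont that])
      show ?case
      proof (rule tendstoI, fold f_def)
        fix \<epsilon> :: real assume \<epsilon>: "\<epsilon> > 0"
        define b where "b = \<epsilon> / (4 * real k)"
        have b: "b > 0" "real k * (2 * b) < \<epsilon>" using \<epsilon> k by (auto simp: b_def)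
        obtain P where P: "P > 0" "\<And>s t. 0 \<le> s \<Longrightarrow> s \<le> real (k + 1) \<Longrightarrow> 0 \<le> t \<Longrightarrow> t \<le> real (k + 1) \<Longrightarrow>
          \<bar>s - t\<bar> \<le> 1 / real P \<Longrightarrow> \<bar>path_at f s - path_at f t\<bar> \<le> b"
          using path_modulus_tendsto[OF b(1), where k = "k + 1" and f = f] by metis
        have "dist (increment_functional (Suc p) G (D (Suc p) \<omega>)) (G f) < \<epsilon>" if "p \<ge> P" for p
        proof -
          have le: "1 / real (Suc p) \<le> 1 / real P" using that P(1) by (simp add: frac_le)
          have B1: "\<bar>B (1 / real (Suc p)) \<omega>\<bar> \<le> b"
          proof -
            have "1 / real (Suc p) \<le> 1" by simp
            then have "1 / real (Suc p) \<le> real (k + 1)" by (rule order_trans) simp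
            with P(2)[of "1 / real (Suc p)" 0] f[of 0] f[of "1 / real (Suc p)"] elim(1) le
            show ?thesis by simp
          qed
          have "\<bar>increment_functional (Suc p) G (D (Suc p) \<omega>) - G f\<bar> \<le> real k * (b + b)"
            unfolding increment_functional_def
          proof (rule polygon_approximates[OF _ G])
            fix i
            have "(\<Sum>j<l. D (Suc p) \<omega> j) = B (real (l + 1) / real (Suc p)) \<omega> - B (1 / real (Suc p)) \<omega>" for l
              by (induction l) (simp_all add: D_def)
            then show "\<bar>(\<Sum>j<i - 1. D (Suc p) \<omega> j) - path_at f (real i / real (Suc p))\<bar> \<le> b"
              using B1 f[of "real i / real (Suc p)"] elim(1) by (cases i) auto
          qed (use P(2) le in \<open>auto intro: order_trans\<close>)
          then show ?thesis using b by (simp add: dist_real_def)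
        qed
        then show "\<forall>\<^sub>F p in sequentially. dist (increment_functional (Suc p) G (D (Suc p) \<omega>)) (G f) < \<epsilon>"
          unfolding eventually_sequentially by blast
      qed
    qed
  qed (use C' in simp_all)
  moreover have "(\<integral>u. increment_functional (Suc p) G u \<partial>Pi\<^sub>M {..<Suc p * k} (\<lambda>_. scaled_normal (1 / sqrt (real (Suc p)))))
      = (\<integral>\<omega>. increment_functional (Suc p) G (D (Suc p) \<omega>) \<partial>W)" for p
    unfolding D_def by (rule brownian_increments_distr[OF W _ lip C']) (use k in simp_all)
  ultimately show ?thesis by simp
qed

lemma rescaled_path_measurable:
  assumes "drift_walk M e X" "t \<ge> 0"
  shows "(\<lambda>\<omega>. path_at (rescaled_path X n \<omega>) t) \<in> borel_measurable M"
proof -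
  have [measurable]: "X n \<in> measurable M (count_space UNIV)" for n
    using assms(1) by (simp add: drift_walk_def)
  have [measurable]: "(\<lambda>\<omega>. real_of_int (X n \<omega>)) \<in> borel_measurable M" for n
    by measurable
  have "(\<lambda>\<omega>. path_at (rescaled_path X n \<omega>) t) = (\<lambda>\<omega>. interp (\<lambda>k. real_of_int (X k \<omega>)) n t)"
    unfolding rescaled_path_def by (simp add: path_at_to_path[OF continuous_on_interp assms(2)])
  then show ?thesis unfolding interp_def by simp
qed

lemma path_lipschitz_Suc:
  assumes "path_lipschitz k G"
  shows "path_lipschitz (Suc k) G"
  unfolding path_lipschitz_def
proof (intro allI impI)
  fix f g c assume c: "\<forall>t\<in>{0..real (Suc k)}. \<bar>path_at f t - path_at g t\<bar> \<le> c"
  have "\<bar>G f - G g\<bar> \<le> real k * c" by (rule path_lipschitzD[OF assms]) (use c in auto)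
  moreover have "0 \<le> c" using c[THEN bspec, of 0] by simp
  ultimately show "\<bar>G f - G g\<bar> \<le> real (Suc k) * c" by (simp add: algebra_simps)
qed

context drift_sequence
begin

text \<open>
  The error terms come from the approximation by a polygon, from the paths with a large oscillation in
  some block, from rare visits during the first block, and from the drift afterwards.
\<close>

lemma path_functional_estimate:
  assumes walk: "drift_walk M e X"
    and G: "path_lipschitz k G" and C: "\<And>f. \<bar>G f\<bar> \<le> C" and p: "p > 0" and q: "p * k + 1 \<le> n div p"
    and m: "m \<ge> 1" and E: "\<And>j. m \<le> j \<Longrightarrow> e j \<le> E" and d: "d > 0" and \<theta>: "0 \<le> \<theta>" "\<theta> \<le> 1"
  shows "\<bar>(\<integral>\<omega>. G (rescaled_path X n \<omega>) \<partial>M) - coin_mean (p * k * (n div p))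
          (\<lambda>cs. increment_functional p G (block_sums p n cs))\<bar>
    \<le> real k * (4 * d) + 2 * C * (real (p * k + 2) * (8 * real m / sqrt (real (n div p)) +
          2 * exp (real (n div p) * (\<theta>\<^sup>2 + 2 * E * \<theta>) - \<theta> * (d * sqrt (real n)))))
      + 2 * C * (8 * real m / sqrt (real (n div p))) + real (p * k * (n div p)) * (E * (real k / sqrt (real n)))"
proof -
  interpret prob_space M using walk by (simp add: drift_walk_def)
  have [measurable]: "X j \<in> measurable M (count_space UNIV)" for j
    using walk by (simp add: drift_walk_def)
  define q where "q = n div p"
  have q1: "p * k + 1 \<le> q" using q by (simp add: q_def)
  have n: "n > 0" using q by (cases "n = 0") auto
  have np: "n \<ge> p" using q1 by (cases "n < p") (auto simp: q_def)
  have sn: "0 < d * sqrt (real n)" using n d by simp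
  have C0: "0 \<le> C" using C[of undefined] by linarith
  define osc where "osc = (\<lambda>i. {\<omega> \<in> space M. \<exists>l\<le>q. d * sqrt (real n) \<le> of_int \<bar>X (i * q + l) \<omega> - X (i * q) \<omega>\<bar>})"
  define S where "S = (\<lambda>\<omega>. G (polygon p (grid_values p n (\<lambda>t. X t \<omega>))))"
  have osc_meas[measurable]: "osc i \<in> sets M" for i unfolding osc_def by measurable
  define b where "b = 8 * real m / sqrt (real q) + 2 * exp (real q * (\<theta>\<^sup>2 + 2 * E * \<theta>) - \<theta> * (d * sqrt (real n)))"
  have osc_prob: "prob (osc i) \<le> b" for i
    unfolding osc_def b_def by (rule block_oscillation[OF walk \<theta> sn m E]) (use q1 in simp_all)
  have bad: "prob (\<Union>i\<le>p * k + 1. osc i) \<le> real (p * k + 2) * b"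
  proof -
    have "prob (\<Union>i\<le>p * k + 1. osc i) \<le> (\<Sum>i\<le>p * k + 1. prob (osc i))"
      by (rule finite_measure_subadditive_finite) auto
    also have "\<dots> \<le> (\<Sum>i\<le>p * k + 1. b)" by (rule sum_mono) (rule osc_prob)
    finally show ?thesis by (simp add: algebra_simps)
  qed
  have S_hist: "S \<omega> = G (polygon p (grid_values p n (\<lambda>t. rev (history X (q + p * k * q) \<omega>) ! t)))" for \<omega>
    unfolding S_def
  proof (rule polygon_functional_cong[OF G p])
    fix i assume i: "i \<le> p * k + 1"
    have "i * q \<le> (p * k + 1) * q" using i by (rule mult_le_mono1)
    then have "i * q \<le> q + p * k * q" by simp
    then show "grid_values p n (\<lambda>t. X t \<omega>) i = grid_values p n (\<lambda>t. rev (history X (q + p * k * q) \<omega>) ! t) i"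
      by (simp add: grid_values_def q_def[symmetric] history_nth)
  qed
  have S_mean: "(\<integral>\<omega>. S \<omega> \<partial>M) = mean_from e (q + p * k * q) [0] (\<lambda>h. G (polygon p (grid_values p n (\<lambda>t. rev h ! t))))"
    unfolding S_hist by (rule expectation_history[OF walk])
  have S_meas: "S \<in> borel_measurable M"
    unfolding S_hist[abs_def]
    by (rule measurable_compose[OF measurable_history]) simp_all
  have Y_meas: "(\<lambda>\<omega>. G (rescaled_path X n \<omega>)) \<in> borel_measurable M"
    by (rule borel_measurable_path_lipschitz[OF G rescaled_path_measurable[OF walk]])
  have int: "integrable M S" "integrable M (\<lambda>\<omega>. G (rescaled_path X n \<omega>))"
    using bounded_integrable[OF prob_space_axioms S_meas, of C]
      bounded_integrable[OF prob_space_axioms Y_meas C] by (simp_all add: S_def C)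
  have X0: "AE \<omega> in M. X 0 \<omega> = 0" using walk by (simp add: drift_walk_def)
  have "\<bar>(\<integral>\<omega>. G (rescaled_path X n \<omega>) \<partial>M) - (\<integral>\<omega>. S \<omega> \<partial>M)\<bar> = \<bar>\<integral>\<omega>. G (rescaled_path X n \<omega>) - S \<omega> \<partial>M\<bar>"
    using int by simp
  also have "\<dots> \<le> (\<integral>\<omega>. \<bar>G (rescaled_path X n \<omega>) - S \<omega>\<bar> \<partial>M)" by (rule integral_abs_bound)
  also have "\<dots> \<le> (\<integral>\<omega>. real k * (4 * d) + 2 * C * indicator (\<Union>i\<le>p * k + 1. osc i) \<omega> \<partial>M)"
  proof (rule integral_mono_AE)
    show "integrable M (\<lambda>\<omega>. \<bar>G (rescaled_path X n \<omega>) - S \<omega>\<bar>)" using int by simp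
    show "integrable M (\<lambda>\<omega>. real k * (4 * d) + 2 * C * indicator (\<Union>i\<le>p * k + 1. osc i) \<omega>)"
      by (intro Bochner_Integration.integrable_add integrable_mult_right integrable_real_indicator)
         (auto simp: emeasure_eq_measure)
    show "AE \<omega> in M. \<bar>G (rescaled_path X n \<omega>) - S \<omega>\<bar> \<le> real k * (4 * d) + 2 * C * indicator (\<Union>i\<le>p * k + 1. osc i) \<omega>"
      using X0 AE_space
    proof eventually_elim
      case (elim \<omega>)
      show ?case
      proof (cases "\<omega> \<in> (\<Union>i\<le>p * k + 1. osc i)")
        case True
        have "\<bar>G (rescaled_path X n \<omega>) - S \<omega>\<bar> \<le> 2 * C"
          using C[of "rescaled_path X n \<omega>"] C[of "polygon p (grid_values p n (\<lambda>t. X t \<omega>))"] unfolding S_def by linarith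
        moreover have "0 \<le> real k * (4 * d)" using d by simp
        ultimately show ?thesis using True unfolding indicator_simps(1)[OF True] by linarith
      next
        case False
        have "\<bar>G (rescaled_path X n \<omega>) - S \<omega>\<bar> \<le> real k * (4 * d)"
          unfolding S_def rescaled_path_eq_polygon[OF n]
        proof (rule rescaled_path_near_grid_polygon[where x = "\<lambda>t. X t \<omega>", OF G p q elim(1)])
          fix i l assume "i \<le> p * k + 1" "l \<le> n div p"
          then have "\<not> d * sqrt (real n) \<le> of_int \<bar>X (i * q + l) \<omega> - X (i * q) \<omega>\<bar>"
            using False elim(2) by (auto simp: osc_def q_def)
          then show "\<bar>of_int (X (i * (n div p) + l) \<omega> - X (i * (n div p)) \<omega>)\<bar> \<le> d * sqrt (real n)"
            by (simp add: q_def)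
        qed
        then show ?thesis using False by simp
      qed
    qed
  qed
  also have "\<dots> = real k * (4 * d) + 2 * C * prob (\<Union>i\<le>p * k + 1. osc i)"
  proof -
    have "integrable M (indicator (\<Union>i\<le>p * k + 1. osc i) :: _ \<Rightarrow> real)"
      by (rule integrable_real_indicator) (auto simp: emeasure_eq_measure)
    moreover have "(\<integral>\<omega>. indicator A \<omega> \<partial>M) = prob A" if "A \<in> sets M" for A
      using sets.Int_space_eq2[OF that] by simp
    then have "(\<integral>\<omega>. indicator (\<Union>i\<le>p * k + 1. osc i) \<omega> \<partial>M) = prob (\<Union>i\<le>p * k + 1. osc i)"
      by this measurable
    ultimately show ?thesis by (simp add: prob_space del: UN_simps)
  qed
  also have "\<dots> \<le> real k * (4 * d) + 2 * C * (real (p * k + 2) * b)"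
    using bad C0 by (intro add_left_mono mult_left_mono) auto
  finally have 1: "\<bar>(\<integral>\<omega>. G (rescaled_path X n \<omega>) \<partial>M) - (\<integral>\<omega>. S \<omega> \<partial>M)\<bar> \<le> real k * (4 * d) + 2 * C * (real (p * k + 2) * b)" .
  from 1[unfolded S_mean] grid_functional_near_simple[OF G C p np m E]
  show ?thesis unfolding b_def q_def by linarith
qed

end

context drift_sequence
begin

text \<open>
  The parameters are chosen in the order \<open>d\<close> (admitted oscillation), \<open>p\<close> (number of blocks per unit of
  time), \<open>b\<close> (the number of visits regarded as rare is \<open>b \<surd>n\<close>), \<open>c\<close> (the drift after that is at most
  \<open>c / \<surd>n\<close>), and finally \<open>n\<close>. With \<open>\<theta> = p d / (2 \<surd>n)\<close> the probability of a large oscillation decays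
  like \<open>exp (- p d\<^sup>2 / 4)\<close> in one block, which beats the number \<open>p k + 2\<close> of blocks.
\<close>

lemma path_functional_tendsto:
  assumes walk: "drift_walk M e X" and small: "(\<lambda>n. real n * e n) \<longlonglongrightarrow> 0"
    and W: "standard_brownian_motion W B"
    and G: "path_lipschitz k G" and C: "\<And>f. \<bar>G f\<bar> \<le> C" and k: "k > 0"
  shows "(\<lambda>n. \<integral>\<omega>. G (rescaled_path X n \<omega>) \<partial>M) \<longlonglongrightarrow> (\<integral>\<omega>. G (to_path (\<lambda>t. B t \<omega>)) \<partial>W)"
proof (rule tendstoI)
  fix \<eta> :: real assume \<eta>: "\<eta> > 0"
  define \<Phi> where "\<Phi> = (\<lambda>p. \<integral>u. increment_functional p G u \<partial>Pi\<^sub>M {..<p * k} (\<lambda>_. scaled_normal (1 / sqrt (real p))))"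
  define L where "L = (\<integral>\<omega>. G (to_path (\<lambda>t. B t \<omega>)) \<partial>W)"
  have C0: "0 \<le> C" using C[of undefined] by linarith
  define d where "d = \<eta> / (32 * real k)"
  have d: "d > 0" "real k * (4 * d) = \<eta> / 8" using \<eta> k by (auto simp: d_def)
  have "(\<lambda>p. \<Phi> (Suc p)) \<longlonglongrightarrow> L"
    unfolding \<Phi>_def L_def by (rule brownian_increment_functional_tendsto[OF W G C k])
  then have ev1: "\<forall>\<^sub>F p in sequentially. dist (\<Phi> (Suc p)) L < \<eta> / 8"
    by (rule tendstoD) (use \<eta> in simp)
  have "(\<lambda>p. 2 * C * ((real (Suc p) * real k + 2) * (2 * exp (d - real (Suc p) * d\<^sup>2 / 4)))) \<longlonglongrightarrow> 0"
    using d(1) by real_asymp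
  then have ev2: "\<forall>\<^sub>F p in sequentially. 2 * C * ((real (Suc p) * real k + 2) * (2 * exp (d - real (Suc p) * d\<^sup>2 / 4))) < \<eta> / 8"
    by (rule order_tendstoD) (use \<eta> in simp)
  obtain p' where p': "dist (\<Phi> (Suc p')) L < \<eta> / 8"
    "2 * C * ((real (Suc p') * real k + 2) * (2 * exp (d - real (Suc p') * d\<^sup>2 / 4))) < \<eta> / 8"
    using eventually_conj[OF ev1 ev2] by (auto simp: eventually_sequentially)
  define p where "p = Suc p'"
  have p: "p > 0" by (simp add: p_def)
  have p1: "\<bar>\<Phi> p - L\<bar> < \<eta> / 8" using p'(1) by (simp add: p_def dist_real_def)
  have p2: "2 * C * ((real p * real k + 2) * (2 * exp (d - real p * d\<^sup>2 / 4))) < \<eta> / 8"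
    using p'(2) by (simp only: p_def)
  define a where "a = 2 * C * (real (p * k) + 3) * 16 * sqrt (2 * real p)"
  have a: "0 \<le> a" using C0 by (simp add: a_def)
  \<comment> \<open>The two contributions of rare visits add up to \<open>a b\<close>.\<close>
  define b where "b = \<eta> / 8 / (a + 1)"
  have b: "b > 0" "a * b \<le> \<eta> / 8"
  proof -
    show "b > 0" using \<eta> a by (simp add: b_def)
    have "a * b \<le> (a + 1) * b" using \<open>b > 0\<close> by simp
    also have "\<dots> = \<eta> / 8"
    proof -
      have "a + 1 \<noteq> 0" using a by linarith
      then show ?thesis unfolding b_def
        by (metis nonzero_mult_div_cancel_left times_divide_eq_right)
    qed
    finally show "a * b \<le> \<eta> / 8" .
  qed
  define c where "c = min 1 (\<eta> / (8 * (real k)\<^sup>2))"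
  have c: "0 < c" "c \<le> 1" "(real k)\<^sup>2 * c \<le> \<eta> / 8"
  proof -
    show "0 < c" "c \<le> 1" using \<eta> k by (simp_all add: c_def)
    have "(real k)\<^sup>2 * c \<le> (real k)\<^sup>2 * (\<eta> / (8 * (real k)\<^sup>2))"
      by (intro mult_left_mono) (simp_all add: c_def)
    also have "\<dots> = \<eta> / 8" using k by simp
    finally show "(real k)\<^sup>2 * c \<le> \<eta> / 8" .
  qed
  define K where "K = real p * d / 2"
  have K: "K > 0" using p d by (simp add: K_def)
  have "\<forall>\<^sub>F j in sequentially. real j * e j < c * b"
    by (rule order_tendstoD(2)[OF small]) (use c b in simp)
  then obtain J where J: "\<And>j. j \<ge> J \<Longrightarrow> real j * e j < c * b" by (auto simp: eventually_sequentially)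
  have "filterlim (\<lambda>n. sqrt (real n)) at_top sequentially" by real_asymp
  then have root: "\<forall>\<^sub>F n in sequentially. max (max (1 / b) K) (real J / b) \<le> sqrt (real n)"
    unfolding filterlim_at_top by blast
  have coins: "\<forall>\<^sub>F n in sequentially. dist (coin_mean (p * k * (n div p))
      (\<lambda>cs. increment_functional p G (block_sums p n cs))) (\<Phi> p) < \<eta> / 8"
  proof -
    have "\<bar>increment_functional p G u\<bar> \<le> C" for u by (simp add: increment_functional_def C)
    from block_sums_weak_conv[OF p coord_lipschitz_increment_functional[OF G p] this]
    show ?thesis unfolding \<Phi>_def by (rule tendstoD) (use \<eta> in simp_all)
  qed
  show "\<forall>\<^sub>F n in sequentially. dist (\<integral>\<omega>. G (rescaled_path X n \<omega>) \<partial>M) (\<integral>\<omega>. G (to_path (\<lambda>t. B t \<omega>)) \<partial>W) < \<eta>"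
    using root coins eventually_ge_at_top[of "p * (p * k + 1)"] eventually_ge_at_top[of "2 * p"]
  proof eventually_elim
    case (elim n)
    define q where "q = n div p"
    have n: "n > 0" using elim(4) p by (cases "n = 0") auto
    define s where "s = sqrt (real n)"
    have s: "s > 0" "s * s = real n" using n by (auto simp: s_def)
    have s_large: "1 \<le> b * s" "K \<le> s" "real J \<le> b * s"
      using elim(1) b(1) by (auto simp: s_def field_simps)
    have q1: "p * k + 1 \<le> n div p" using elim(3) p by (simp add: less_eq_div_iff_mult_less_eq mult.commute)
    have pq: "real p * real q \<le> real n"
      unfolding q_def by (metis of_nat_le_iff of_nat_mult times_div_less_eq_dividend)
    \<comment> \<open>A block has \<open>n / p\<close> steps up to rounding, which costs at most the factor \<open>2\<close>.\<close>
    have q2: "real n / (2 * real p) \<le> real q"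
    proof -
      have "n < p * q + p" using p dividend_less_times_div[of p n] by (simp add: q_def add.commute)
      then have "2 * n \<le> 2 * (p * q) + n" using elim(4) by linarith
      then have "real n \<le> 2 * (real p * real q)" by (metis (no_types, opaque_lifting) add.commute add_le_cancel_left
            mult_2 of_nat_le_iff of_nat_mult of_nat_numeral)
      then show ?thesis using p by (simp add: field_simps)
    qed
    define m where "m = nat \<lceil>b * s\<rceil>"
    have m: "m \<ge> 1" "real m \<le> 2 * (b * s)" "b * s \<le> real m"
      using s_large(1) unfolding m_def by linarith+
    have E: "e j \<le> c / s" if "m \<le> j" for j
    proof -
      have j: "b * s \<le> real j" "J \<le> j" using m(3) s_large(3) that by linarith+
      have "b * s * e j \<le> real j * e j" using j(1) nonneg by (rule mult_right_mono)
      also have "\<dots> \<le> c * b" using J[OF j(2)] by simp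
      finally have "b * (s * e j) \<le> b * c" by (simp add: mult_ac)
      then have "s * e j \<le> c" using b(1) by simp
      then show ?thesis using s(1) by (simp add: field_simps)
    qed
    have \<theta>: "0 \<le> K / s" "K / s \<le> 1" using K s(1) s_large(2) by auto
    have visits: "8 * real m / sqrt (real q) \<le> 16 * b * sqrt (2 * real p)"
    proof -
      have "8 * real m / sqrt (real q) \<le> 8 * (2 * (b * s)) / sqrt (real n / (2 * real p))"
        using m(2) q2 n p s b by (intro frac_le mult_left_mono real_sqrt_le_mono) auto
      also have "\<dots> = 16 * b * sqrt (2 * real p)"
        using s n p by (simp add: real_sqrt_divide s_def[symmetric])
      finally show ?thesis .
    qed
    have exponent: "real q * ((K / s)\<^sup>2 + 2 * (c / s) * (K / s)) - K / s * (d * s) \<le> d - real p * d\<^sup>2 / 4"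
    proof -
      have q3: "real q \<le> real n / real p" using pq p by (simp add: field_simps)
      have "real q * ((K / s)\<^sup>2 + 2 * (c / s) * (K / s)) \<le> real n / real p * ((K / s)\<^sup>2 + 2 * (c / s) * (K / s))"
        using q3 K c s by (intro mult_right_mono) auto
      also have "\<dots> = (K\<^sup>2 + 2 * c * K) / real p"
        unfolding s(2)[symmetric] using s(1) p by (simp add: field_simps power2_eq_square)
      also have "\<dots> = real p * d\<^sup>2 / 4 + c * d"
        using p by (simp add: K_def field_simps power2_eq_square)
      also have "\<dots> \<le> real p * d\<^sup>2 / 4 + d" using c d by simp
      finally show ?thesis using s(1) by (simp add: K_def field_simps power2_eq_square)
    qed
    have last: "real (p * k * q) * (c / s * (real k / s)) \<le> (real k)\<^sup>2 * c"
    proof -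
      have "real (p * k * q) * (c / s * (real k / s)) = (real p * real q) * ((real k)\<^sup>2 * c / real n)"
        unfolding s(2)[symmetric] by (simp add: power2_eq_square)
      also have "\<dots> \<le> real n * ((real k)\<^sup>2 * c / real n)" using pq c by (intro mult_right_mono) auto
      also have "\<dots> = (real k)\<^sup>2 * c" using n by simp
      finally show ?thesis .
    qed
    have "\<bar>(\<integral>\<omega>. G (rescaled_path X n \<omega>) \<partial>M) - coin_mean (p * k * (n div p))
          (\<lambda>cs. increment_functional p G (block_sums p n cs))\<bar>
      \<le> real k * (4 * d) + 2 * C * (real (p * k + 2) * (8 * real m / sqrt (real q) +
          2 * exp (real q * ((K / s)\<^sup>2 + 2 * (c / s) * (K / s)) - K / s * (d * s))))
        + 2 * C * (8 * real m / sqrt (real q)) + real (p * k * q) * (c / s * (real k / s))"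
      using path_functional_estimate[OF walk G C p q1 m(1) E d(1) \<theta>] by (simp add: q_def s_def)
    also have "\<dots> \<le> real k * (4 * d) + 2 * C * (real (p * k + 2) * (16 * b * sqrt (2 * real p) +
          2 * exp (d - real p * d\<^sup>2 / 4))) + 2 * C * (16 * b * sqrt (2 * real p)) + (real k)\<^sup>2 * c"
      using visits exponent last C0 by (intro add_mono mult_left_mono order.refl) auto
    also have "\<dots> = real k * (4 * d) + a * b + 2 * C * ((real p * real k + 2) * (2 * exp (d - real p * d\<^sup>2 / 4))) + (real k)\<^sup>2 * c"
      by (simp add: a_def algebra_simps)
    finally show ?case
      using p1 p2 b(2) c(3) d(2) elim(2) unfolding dist_real_def L_def[symmetric] by linarith
  qed
qed

theorem invariance_principle:
  assumes walk: "drift_walk M e X" and small: "(\<lambda>n. real n * e n) \<longlonglongrightarrow> 0"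
    and W: "standard_brownian_motion W B"
  shows "converges_in_law M (rescaled_path X) W (\<lambda>\<omega>. to_path (\<lambda>t. B t \<omega>))"
proof (rule converges_in_law_by_lipschitz)
  show "prob_space M" using walk by (simp add: drift_walk_def)
  show "prob_space W" using W by (simp add: standard_brownian_motion_def)
  show "(\<lambda>n. \<integral>\<omega>. G (rescaled_path X n \<omega>) \<partial>M) \<longlonglongrightarrow> (\<integral>\<omega>. G (to_path (\<lambda>t. B t \<omega>)) \<partial>W)"
    if "path_lipschitz k G" "\<And>f. \<bar>G f\<bar> \<le> C" for k G C
    by (rule path_functional_tendsto[OF walk small W path_lipschitz_Suc[OF that(1)] that(2)]) simp
qed (rule rescaled_path_measurable[OF walk], assumption, rule brownian_path_measurable[OF W], assumption)

end

section \<open>Moments of the likelihood ratio\<close>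

text \<open>
  A weight with the factor \<open>a m\<close> for each step away from the origin and \<open>b m\<close> for each step towards it
  in the \<open>m\<close>-th excursion. The likelihood ratio and its powers are of this form.
\<close>

fun tilt :: "(nat \<Rightarrow> real) \<Rightarrow> (nat \<Rightarrow> real) \<Rightarrow> int list \<Rightarrow> real" where
  "tilt a b (x # y # h) =
     (if y = 0 then 1 else if \<bar>y\<bar> < \<bar>x\<bar> then a (count_list (y # h) 0) else b (count_list (y # h) 0)) * tilt a b (y # h)"
| "tilt a b _ = 1"

lemma tilt_nonneg: "(\<And>m. 0 \<le> a m) \<Longrightarrow> (\<And>m. 0 \<le> b m) \<Longrightarrow> 0 \<le> tilt a b h"
  by (induction a b h rule: tilt.induct) auto

lemma tilt_pos: "(\<And>m. 0 < a m) \<Longrightarrow> (\<And>m. 0 < b m) \<Longrightarrow> 0 < tilt a b h"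
  by (induction a b h rule: tilt.induct) auto

lemma tilt_power: "tilt a b h ^ k = tilt (\<lambda>m. a m ^ k) (\<lambda>m. b m ^ k) h"
  by (induction a b h rule: tilt.induct) (auto simp: power_mult_distrib)

lemma tilt_powr:
  "(\<And>m. 0 \<le> a m) \<Longrightarrow> (\<And>m. 0 \<le> b m) \<Longrightarrow> tilt a b h powr \<beta> = tilt (\<lambda>m. a m powr \<beta>) (\<lambda>m. b m powr \<beta>) h"
  by (induction a b h rule: tilt.induct) (auto simp: powr_mult tilt_nonneg)

lemma tilt_sqrt: "sqrt (tilt a b h) = tilt (\<lambda>m. sqrt (a m)) (\<lambda>m. sqrt (b m)) h"
  by (induction a b h rule: tilt.induct) (auto simp: real_sqrt_mult)

lemma step_mean_tilt:
  assumes "h \<noteq> []"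
  shows "step_mean (\<lambda>_. 0) h (\<lambda>h'. tilt a b h' * f h') =
    (if hd h = 0 then (f (1 # h) + f (- 1 # h)) / 2
     else (a (count_list h 0) * f ((hd h + sgn (hd h)) # h) + b (count_list h 0) * f ((hd h - sgn (hd h)) # h)) / 2)
    * tilt a b h"
proof -
  obtain x h' where h: "h = x # h'" using assms by (cases h) auto
  consider "x = 0" | "x > 0" | "x < 0" by linarith
  then show ?thesis by cases (simp_all add: h step_mean_def field_simps)
qed

text \<open>
  The mean of the remaining factors of a tilt up to the \<open>N\<close>-th excursion, if \<open>\<rho> m\<close> is the mean of the
  factor gained while descending by one level of distance in the \<open>m\<close>-th excursion. At the origin, the excursion that is
  about to begin first climbs to distance \<open>1\<close>; the maximum accounts for this.
\<close>

definition excursion_weight :: "(nat \<Rightarrow> real) \<Rightarrow> nat \<Rightarrow> int list \<Rightarrow> real" where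
  "excursion_weight \<rho> N h =
     \<rho> (count_list h 0) ^ nat (max \<bar>hd h\<bar> 1) * (\<Prod>j\<in>{count_list h 0<..N}. \<rho> j)"

text \<open>
  The weighted tilt is a martingale precisely if \<open>(a \<rho>\<^sup>2 + b) / 2 = \<rho>\<close>: in order to descend by one level,
  the walk either steps down at once or has to descend by two levels after one step up.
\<close>

lemma step_mean_excursion_weight:
  assumes h: "h \<noteq> []" and N: "count_list h 0 < N"
  defines "v \<equiv> count_list h (0::int)"
  shows "step_mean (\<lambda>_. 0) h (\<lambda>h'. tilt a b h' * excursion_weight \<rho> N h') = tilt a b h * (excursion_weight \<rho> N h +
    (if hd h = 0 then 0 else \<rho> v ^ nat (\<bar>hd h\<bar> - 1) * (\<Prod>j\<in>{v<..N}. \<rho> j) * ((a v * \<rho> v ^ 2 + b v) / 2 - \<rho> v)))"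
proof -
  let ?P = "\<Prod>j\<in>{v<..N}. \<rho> j"
  show ?thesis
  proof (cases "hd h = 0")
    case True
    then show ?thesis unfolding step_mean_tilt[OF h]
      by (simp add: excursion_weight_def v_def)
  next
    case False
    define r where "r = nat (\<bar>hd h\<bar> - 1)"
    have r: "\<bar>hd h\<bar> = int r + 1" using False by (simp add: r_def)
    have outward: "excursion_weight \<rho> N ((hd h + sgn (hd h)) # h) = \<rho> v ^ (r + 2) * ?P"
    proof -
      have "\<bar>hd h + sgn (hd h)\<bar> = int (r + 2)" "hd h + sgn (hd h) \<noteq> 0"
        using False r by (auto simp: sgn_if)
      then show ?thesis by (simp add: excursion_weight_def v_def nat_add_distrib)
    qed
    have inward: "excursion_weight \<rho> N ((hd h - sgn (hd h)) # h) = \<rho> v ^ r * ?P"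
    proof (cases "r = 0")
      case True
      then have *: "hd h - sgn (hd h) = 0" using False r by (auto simp: sgn_if)
      have "{v<..N} = insert (Suc v) {Suc v<..N}" using N by (auto simp: v_def)
      then have "?P = \<rho> (Suc v) * (\<Prod>j\<in>{Suc v<..N}. \<rho> j)" by simp
      then show ?thesis unfolding * using True by (simp add: excursion_weight_def v_def)
    next
      case r0: False
      then have "\<bar>hd h - sgn (hd h)\<bar> = int r" "hd h - sgn (hd h) \<noteq> 0"
        using False r by (auto simp: sgn_if)
      moreover have "nat (max (int r) 1) = r" using r0 by (auto simp: max_def)
      ultimately show ?thesis by (simp add: excursion_weight_def v_def)
    qed
    have "nat (max \<bar>hd h\<bar> 1) = Suc r" using r by (auto simp: max_def)
    then have "excursion_weight \<rho> N h = \<rho> v ^ Suc r * ?P" by (simp add: excursion_weight_def v_def)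
    then show ?thesis unfolding step_mean_tilt[OF h] outward inward v_def[symmetric] r_def[symmetric]
      using False by (simp add: field_simps power2_eq_square)
  qed
qed

lemma excursion_weight_start:
  assumes "1 \<le> N"
  shows "excursion_weight \<rho> N [0] = (\<Prod>j\<in>{1..N}. \<rho> j)"
proof -
  have "{1..N} = insert 1 {1<..N}" using assms by auto
  then show ?thesis by (simp add: excursion_weight_def)
qed

lemma count_list_walk_from:
  assumes "h \<in> set_pmf (walk_from e l [0])"
  shows "h \<noteq> []" "count_list h 0 \<le> Suc l" "1 \<le> count_list h 0"
proof -
  obtain g where g: "h = g @ [0]" "length g = l" using set_pmf_walk_from[OF assms] by blast
  show "h \<noteq> []" "1 \<le> count_list h 0" using g by simp_all
  show "count_list h 0 \<le> Suc l" using count_le_length[of h 0] g by simp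
qed

context
  fixes a b \<rho> :: "nat \<Rightarrow> real"
  assumes a: "\<And>m. 0 \<le> a m" and b: "\<And>m. 0 \<le> b m" and \<rho>: "\<And>m. 0 \<le> \<rho> m"
begin

private lemma correction_nonneg:
  "0 \<le> tilt a b h * (\<rho> v ^ i * (\<Prod>j\<in>A. \<rho> j))"
  by (intro mult_nonneg_nonneg tilt_nonneg zero_le_power prod_nonneg a b \<rho> ballI)

text \<open>
  It is enough to have a supersolution \<open>\<rho>\<close> of the quadratic equation.
\<close>

proposition tilted_mean_le:
  assumes super: "\<And>m. (a m * \<rho> m ^ 2 + b m) / 2 \<le> \<rho> m" and N: "n < N"
  shows "simple_mean n [0] (\<lambda>h. tilt a b h * excursion_weight \<rho> N h) \<le> (\<Prod>j\<in>{1..N}. \<rho> j)"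
proof -
  have "simple_mean n [0] (\<lambda>h. tilt a b h * excursion_weight \<rho> N h)
      \<le> tilt a b [0] * excursion_weight \<rho> N [0]"
  proof (rule simple.mean_from_supermartingale)
    fix l h assume l: "l < n" and h: "h \<in> set_pmf (walk_from (\<lambda>_. 0) l [0])"
    note c = count_list_walk_from[OF h]
    have v: "count_list h 0 < N" using c(2) l N by linarith
    show "step_mean (\<lambda>_. 0) h (\<lambda>h. tilt a b h * excursion_weight \<rho> N h) \<le> tilt a b h * excursion_weight \<rho> N h"
      using mult_nonneg_nonpos[OF correction_nonneg, of "(a (count_list h 0) * \<rho> (count_list h 0) ^ 2 + b (count_list h 0)) / 2 - \<rho> (count_list h 0)"]
        super[of "count_list h 0"]
      unfolding step_mean_excursion_weight[OF c(1) v] by (simp add: distrib_left mult.assoc)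
  qed
  then show ?thesis using excursion_weight_start[of N \<rho>] N by simp
qed

proposition tilted_mean_ge:
  assumes sub: "\<And>m. \<rho> m \<le> (a m * \<rho> m ^ 2 + b m) / 2" and N: "n < N"
  shows "(\<Prod>j\<in>{1..N}. \<rho> j) \<le> simple_mean n [0] (\<lambda>h. tilt a b h * excursion_weight \<rho> N h)"
proof -
  have "tilt a b [0] * excursion_weight \<rho> N [0]
      \<le> simple_mean n [0] (\<lambda>h. tilt a b h * excursion_weight \<rho> N h)"
  proof (rule simple.mean_from_submartingale)
    fix l h assume l: "l < n" and h: "h \<in> set_pmf (walk_from (\<lambda>_. 0) l [0])"
    note c = count_list_walk_from[OF h]
    have v: "count_list h 0 < N" using c(2) l N by linarith
    show "tilt a b h * excursion_weight \<rho> N h \<le> step_mean (\<lambda>_. 0) h (\<lambda>h. tilt a b h * excursion_weight \<rho> N h)"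
      using mult_nonneg_nonneg[OF correction_nonneg, of "(a (count_list h 0) * \<rho> (count_list h 0) ^ 2 + b (count_list h 0)) / 2 - \<rho> (count_list h 0)"]
        sub[of "count_list h 0"]
      unfolding step_mean_excursion_weight[OF c(1) v] by (simp add: distrib_left mult.assoc)
  qed
  then show ?thesis using excursion_weight_start[of N \<rho>] N by simp
qed

end

text \<open>
  The density, on histories, of the law of the walk with respect to that of the simple random walk.
\<close>

definition likelihood :: "(nat \<Rightarrow> real) \<Rightarrow> int list \<Rightarrow> real" where
  "likelihood e = tilt (\<lambda>m. 1 - e m) (\<lambda>m. 1 + e m)"

lemma sqrt_sum_le:
  fixes x :: real
  assumes "0 \<le> x" "x \<le> 1"
  shows "sqrt (1 - x) + sqrt (1 + x) \<le> 2 - x\<^sup>2 / 4"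
proof (rule power2_le_imp_le)
  have x: "x\<^sup>2 \<le> 1" using assms by (simp add: power_le_one)
  have "sqrt (1 - x\<^sup>2) \<le> 1 - x\<^sup>2 / 2"
  proof (rule real_le_lsqrt)
    have "(1 - x\<^sup>2 / 2)\<^sup>2 = 1 - x\<^sup>2 + (x\<^sup>2)\<^sup>2 / 4" by (simp add: power2_eq_square algebra_simps)
    then show "1 - x\<^sup>2 \<le> (1 - x\<^sup>2 / 2)\<^sup>2" by simp
  qed (use x in simp)
  moreover have "(sqrt (1 - x) + sqrt (1 + x))\<^sup>2 = 2 + 2 * sqrt (1 - x\<^sup>2)"
    using assms by (simp add: power2_sum real_sqrt_mult[symmetric] algebra_simps power2_eq_square)
  ultimately have "(sqrt (1 - x) + sqrt (1 + x))\<^sup>2 \<le> 4 - x\<^sup>2" by linarith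
  also have "\<dots> \<le> (2 - x\<^sup>2 / 4)\<^sup>2"
  proof -
    have "(2 - x\<^sup>2 / 4)\<^sup>2 = 4 - x\<^sup>2 + (x\<^sup>2)\<^sup>2 / 16" by (simp add: power2_eq_square algebra_simps)
    then show ?thesis by simp
  qed
  finally show "(sqrt (1 - x) + sqrt (1 + x))\<^sup>2 \<le> (2 - x\<^sup>2 / 4)\<^sup>2" .
  show "0 \<le> 2 - x\<^sup>2 / 4" using x by simp
qed

text \<open>
  \<open>\<rho> = 1 - x / 8\<close> is a supersolution for the square root of the likelihood ratio, and it loses an amount
  of first order in the drift \<open>x\<close>.
\<close>

lemma hellinger_step:
  fixes x :: real
  assumes x: "0 \<le> x" "x \<le> 1"
  shows "sqrt (1 - x) * (1 - x / 8)\<^sup>2 + sqrt (1 + x) \<le> 2 * (1 - x / 8)"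
proof -
  have "sqrt (1 - x) \<le> 1 - x / 16"
    by (rule real_le_lsqrt) (use x in \<open>auto simp: power2_eq_square algebra_simps\<close>)
  then have "sqrt (1 - x) * sqrt (1 - x) \<le> sqrt (1 - x) * (1 - x / 16)"
    using x by (intro mult_left_mono) auto
  then have "1 - x \<le> sqrt (1 - x) * (1 - x / 16)" using x by simp
  then have "x / 4 * (1 - x) \<le> x / 4 * (sqrt (1 - x) * (1 - x / 16))"
    using x by (intro mult_left_mono) auto
  moreover have "sqrt (1 - x) * (1 - x / 8)\<^sup>2 + sqrt (1 + x)
      = (sqrt (1 - x) + sqrt (1 + x)) - x / 4 * (sqrt (1 - x) * (1 - x / 16))"
    by (simp add: power2_eq_square algebra_simps)
  moreover have "2 - x\<^sup>2 / 4 - x / 4 * (1 - x) = 2 * (1 - x / 8)"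
    by (simp add: power2_eq_square field_simps)
  ultimately show ?thesis using sqrt_sum_le[OF x] by linarith
qed

lemma one_minus_sum_le_prod:
  fixes f :: "'a \<Rightarrow> real"
  assumes "finite A" "\<And>j. j \<in> A \<Longrightarrow> 0 \<le> f j" "\<And>j. j \<in> A \<Longrightarrow> f j \<le> 1"
  shows "1 - (\<Sum>j\<in>A. f j) \<le> (\<Prod>j\<in>A. 1 - f j)"
  using assms
proof (induction A rule: finite_induct)
  case (insert x A)
  have IH: "1 - (\<Sum>j\<in>A. f j) \<le> (\<Prod>j\<in>A. 1 - f j)" using insert by simp
  have "(\<Prod>j\<in>A. 1 - f j) \<le> 1" using insert.prems by (intro prod_le_1) auto
  then have "f x * (\<Prod>j\<in>A. 1 - f j) \<le> f x" using insert.prems by (intro mult_left_le) auto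
  then show ?case using IH insert.hyps by (simp add: algebra_simps)
qed simp

context drift_sequence
begin

lemma likelihood_pos: "0 < likelihood e h"
  unfolding likelihood_def by (rule tilt_pos) (use nonneg less_1 in \<open>auto simp: add_pos_nonneg\<close>)

proposition mean_from_likelihood:
  "mean_from e n [0] f = simple_mean n [0] (\<lambda>h. likelihood e h * f h)"
proof (induction n arbitrary: f)
  case 0
  then show ?case by (simp add: likelihood_def)
next
  case (Suc n)
  have "mean_from e (Suc n) [0] f = simple_mean n [0] (\<lambda>h. likelihood e h * step_mean e h f)"
    unfolding mean_from_Suc_right by (rule Suc.IH)
  also have "\<dots> = simple_mean n [0] (\<lambda>h. step_mean (\<lambda>_. 0) h (\<lambda>h'. likelihood e h' * f h'))"
  proof (rule mean_pmf_cong)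
    fix h assume "h \<in> set_pmf (walk_from (\<lambda>_. 0) n [0])"
    note c = count_list_walk_from[OF this]
    consider "hd h = 0" | "hd h > 0" | "hd h < 0" by linarith
    then show "likelihood e h * step_mean e h f = step_mean (\<lambda>_. 0) h (\<lambda>h'. likelihood e h' * f h')"
      unfolding likelihood_def step_mean_tilt[OF c(1)]
      by cases (simp_all add: step_mean_def drift_def field_simps)
  qed
  also have "\<dots> = simple_mean (Suc n) [0] (\<lambda>h. likelihood e h * f h)"
    by (rule simple.mean_from_Suc_right[symmetric])
  finally show ?case .
qed

corollary mean_likelihood: "simple_mean n [0] (likelihood e) = 1"
  using mean_from_likelihood[of n "\<lambda>_. 1"] by simp

abbreviation event_prob :: "nat \<Rightarrow> int list set \<Rightarrow> real" where
  "event_prob n A \<equiv> mean_from e n [0] (indicator A)"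

abbreviation simple_prob :: "nat \<Rightarrow> int list set \<Rightarrow> real" where
  "simple_prob n A \<equiv> simple_mean n [0] (indicator A)"

text \<open>
  Only the first \<open>M\<close> excursions are used: for later ones \<open>\<rho> = 1\<close> is a supersolution as well. Then
  the weight is \<open>1\<close> after \<open>M\<close> visits, and the event of fewer visits has small probability.
\<close>

lemma mean_sqrt_likelihood_le:
  assumes M: "1 \<le> M" and n: "1 \<le> n" and \<delta>: "\<delta> > 0"
  shows "simple_mean n [0] (\<lambda>h. sqrt (likelihood e h)) \<le>
    (\<Prod>j\<in>{1..M}. 1 - e j / 8) + \<delta> / 2 + 8 * real M / sqrt (real n) / (2 * \<delta>)"
proof -
  define \<rho> where "\<rho> = (\<lambda>j. if j \<le> M then 1 - e j / 8 else 1)"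
  define N where "N = n + 1 + M"
  have \<rho>: "0 \<le> \<rho> j" for j using less_1[of j] by (simp add: \<rho>_def)
  have super: "(sqrt (1 - e j) * \<rho> j ^ 2 + sqrt (1 + e j)) / 2 \<le> \<rho> j" for j
  proof (cases "j \<le> M")
    case True
    have "sqrt (1 - e j) * (1 - e j / 8)\<^sup>2 + sqrt (1 + e j) \<le> 2 * (1 - e j / 8)"
      by (rule hellinger_step) (use nonneg less_1 in \<open>auto intro: less_imp_le\<close>)
    then show ?thesis using True by (simp add: \<rho>_def)
  next
    case False
    have "sqrt (1 - e j) + sqrt (1 + e j) \<le> 2 - (e j)\<^sup>2 / 4"
      by (rule sqrt_sum_le) (use nonneg less_1 in \<open>auto intro: less_imp_le\<close>)
    moreover have "0 \<le> (e j)\<^sup>2" by simp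
    ultimately have "sqrt (1 - e j) + sqrt (1 + e j) \<le> 2" by linarith
    then show ?thesis using False by (simp add: \<rho>_def)
  qed
  have e: "0 \<le> 1 - e j" "0 \<le> 1 + e j" for j
    using nonneg[of j] less_1[of j] by auto
  let ?Z = "\<lambda>h. tilt (\<lambda>m. sqrt (1 - e m)) (\<lambda>m. sqrt (1 + e m)) h * excursion_weight \<rho> N h"
  have "simple_mean n [0] (\<lambda>h. sqrt (likelihood e h)) \<le>
      simple_mean n [0] (\<lambda>h. ?Z h + \<delta> / 2 * likelihood e h + 1 / (2 * \<delta>) * indicator {h. count_list h 0 \<le> M} h)"
  proof (rule mean_from_mono)
    fix h
    have Z: "?Z h = sqrt (likelihood e h) * excursion_weight \<rho> N h"
      by (simp add: likelihood_def tilt_sqrt)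
    have wgt: "0 \<le> excursion_weight \<rho> N h"
      unfolding excursion_weight_def by (intro mult_nonneg_nonneg zero_le_power prod_nonneg ballI \<rho>)
    have l: "0 \<le> likelihood e h" using likelihood_pos[of h] by simp
    show "sqrt (likelihood e h) \<le> ?Z h + \<delta> / 2 * likelihood e h + 1 / (2 * \<delta>) * indicator {h. count_list h 0 \<le> M} h"
    proof (cases "count_list h 0 \<le> M")
      case True
      have "0 \<le> (\<delta> * sqrt (likelihood e h) - 1)\<^sup>2 / (2 * \<delta>)" using \<delta> by simp
      also have "\<dots> = \<delta> / 2 * likelihood e h + 1 / (2 * \<delta>) - sqrt (likelihood e h)"
        using \<delta> l by (simp add: power2_diff power_mult_distrib field_simps power2_eq_square)
      finally have "sqrt (likelihood e h) \<le> \<delta> / 2 * likelihood e h + 1 / (2 * \<delta>)" by simp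
      moreover have "0 \<le> ?Z h" unfolding Z using l wgt by simp
      moreover have "indicator {h. count_list h 0 \<le> M} h = (1 :: real)" using True by simp
      ultimately show ?thesis by (simp only: mult_1_right)
    next
      case False
      have "excursion_weight \<rho> N h = 1"
        using False by (simp add: excursion_weight_def \<rho>_def)
      then show ?thesis unfolding Z using False \<delta> l by simp
    qed
  qed
  also have "\<dots> = simple_mean n [0] ?Z + \<delta> / 2 + 1 / (2 * \<delta>) * simple_prob n {h. count_list h 0 \<le> M}"
    using mean_likelihood[of n] by simp
  also have "\<dots> \<le> (\<Prod>j\<in>{1..N}. \<rho> j) + \<delta> / 2 + 1 / (2 * \<delta>) * (8 * real M / sqrt (real n))"
  proof (intro add_mono mult_left_mono order.refl)
    show "simple_mean n [0] ?Z \<le> (\<Prod>j\<in>{1..N}. \<rho> j)"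
      by (rule tilted_mean_le) (use e \<rho> super in \<open>simp_all add: N_def\<close>)
    show "simple_prob n {h. count_list h 0 \<le> M} \<le> 8 * real M / sqrt (real n)"
      by (rule simple.few_visits[OF M n])
  qed (use \<delta> in simp)
  also have "(\<Prod>j\<in>{1..N}. \<rho> j) = (\<Prod>j\<in>{1..M}. 1 - e j / 8)"
    by (rule prod.mono_neutral_cong_right) (auto simp: \<rho>_def N_def)
  finally show ?thesis by (simp add: field_simps)
qed

lemma mean_sqrt_likelihood_tendsto_0:
  assumes "\<not> summable (\<lambda>n. e (Suc n))"
  shows "(\<lambda>n. simple_mean n [0] (\<lambda>h. sqrt (likelihood e h))) \<longlonglongrightarrow> 0"
proof (rule tendstoI)
  fix \<eta> :: real assume \<eta>: "\<eta> > 0"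
  \<comment> \<open>Beyond this point the product of the \<open>1 - e j / 8\<close> is less than \<open>\<eta> / 4\<close>.\<close>
  obtain M where M: "8 * (- ln (\<eta> / 4)) < (\<Sum>j<M. e (Suc j))" "1 \<le> M"
  proof -
    have "\<exists>M. max 0 (8 * (- ln (\<eta> / 4))) < (\<Sum>j<M. e (Suc j))"
      using assms summableI_nonneg_bounded[of "\<lambda>n. e (Suc n)"] nonneg by (metis not_le)
    then obtain M where "max 0 (8 * (- ln (\<eta> / 4))) < (\<Sum>j<M. e (Suc j))" by blast
    then show ?thesis by (intro that[of M]) (cases M; simp)+
  qed
  have prod: "(\<Prod>j\<in>{1..M}. 1 - e j / 8) < \<eta> / 4"
  proof -
    have "(\<Prod>j\<in>{1..M}. 1 - e j / 8) \<le> (\<Prod>j\<in>{1..M}. exp (- (e j / 8)))"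
    proof (intro prod_mono conjI)
      fix j
      show "0 \<le> 1 - e j / 8" using less_1[of j] by simp
      show "1 - e j / 8 \<le> exp (- (e j / 8))" using exp_ge_add_one_self[of "- (e j / 8)"] by simp
    qed
    also have "\<dots> = exp (\<Sum>j\<in>{1..M}. - (e j / 8))" by (simp add: exp_sum)
    also have "(\<Sum>j\<in>{1..M}. - (e j / 8)) = - (\<Sum>j<M. e (Suc j)) / 8"
      by (simp add: sum_negf sum_divide_distrib[symmetric] sum.atLeast1_atMost_eq)
    also have "exp \<dots> < exp (ln (\<eta> / 4))" using M(1) by simp
    finally show ?thesis using \<eta> by simp
  qed
  have "(\<lambda>n. 8 * real M / sqrt (real n) / (2 * (\<eta> / 2))) \<longlonglongrightarrow> 0" using \<eta> by real_asymp
  then have "\<forall>\<^sub>F n in sequentially. 8 * real M / sqrt (real n) / (2 * (\<eta> / 2)) < \<eta> / 4"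
    by (rule order_tendstoD) (use \<eta> in simp)
  then show "\<forall>\<^sub>F n in sequentially. dist (simple_mean n [0] (\<lambda>h. sqrt (likelihood e h))) 0 < \<eta>"
    using eventually_ge_at_top[of 1]
  proof eventually_elim
    case (elim n)
    have "0 \<le> simple_mean n [0] (\<lambda>h. sqrt (likelihood e h))"
      by (rule integral_nonneg_AE) (simp add: less_imp_le likelihood_pos)
    then show ?case
      using mean_sqrt_likelihood_le[OF M(2) elim(2), of "\<eta> / 2"] \<eta> elim(1) prod
      by (simp add: dist_real_def)
  qed
qed

lemma simple_prob_likelihood_ge_1: "simple_prob n {h. 1 \<le> likelihood e h} \<le> simple_mean n [0] (\<lambda>h. sqrt (likelihood e h))"
  by (rule mean_from_mono) (simp add: indicator_def less_imp_le likelihood_pos)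

lemma event_prob_likelihood_less_1: "event_prob n {h. likelihood e h < 1} \<le> simple_mean n [0] (\<lambda>h. sqrt (likelihood e h))"
  unfolding mean_from_likelihood
proof (rule mean_from_mono)
  fix h
  have "likelihood e h \<le> sqrt (likelihood e h)" if "likelihood e h < 1"
    using that likelihood_pos[of h] by (intro real_le_rsqrt) (simp add: power2_eq_square mult_left_le)
  then show "likelihood e h * indicator {h. likelihood e h < 1} h \<le> sqrt (likelihood e h)"
    by (simp add: indicator_def less_imp_le likelihood_pos)
qed

lemma summable_drift_bounds:
  assumes "summable (\<lambda>n. e (Suc n))"
  obtains \<kappa> S where "0 < \<kappa>" "\<kappa> < 1" "0 \<le> S" "\<And>j. e j \<le> \<kappa>" "\<And>N. (\<Sum>j\<in>{1..N}. e j) \<le> S"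
proof -
  have "(\<lambda>n. e (Suc n)) \<longlonglongrightarrow> 0" by (rule summable_LIMSEQ_zero[OF assms])
  then have "e \<longlonglongrightarrow> 0" by (rule LIMSEQ_imp_Suc)
  then have "\<forall>\<^sub>F n in sequentially. e n < 1 / 2" by (rule order_tendstoD) simp
  then obtain J where J: "\<And>n. n \<ge> J \<Longrightarrow> e n < 1 / 2" by (auto simp: eventually_sequentially)
  define \<kappa> where "\<kappa> = Max (insert (1 / 2) (e ` {..J}))"
  have fin: "finite (insert (1 / 2) (e ` {..J}))" by simp
  show ?thesis
  proof (rule that)
    have "1 / 2 \<le> \<kappa>" unfolding \<kappa>_def by (rule Max_ge[OF fin]) simp
    then show "0 < \<kappa>" by simp
    show "\<kappa> < 1" unfolding \<kappa>_def using less_1 by (subst Max_less_iff[OF fin]) auto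
    show "e j \<le> \<kappa>" for j
    proof (cases "j \<le> J")
      case True
      then show ?thesis unfolding \<kappa>_def by (intro Max_ge[OF fin]) simp
    next
      case False
      then show ?thesis using J[of j] \<open>1 / 2 \<le> \<kappa>\<close> by simp
    qed
    show "(\<Sum>j\<in>{1..N}. e j) \<le> (\<Sum>n. e (Suc n))" for N
      unfolding sum.atLeast1_atMost_eq One_nat_def by (rule sum_le_suminf[OF assms]) (use nonneg in auto)
    show "0 \<le> (\<Sum>n. e (Suc n))" by (rule suminf_nonneg[OF assms nonneg])
  qed
qed

text \<open>
  For the square of the likelihood ratio \<open>\<rho> = (1 + \<epsilon>) / (1 - \<epsilon>)\<close> is a supersolution, and the infinite
  product of these numbers converges together with \<open>\<Sum>\<epsilon>\<close>. So the densities are bounded in \<open>L\<^sup>2\<close>.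
\<close>

proposition event_prob_le_simple_prob:
  assumes "summable (\<lambda>n. e (Suc n))"
  obtains R where "0 \<le> R" "\<And>n A \<delta>. \<delta> > 0 \<Longrightarrow> event_prob n A \<le> \<delta> * R + simple_prob n A / \<delta>"
proof -
  from summable_drift_bounds[OF assms] obtain \<kappa> S where \<kappa>: "0 < \<kappa>" "\<kappa> < 1" "\<And>j. e j \<le> \<kappa>"
    and S: "0 \<le> S" "\<And>N. (\<Sum>j\<in>{1..N}. e j) \<le> S" by metis
  define \<rho> where "\<rho> = (\<lambda>j. (1 + e j) / (1 - e j))"
  have \<rho>1: "1 \<le> \<rho> j" for j using nonneg[of j] less_1[of j] by (simp add: \<rho>_def)
  have \<rho>_exp: "\<rho> j \<le> exp (2 / (1 - \<kappa>) * e j)" for j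
  proof -
    have "\<rho> j = 1 + 2 * e j / (1 - e j)" using less_1[of j] by (simp add: \<rho>_def field_simps)
    also have "\<dots> \<le> 1 + 2 * e j / (1 - \<kappa>)"
      using nonneg[of j] \<kappa>(2) \<kappa>(3)[of j] by (intro add_left_mono divide_left_mono) auto
    also have "\<dots> \<le> exp (2 / (1 - \<kappa>) * e j)" using exp_ge_add_one_self[of "2 / (1 - \<kappa>) * e j"] by simp
    finally show ?thesis .
  qed
  have super: "((1 - e j)\<^sup>2 * \<rho> j ^ 2 + (1 + e j)\<^sup>2) / 2 \<le> \<rho> j" for j
  proof -
    have x: "0 \<le> e j" "e j < 1" using nonneg less_1 by auto
    have "(1 - e j)\<^sup>2 * \<rho> j ^ 2 = (1 + e j)\<^sup>2" using x by (simp add: \<rho>_def power_divide)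
    then have "((1 - e j)\<^sup>2 * \<rho> j ^ 2 + (1 + e j)\<^sup>2) / 2 = (1 + e j)\<^sup>2" by simp
    also have "\<dots> = (1 + e j) * ((1 + e j) * (1 - e j)) / (1 - e j)" using x by (simp add: power2_eq_square)
    also have "\<dots> \<le> (1 + e j) * 1 / (1 - e j)"
      using x by (intro divide_right_mono mult_left_mono) (simp_all add: algebra_simps)
    finally show ?thesis by (simp add: \<rho>_def)
  qed
  define R where "R = exp (2 / (1 - \<kappa>) * S)"
  have second: "simple_mean n [0] (\<lambda>h. likelihood e h ^ 2) \<le> R" for n
  proof -
    let ?Z = "\<lambda>h. tilt (\<lambda>m. (1 - e m)\<^sup>2) (\<lambda>m. (1 + e m)\<^sup>2) h * excursion_weight \<rho> (Suc n) h"
    have "simple_mean n [0] (\<lambda>h. likelihood e h ^ 2) \<le> simple_mean n [0] ?Z"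
    proof (rule mean_from_mono)
      fix h
      have "1 * 1 \<le> excursion_weight \<rho> (Suc n) h"
        unfolding excursion_weight_def using \<rho>1 by (intro mult_mono one_le_power prod_ge_1) (auto intro: order_trans[OF zero_le_one])
      then have "likelihood e h ^ 2 * 1 \<le> likelihood e h ^ 2 * excursion_weight \<rho> (Suc n) h"
        by (intro mult_left_mono) auto
      then show "likelihood e h ^ 2 \<le> ?Z h" by (simp add: likelihood_def tilt_power)
    qed
    also have "\<dots> \<le> (\<Prod>j\<in>{1..Suc n}. \<rho> j)"
      by (rule tilted_mean_le) (use super \<rho>1 in \<open>auto intro: order_trans[OF zero_le_one]\<close>)
    also have "\<dots> \<le> (\<Prod>j\<in>{1..Suc n}. exp (2 / (1 - \<kappa>) * e j))"
      using \<rho>_exp \<rho>1 by (intro prod_mono conjI) (auto intro: order_trans[OF zero_le_one])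
    also have "\<dots> = exp (2 / (1 - \<kappa>) * (\<Sum>j\<in>{1..Suc n}. e j))"
      by (simp only: exp_sum[symmetric] finite_atLeastAtMost sum_distrib_left)
    also have "\<dots> \<le> R" unfolding R_def exp_le_cancel_iff using S(2)[of "Suc n"] \<kappa> by (intro mult_left_mono) auto
    finally show ?thesis .
  qed
  show ?thesis
  proof (rule that)
    show "0 \<le> R" by (simp add: R_def)
    fix n A and \<delta> :: real assume \<delta>: "\<delta> > 0"
    have "event_prob n A = simple_mean n [0] (\<lambda>h. likelihood e h * indicator A h)"
      by (rule mean_from_likelihood)
    also have "\<dots> \<le> simple_mean n [0] (\<lambda>h. \<delta> * likelihood e h ^ 2 + 1 / \<delta> * indicator A h)"
    proof (rule mean_from_mono)
      fix h
      define x where "x = likelihood e h"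
      have x: "0 \<le> x" using likelihood_pos[of h] by (simp add: x_def)
      have "x \<le> \<delta> * x\<^sup>2 + 1 / \<delta>"
      proof -
        have "0 \<le> (\<delta> * x - 1)\<^sup>2 / \<delta> + x" using \<delta> x by simp
        also have "\<dots> = \<delta> * x\<^sup>2 + 1 / \<delta> - x" using \<delta> by (simp add: power2_eq_square field_simps)
        finally show ?thesis by simp
      qed
      then show "likelihood e h * indicator A h \<le> \<delta> * likelihood e h ^ 2 + 1 / \<delta> * indicator A h"
        using \<delta> by (simp add: indicator_def x_def)
    qed
    also have "\<dots> = \<delta> * simple_mean n [0] (\<lambda>h. likelihood e h ^ 2) + simple_prob n A / \<delta>" by simp
    also have "\<dots> \<le> \<delta> * R + simple_prob n A / \<delta>"
      using second[of n] \<delta> by (intro add_right_mono mult_left_mono) auto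
    finally show "event_prob n A \<le> \<delta> * R + simple_prob n A / \<delta>" .
  qed
qed

text \<open>
  For \<open>a = (1 - \<epsilon>)\<^sup>\<beta>\<close> and \<open>b = (1 + \<epsilon>)\<^sup>\<beta>\<close> the discriminant of \<open>a \<rho>\<^sup>2 - 2 \<rho> + b\<close> is, up to a factor,
  \<open>s\<^sup>2 = 1 - (1 - \<epsilon>\<^sup>2)\<^sup>\<beta>\<close>. As \<open>a \<le> 1\<close>, the number \<open>1 - s\<close> lies below the smaller root and is a
  subsolution, and \<open>s\<close> is at most a multiple of \<open>\<surd>\<beta> \<epsilon>\<close>.
\<close>

lemma mean_likelihood_powr_ge:
  assumes \<kappa>: "\<kappa> < 1" "\<And>j. e j \<le> \<kappa>" and S: "\<And>N. (\<Sum>j\<in>{1..N}. e j) \<le> S" and \<beta>: "0 < \<beta>"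
  shows "1 - sqrt \<beta> / sqrt (1 - \<kappa>\<^sup>2) * S \<le> simple_mean n [0] (\<lambda>h. likelihood e h powr \<beta>)"
proof -
  have e: "0 \<le> 1 - e j" "0 \<le> 1 + e j" for j
    using nonneg[of j] less_1[of j] by auto
  define s where "s = (\<lambda>j. sqrt (1 - (1 - (e j)\<^sup>2) powr \<beta>))"
  have \<kappa>0: "0 \<le> \<kappa>" using nonneg[of 0] \<kappa>(2)[of 0] by linarith
  have \<kappa>1: "0 < 1 - \<kappa>\<^sup>2" using \<kappa>0 \<kappa>(1) by (simp add: power_less_one_iff abs_square_less_1)
  have u: "0 < 1 - (e j)\<^sup>2" "1 - (e j)\<^sup>2 \<le> 1" "1 - \<kappa>\<^sup>2 \<le> 1 - (e j)\<^sup>2" for j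
  proof -
    have "(e j)\<^sup>2 \<le> \<kappa>\<^sup>2" using nonneg \<kappa>(2) by (intro power_mono)
    then show "1 - \<kappa>\<^sup>2 \<le> 1 - (e j)\<^sup>2" by simp
    then show "0 < 1 - (e j)\<^sup>2" using \<kappa>1 by linarith
  qed simp
  have pw: "0 < (1 - (e j)\<^sup>2) powr \<beta>" "(1 - (e j)\<^sup>2) powr \<beta> \<le> 1" for j
  proof -
    show "0 < (1 - (e j)\<^sup>2) powr \<beta>" using u(1)[of j] by simp
    show "(1 - (e j)\<^sup>2) powr \<beta> \<le> 1"
      using powr_mono2[of \<beta> "1 - (e j)\<^sup>2" 1] u(1)[of j] u(2)[of j] \<beta> by simp
  qed
  have s: "0 \<le> s j" "s j \<le> 1" "(s j)\<^sup>2 = 1 - (1 - (e j)\<^sup>2) powr \<beta>" for j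
    using pw[of j] by (simp_all add: s_def)
  have s_le: "s j \<le> sqrt \<beta> / sqrt (1 - \<kappa>\<^sup>2) * e j" for j
  proof -
    have y: "0 < 1 - (e j)\<^sup>2" by (rule u(1))
    have "1 - 1 / (1 - (e j)\<^sup>2) \<le> ln (1 - (e j)\<^sup>2)"
      using ln_le_minus_one[of "1 / (1 - (e j)\<^sup>2)"] y by (simp add: ln_div)
    moreover have "1 - 1 / (1 - (e j)\<^sup>2) = - ((e j)\<^sup>2 / (1 - (e j)\<^sup>2))" using y by (simp add: field_simps)
    moreover have "(e j)\<^sup>2 / (1 - (e j)\<^sup>2) \<le> (e j)\<^sup>2 / (1 - \<kappa>\<^sup>2)"
      using u(3)[of j] \<kappa>1 by (intro divide_left_mono mult_pos_pos y) auto
    ultimately have "- ln (1 - (e j)\<^sup>2) \<le> (e j)\<^sup>2 / (1 - \<kappa>\<^sup>2)" by linarith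
    then have "\<beta> * (- ln (1 - (e j)\<^sup>2)) \<le> \<beta> * ((e j)\<^sup>2 / (1 - \<kappa>\<^sup>2))" using \<beta> by (intro mult_left_mono) auto
    moreover have "1 + \<beta> * ln (1 - (e j)\<^sup>2) \<le> (1 - (e j)\<^sup>2) powr \<beta>"
      using exp_ge_add_one_self[of "\<beta> * ln (1 - (e j)\<^sup>2)"] y by (simp add: powr_def)
    ultimately have "1 - (1 - (e j)\<^sup>2) powr \<beta> \<le> \<beta> * ((e j)\<^sup>2 / (1 - \<kappa>\<^sup>2))" by (simp add: algebra_simps)
    then have "s j \<le> sqrt (\<beta> * ((e j)\<^sup>2 / (1 - \<kappa>\<^sup>2)))" unfolding s_def by (rule real_sqrt_le_mono)
    also have "\<dots> = sqrt \<beta> / sqrt (1 - \<kappa>\<^sup>2) * e j" using nonneg[of j] by (simp add: real_sqrt_mult real_sqrt_divide)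
    finally show ?thesis .
  qed
  have sub: "1 - s j \<le> ((1 - e j) powr \<beta> * (1 - s j)\<^sup>2 + (1 + e j) powr \<beta>) / 2" for j
  proof -
    define a b where "a = (1 - e j) powr \<beta>" and "b = (1 + e j) powr \<beta>"
    have a: "0 < a" "a \<le> 1"
      using powr_mono2[of \<beta> "1 - e j" 1] less_1[of j] nonneg[of j] \<beta> by (auto simp: a_def)
    have "(1 - e j) * (1 + e j) = 1 - (e j)\<^sup>2" by (simp add: power2_eq_square algebra_simps)
    then have ab: "a * b = 1 - (s j)\<^sup>2" unfolding a_def b_def s(3)
      using e powr_mult[of "1 - e j" "1 + e j" \<beta>] by simp
    have "a * (1 - s j) \<le> 1 * (1 - s j)" using a s(2)[of j] by (intro mult_right_mono) auto
    then have "(s j)\<^sup>2 \<le> (1 - a * (1 - s j))\<^sup>2" using s(1)[of j] by (intro power_mono) auto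
    then have "0 \<le> (1 - a * (1 - s j))\<^sup>2 - (1 - a * b)" unfolding ab by simp
    also have "\<dots> = a * (a * (1 - s j)\<^sup>2 + b - 2 * (1 - s j))"
      by (simp add: power2_eq_square algebra_simps)
    finally have "0 \<le> a * (1 - s j)\<^sup>2 + b - 2 * (1 - s j)" using a by (simp add: zero_le_mult_iff)
    then show ?thesis by (simp add: a_def b_def)
  qed
  let ?Z = "\<lambda>h. tilt (\<lambda>m. (1 - e m) powr \<beta>) (\<lambda>m. (1 + e m) powr \<beta>) h * excursion_weight (\<lambda>j. 1 - s j) (Suc n) h"
  have "1 - sqrt \<beta> / sqrt (1 - \<kappa>\<^sup>2) * S \<le> 1 - sqrt \<beta> / sqrt (1 - \<kappa>\<^sup>2) * (\<Sum>j\<in>{1..Suc n}. e j)"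
    using S[of "Suc n"] \<beta> \<kappa>1 by (intro diff_left_mono mult_left_mono) auto
  also have "\<dots> \<le> 1 - (\<Sum>j\<in>{1..Suc n}. s j)"
    unfolding sum_distrib_left by (intro diff_left_mono sum_mono s_le)
  also have "\<dots> \<le> (\<Prod>j\<in>{1..Suc n}. 1 - s j)"
    by (rule one_minus_sum_le_prod) (use s in auto)
  also have "\<dots> \<le> simple_mean n [0] ?Z"
    by (rule tilted_mean_ge) (use sub s(2) in auto)
  also have "\<dots> \<le> simple_mean n [0] (\<lambda>h. likelihood e h powr \<beta>)"
  proof (rule mean_from_mono)
    fix h
    have "excursion_weight (\<lambda>j. 1 - s j) (Suc n) h \<le> 1"
      unfolding excursion_weight_def using s
      by (intro mult_le_one power_le_one prod_le_1 prod_nonneg) auto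
    then have "likelihood e h powr \<beta> * excursion_weight (\<lambda>j. 1 - s j) (Suc n) h \<le> likelihood e h powr \<beta>"
      by (intro mult_left_le) auto
    moreover have "tilt (\<lambda>m. (1 - e m) powr \<beta>) (\<lambda>m. (1 + e m) powr \<beta>) h = likelihood e h powr \<beta>"
      unfolding likelihood_def by (rule tilt_powr[OF e, symmetric])
    ultimately show "?Z h \<le> likelihood e h powr \<beta>" by simp
  qed
  finally show ?thesis .
qed

text \<open>
  By concavity \<open>L\<^sup>\<beta> \<le> 1 - \<beta> + \<beta> L\<close>, where the right-hand side has mean \<open>1\<close>. On the event that \<open>L\<close> is small
  the inequality is far from being sharp, so this event is rare if \<open>L\<^sup>\<beta>\<close> has mean close to \<open>1\<close>.
\<close>

lemma simple_prob_small_likelihood: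
  assumes \<beta>: "0 < \<beta>" "\<beta> \<le> 1 / 4" and K: "0 < K" "K powr - \<beta> \<le> 1 / 4"
    and ge: "1 - \<sigma> \<le> simple_mean n [0] (\<lambda>h. likelihood e h powr \<beta>)"
  shows "simple_prob n {h. likelihood e h < 1 / K} \<le> 2 * \<sigma>"
proof -
  let ?A = "{h. likelihood e h < 1 / K}"
  have "1 - \<sigma> \<le> simple_mean n [0] (\<lambda>h. (1 - \<beta>) + \<beta> * likelihood e h - 1 / 2 * indicator ?A h)"
  proof (rule order_trans[OF ge], rule mean_from_mono)
    fix h
    define y where "y = likelihood e h"
    have y: "0 < y" using likelihood_pos by (simp add: y_def)
    have "y powr \<beta> \<le> (1 - \<beta>) + \<beta> * y"
    proof -
      have "exp ((1 - \<beta>) * 0 + \<beta> * ln y) \<le> (1 - \<beta>) * exp 0 + \<beta> * exp (ln y)"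
        using convex_onD[OF exp_convex, of \<beta> 0 "ln y"] \<beta> by simp
      then show ?thesis using y by (simp add: powr_def)
    qed
    moreover have "y powr \<beta> \<le> (1 - \<beta>) + \<beta> * y - 1 / 2" if "y < 1 / K"
    proof -
      have "y powr \<beta> \<le> (1 / K) powr \<beta>" using that y \<beta> by (intro powr_mono2) auto
      also have "\<dots> = K powr - \<beta>" using K by (simp add: powr_minus powr_divide field_simps)
      also have "\<dots> \<le> 1 / 4" by (rule K(2))
      finally have "y powr \<beta> \<le> 1 / 4" .
      moreover have "0 \<le> \<beta> * y" using \<beta> y by simp
      ultimately show ?thesis using \<beta> by linarith
    qed
    ultimately show "likelihood e h powr \<beta> \<le> (1 - \<beta>) + \<beta> * likelihood e h - 1 / 2 * indicator ?A h"
      by (simp add: indicator_def y_def)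
  qed
  also have "\<dots> = 1 - 1 / 2 * simple_prob n ?A" using mean_likelihood[of n] by simp
  finally show ?thesis by simp
qed

proposition simple_prob_le_event_prob:
  assumes "summable (\<lambda>n. e (Suc n))" and \<eta>: "\<eta> > 0"
  obtains K where "K > 0" "\<And>n A. simple_prob n A \<le> \<eta> + K * event_prob n A"
proof -
  from summable_drift_bounds[OF assms(1)] obtain \<kappa> S where \<kappa>: "0 < \<kappa>" "\<kappa> < 1" "\<And>j. e j \<le> \<kappa>"
    and S: "0 \<le> S" "\<And>N. (\<Sum>j\<in>{1..N}. e j) \<le> S" by metis
  have \<kappa>1: "0 < 1 - \<kappa>\<^sup>2" using \<kappa> by (simp add: power_less_one_iff abs_square_less_1)
  define c where "c = S / sqrt (1 - \<kappa>\<^sup>2) + 1"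
  have c: "0 < c" "S / sqrt (1 - \<kappa>\<^sup>2) \<le> c" using S \<kappa>1 by (auto simp: c_def add_nonneg_pos)
  \<comment> \<open>This makes \<open>2 \<sigma>\<close> at most \<open>\<eta>\<close>, where \<open>\<sigma>\<close> is the deviation of the mean of \<open>L\<^sup>\<beta>\<close> from \<open>1\<close>.\<close>
  define \<beta> where "\<beta> = (min (1 / 2) (\<eta> / (2 * c)))\<^sup>2"
  have m: "0 < min (1 / 2) (\<eta> / (2 * c))" using \<eta> c by simp
  have \<beta>: "0 < \<beta>" "\<beta> \<le> 1 / 4" "sqrt \<beta> \<le> \<eta> / (2 * c)"
  proof -
    show "0 < \<beta>" using m by (simp add: \<beta>_def)
    have "\<beta> \<le> (1 / 2)\<^sup>2" unfolding \<beta>_def using m by (intro power_mono) auto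
    then show "\<beta> \<le> 1 / 4" by (simp add: power2_eq_square)
    have "sqrt \<beta> = min (1 / 2) (\<eta> / (2 * c))" unfolding \<beta>_def using m by simp
    then show "sqrt \<beta> \<le> \<eta> / (2 * c)" by simp
  qed
  define K :: real where "K = 4 powr (1 / \<beta>)"
  have K: "0 < K" "K powr - \<beta> \<le> 1 / 4"
    using \<beta> by (simp_all add: K_def powr_powr powr_minus)
  define \<sigma> where "\<sigma> = sqrt \<beta> / sqrt (1 - \<kappa>\<^sup>2) * S"
  have \<sigma>: "2 * \<sigma> \<le> \<eta>"
  proof -
    have "\<sigma> = sqrt \<beta> * (S / sqrt (1 - \<kappa>\<^sup>2))" by (simp add: \<sigma>_def)
    also have "\<dots> \<le> \<eta> / (2 * c) * c" using \<beta> c S \<kappa>1 \<eta> by (intro mult_mono) auto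
    finally show ?thesis using c by simp
  qed
  show ?thesis
  proof (rule that)
    show "K > 0" by (rule K(1))
    fix n A
    have "simple_prob n A \<le> simple_mean n [0]
        (\<lambda>h. indicator {h. likelihood e h < 1 / K} h + K * (likelihood e h * indicator A h))"
    proof (rule mean_from_mono)
      fix h
      have "0 \<le> likelihood e h" using likelihood_pos[of h] by simp
      then have "0 \<le> K * likelihood e h" using K by simp
      moreover have "1 \<le> K * likelihood e h" if "\<not> likelihood e h < 1 / K"
        using that K by (simp add: field_simps)
      ultimately show "indicator A h \<le> indicator {h. likelihood e h < 1 / K} h + K * (likelihood e h * indicator A h)"
        by (simp add: indicator_def)
    qed
    also have "\<dots> = simple_prob n {h. likelihood e h < 1 / K} + K * event_prob n A"
      unfolding mean_from_likelihood by simp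
    also have "simple_prob n {h. likelihood e h < 1 / K} \<le> 2 * \<sigma>"
      by (rule simple_prob_small_likelihood[OF \<beta>(1,2) K])
         (unfold \<sigma>_def, rule mean_likelihood_powr_ge[OF \<kappa>(2,3) S(2) \<beta>(1)])
    finally show "simple_prob n A \<le> \<eta> + K * event_prob n A" using \<sigma> by simp
  qed
qed

end

section \<open>Equivalence and orthogonality of the laws on sequence space\<close>

abbreviation seq_space :: "(nat \<Rightarrow> int) measure" where
  "seq_space \<equiv> \<Pi>\<^sub>M n\<in>UNIV. count_space UNIV"

text \<open>
  The events that depend on the first \<open>n + 1\<close> positions.
\<close>

definition cylinder :: "nat \<Rightarrow> int list set \<Rightarrow> (nat \<Rightarrow> int) set" where
  "cylinder n A = {x. history (\<lambda>k x. x k) n x \<in> A}"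

lemma space_seq_space [simp]: "space seq_space = UNIV"
  by (simp add: space_PiM)

lemma cylinder_in_sets [measurable, simp]: "cylinder n A \<in> sets seq_space"
proof -
  have "history (\<lambda>k x. x k) n \<in> measurable seq_space (count_space UNIV)"
    by (rule measurable_history) (rule measurable_component_singleton, simp)
  from measurable_sets[OF this, of A] show ?thesis by (simp add: cylinder_def vimage_def)
qed

lemma sets_seq_space: "sets seq_space = sigma_sets UNIV (range (\<lambda>(n, A). cylinder n A))"
proof (rule antisym)
  have U: "(\<Pi>\<^sub>E i\<in>(UNIV :: nat set). space (count_space (UNIV :: int set))) = UNIV" by auto
  show "sets seq_space \<subseteq> sigma_sets UNIV (range (\<lambda>(n, A). cylinder n A))"
    unfolding sets_PiM_single U
  proof (rule sigma_sets_mono, safe)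
    fix i :: nat and A :: "int set"
    have "{f \<in> UNIV. f i \<in> A} = cylinder i {h. hd h \<in> A}"
      by (cases i) (auto simp: cylinder_def history_0 history_Suc)
    then show "{f \<in> UNIV. f i \<in> A} \<in> sigma_sets UNIV (range (\<lambda>(n, A). cylinder n A))"
      by (intro sigma_sets.Basic) auto
  qed
  have "sigma_sets (space seq_space) (range (\<lambda>(n, A). cylinder n A)) \<subseteq> sets seq_space"
    by (rule sets.sigma_sets_subset) auto
  then show "sigma_sets UNIV (range (\<lambda>(n, A). cylinder n A)) \<subseteq> sets seq_space" by simp
qed

lemma cylinder_extend: "cylinder n A = cylinder (n + k) {h. drop k h \<in> A}"
proof -
  have "drop k (history X (n + k) x) = history X n x" for X :: "nat \<Rightarrow> (nat \<Rightarrow> int) \<Rightarrow> int" and x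
    by (induction k) (simp_all add: history_Suc)
  then show ?thesis by (simp add: cylinder_def)
qed

lemma cylinder_Un: "\<exists>l C. cylinder n A \<union> cylinder m B = cylinder l C"
proof -
  have "cylinder n A \<union> cylinder m B = cylinder (n + m) {h. drop m h \<in> A} \<union> cylinder (n + m) {h. drop n h \<in> B}"
    using cylinder_extend[of n A m] cylinder_extend[of m B n] by (simp add: add.commute)
  also have "\<dots> = cylinder (n + m) ({h. drop m h \<in> A} \<union> {h. drop n h \<in> B})"
    by (auto simp: cylinder_def)
  finally show ?thesis by blast
qed

text \<open>
  The same cylinder is used for both measures, which allows absolute continuity to be transferred from
  cylinders to all measurable sets.
\<close>

definition cylinder_approximable :: "(nat \<Rightarrow> int) measure \<Rightarrow> (nat \<Rightarrow> int) measure \<Rightarrow> (nat \<Rightarrow> int) set \<Rightarrow> bool" where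
  "cylinder_approximable P Q A \<longleftrightarrow> (\<forall>\<epsilon>>0. \<exists>n C.
     measure P (sym_diff A (cylinder n C)) < \<epsilon> \<and> measure Q (sym_diff A (cylinder n C)) < \<epsilon>)"

context
  fixes P Q :: "(nat \<Rightarrow> int) measure"
  assumes prob_P: "prob_space P" and prob_Q: "prob_space Q"
    and sets_P: "sets P = sets seq_space" and sets_Q: "sets Q = sets seq_space"
begin

interpretation P: prob_space P by (rule prob_P)
interpretation Q: prob_space Q by (rule prob_Q)

lemma cylinder_approximable_Un:
  assumes A: "A \<in> sets seq_space" "cylinder_approximable P Q A"
    and B: "B \<in> sets seq_space" "cylinder_approximable P Q B"
  shows "cylinder_approximable P Q (A \<union> B)"
  unfolding cylinder_approximable_def
proof (intro allI impI)
  fix \<epsilon> :: real assume \<epsilon>: "\<epsilon> > 0"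
  then have \<epsilon>2: "\<epsilon> / 2 > 0" by simp
  from A(2)[unfolded cylinder_approximable_def, rule_format, OF \<epsilon>2] obtain n C where C:
    "measure P (sym_diff A (cylinder n C)) < \<epsilon> / 2" "measure Q (sym_diff A (cylinder n C)) < \<epsilon> / 2"
    by blast
  from B(2)[unfolded cylinder_approximable_def, rule_format, OF \<epsilon>2] obtain m D where D:
    "measure P (sym_diff B (cylinder m D)) < \<epsilon> / 2" "measure Q (sym_diff B (cylinder m D)) < \<epsilon> / 2"
    by blast
  obtain l E where E: "cylinder n C \<union> cylinder m D = cylinder l E" using cylinder_Un by blast
  have sub: "sym_diff (A \<union> B) (cylinder l E) \<subseteq> sym_diff A (cylinder n C) \<union> sym_diff B (cylinder m D)"
    unfolding E[symmetric] by blast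
  have bound: "measure R (sym_diff (A \<union> B) (cylinder l E))
      \<le> measure R (sym_diff A (cylinder n C)) + measure R (sym_diff B (cylinder m D))"
    if "prob_space R" and R: "sets R = sets seq_space" for R
  proof -
    interpret R: prob_space R by fact
    have "A \<in> sets R" "B \<in> sets R" "cylinder n C \<in> sets R" "cylinder m D \<in> sets R"
      using A(1) B(1) R by simp_all
    then have meas: "sym_diff A (cylinder n C) \<in> sets R" "sym_diff B (cylinder m D) \<in> sets R"
      by auto
    have "measure R (sym_diff (A \<union> B) (cylinder l E)) \<le> measure R (sym_diff A (cylinder n C) \<union> sym_diff B (cylinder m D))"
      by (rule R.finite_measure_mono[OF sub]) (rule sets.Un[OF meas])
    also have "\<dots> \<le> measure R (sym_diff A (cylinder n C)) + measure R (sym_diff B (cylinder m D))"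
      by (rule measure_Un_le[OF meas])
    finally show ?thesis .
  qed
  show "\<exists>n C. measure P (sym_diff (A \<union> B) (cylinder n C)) < \<epsilon> \<and> measure Q (sym_diff (A \<union> B) (cylinder n C)) < \<epsilon>"
    using C D bound[OF prob_P sets_P] bound[OF prob_Q sets_Q] by (intro exI[of _ l] exI[of _ E]) linarith
qed

lemma cylinder_approximable_increasing:
  assumes A: "\<And>i. A i \<in> sets seq_space" "incseq A" and approx: "\<And>i. cylinder_approximable P Q (A i)"
  shows "cylinder_approximable P Q (\<Union>i. A i)"
  unfolding cylinder_approximable_def
proof (intro allI impI)
  fix \<epsilon> :: real assume \<epsilon>: "\<epsilon> > 0"
  let ?U = "\<Union>i. A i"
  have A': "A i \<in> sets P" "A i \<in> sets Q" for i using A(1) sets_P sets_Q by auto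
  have "(\<lambda>i. measure P (A i)) \<longlonglongrightarrow> measure P ?U"
    by (rule P.finite_Lim_measure_incseq) (use A' A(2) in auto)
  then have evP: "\<forall>\<^sub>F i in sequentially. measure P ?U - \<epsilon> / 2 < measure P (A i)"
    by (rule order_tendstoD) (use \<epsilon> in simp)
  have "(\<lambda>i. measure Q (A i)) \<longlonglongrightarrow> measure Q ?U"
    by (rule Q.finite_Lim_measure_incseq) (use A' A(2) in auto)
  then have evQ: "\<forall>\<^sub>F i in sequentially. measure Q ?U - \<epsilon> / 2 < measure Q (A i)"
    by (rule order_tendstoD) (use \<epsilon> in simp)
  obtain i where i: "measure P ?U - \<epsilon> / 2 < measure P (A i)" "measure Q ?U - \<epsilon> / 2 < measure Q (A i)"
    using eventually_conj[OF evP evQ] by (auto simp: eventually_sequentially)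
  obtain n C where C: "measure P (sym_diff (A i) (cylinder n C)) < \<epsilon> / 2" "measure Q (sym_diff (A i) (cylinder n C)) < \<epsilon> / 2"
    using approx[of i] \<epsilon> unfolding cylinder_approximable_def by (meson half_gt_zero)
  have bound: "measure R (sym_diff ?U (cylinder n C)) < \<epsilon>"
    if "prob_space R" and R: "sets R = sets seq_space" and i: "measure R ?U - \<epsilon> / 2 < measure R (A i)"
      and C: "measure R (sym_diff (A i) (cylinder n C)) < \<epsilon> / 2" for R
  proof -
    interpret R: prob_space R by fact
    have meas: "A i \<in> sets R" "?U \<in> sets R" "cylinder n C \<in> sets R" using A(1) R by auto
    have "measure R (sym_diff ?U (cylinder n C)) \<le> measure R ((?U - A i) \<union> sym_diff (A i) (cylinder n C))"
      by (rule R.finite_measure_mono) (use meas in auto)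
    also have "\<dots> \<le> measure R (?U - A i) + measure R (sym_diff (A i) (cylinder n C))"
      by (rule measure_Un_le) (use meas in auto)
    also have "measure R (?U - A i) = measure R ?U - measure R (A i)"
      by (rule R.finite_measure_Diff) (use meas in auto)
    finally show ?thesis using C i by linarith
  qed
  show "\<exists>n C. measure P (sym_diff ?U (cylinder n C)) < \<epsilon> \<and> measure Q (sym_diff ?U (cylinder n C)) < \<epsilon>"
    using bound[OF prob_P sets_P i(1) C(1)] bound[OF prob_Q sets_Q i(2) C(2)] by blast
qed

lemma cylinder_approximable_sets:
  assumes "A \<in> sets seq_space"
  shows "cylinder_approximable P Q A"
  using assms unfolding sets_seq_space
proof (induction A rule: sigma_sets.induct)
  case (Basic A)
  then obtain n C where "A = cylinder n C" by auto
  then show ?case unfolding cylinder_approximable_def by (intro allI impI exI[of _ n] exI[of _ C]) simp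
next
  case Empty
  have "cylinder 0 {} = {}" by (simp add: cylinder_def)
  then show ?case unfolding cylinder_approximable_def by (intro allI impI exI[of _ 0] exI[of _ "{}"]) simp
next
  case (Compl A)
  have "sym_diff (UNIV - A) (cylinder n (- C)) = sym_diff A (cylinder n C)" for n C
    by (auto simp: cylinder_def)
  then show ?case using Compl.IH unfolding cylinder_approximable_def by metis
next
  case (Union A)
  define D where "D = (\<lambda>i. \<Union>j\<le>i. A j)"
  have A: "A i \<in> sets seq_space" for i using Union.hyps unfolding sets_seq_space by simp
  have D: "D i \<in> sets seq_space" for i unfolding D_def using A by auto
  have "cylinder_approximable P Q (D i)" for i
  proof (induction i)
    case 0
    then show ?case using Union.IH[of 0] by (simp add: D_def)
  next
    case (Suc i)
    have "D (Suc i) = D i \<union> A (Suc i)" by (auto simp: D_def atMost_Suc)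
    then show ?case using cylinder_approximable_Un[OF D Suc A Union.IH] by simp
  qed
  then have "cylinder_approximable P Q (\<Union>i. D i)"
  proof (rule cylinder_approximable_increasing[OF D, rotated])
    show "incseq D" unfolding D_def by (intro incseq_SucI UN_mono) auto
  qed
  also have "(\<Union>i. D i) = (\<Union>i. A i)" by (auto simp: D_def)
  finally show ?case .
qed

lemma absolutely_continuous_by_cylinders:
  assumes ac: "\<And>\<epsilon>. \<epsilon> > 0 \<Longrightarrow> \<exists>\<delta>>0. \<forall>n C. measure P (cylinder n C) < \<delta> \<longrightarrow> measure Q (cylinder n C) \<le> \<epsilon>"
  shows "absolutely_continuous P Q"
  unfolding absolutely_continuous_def
proof
  fix A assume "A \<in> null_sets P"
  then have A: "A \<in> sets P" "measure P A = 0" by (auto simp: null_sets_def measure_def)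
  then have A': "A \<in> sets seq_space" "A \<in> sets Q" using sets_P sets_Q by auto
  have "measure Q A \<le> 0"
  proof (rule field_le_epsilon)
    fix \<epsilon> :: real assume \<epsilon>: "\<epsilon> > 0"
    obtain \<delta> where \<delta>: "\<delta> > 0" "\<And>n C. measure P (cylinder n C) < \<delta> \<Longrightarrow> measure Q (cylinder n C) \<le> \<epsilon> / 2"
      using ac[of "\<epsilon> / 2"] \<epsilon> by auto
    have "min \<delta> (\<epsilon> / 2) > 0" using \<delta>(1) \<epsilon> by simp
    then obtain n C where C: "measure P (sym_diff A (cylinder n C)) < min \<delta> (\<epsilon> / 2)"
      "measure Q (sym_diff A (cylinder n C)) < min \<delta> (\<epsilon> / 2)"
      using cylinder_approximable_sets[OF A'(1)] unfolding cylinder_approximable_def by meson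
    have cyl: "cylinder n C \<in> sets P" "cylinder n C \<in> sets Q" using sets_P sets_Q by simp_all
    have "measure P (cylinder n C) \<le> measure P (A \<union> sym_diff A (cylinder n C))"
      by (rule P.finite_measure_mono) (use A cyl in auto)
    also have "\<dots> \<le> measure P A + measure P (sym_diff A (cylinder n C))"
      by (rule measure_Un_le) (use A cyl in auto)
    finally have "measure P (cylinder n C) < \<delta>" using C(1) A(2) by simp
    then have *: "measure Q (cylinder n C) \<le> \<epsilon> / 2" by (rule \<delta>(2))
    have "measure Q A \<le> measure Q (cylinder n C \<union> sym_diff A (cylinder n C))"
      by (rule Q.finite_measure_mono) (use A' cyl in auto)
    also have "\<dots> \<le> measure Q (cylinder n C) + measure Q (sym_diff A (cylinder n C))"
      by (rule measure_Un_le) (use A' cyl in auto)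
    finally show "measure Q A \<le> 0 + \<epsilon>" using * C(2) by simp
  qed
  then have "measure Q A = 0" using measure_nonneg[of Q A] by linarith
  then show "A \<in> null_sets Q" using A'(2) by (simp add: null_sets_def Q.emeasure_eq_measure)
qed

text \<open>
  The separating set consists of the sequences that belong to almost all of the cylinders; apply the
  Borel--Cantelli lemma under both measures.
\<close>

lemma orthogonal_by_cylinders:
  assumes P: "summable (\<lambda>k. measure P (- cylinder (n k) (C k)))"
    and Q: "summable (\<lambda>k. measure Q (cylinder (n k) (C k)))"
  shows "orthogonal_measures P Q"
proof -
  have space: "space P = UNIV" "space Q = UNIV"
    using sets_eq_imp_space_eq[OF sets_P] sets_eq_imp_space_eq[OF sets_Q] by simp_all
  have cyl: "cylinder (n k) (C k) \<in> sets seq_space" for k by simp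
  have cyl': "- cylinder (n k) (C k) \<in> sets seq_space" for k
    using sets.compl_sets[OF cyl[of k]] by (simp add: Compl_eq_Diff_UNIV)
  define D where "D = {x. \<forall>\<^sub>F k in sequentially. x \<in> cylinder (n k) (C k)}"
  have D_eq: "D = (\<Union>m. \<Inter>k\<in>{m..}. cylinder (n k) (C k))"
    by (auto simp: D_def eventually_sequentially)
  have D: "D \<in> sets seq_space" unfolding D_eq by (intro sets.countable_UN sets.countable_INT' ) (auto simp: cyl)
  have DP: "UNIV - D \<in> sets P" using sets.compl_sets[OF D] sets_P by simp
  have DQ: "D \<in> sets Q" using D sets_Q by simp
  have "AE x in P. \<forall>\<^sub>F k in sequentially. x \<in> space P - (- cylinder (n k) (C k))"
    by (rule borel_cantelli_AE1) (use cyl' sets_P P in \<open>auto simp: P.emeasure_eq_measure\<close>)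
  then have "AE x in P. x \<in> D" by eventually_elim (simp add: D_def space)
  then have PD: "emeasure P (UNIV - D) = 0"
    using AE_iff_measurable[OF DP, of "\<lambda>x. x \<in> D"] space by auto
  have "AE x in Q. \<forall>\<^sub>F k in sequentially. x \<in> space Q - cylinder (n k) (C k)"
    by (rule borel_cantelli_AE1) (use cyl sets_Q Q in \<open>auto simp: Q.emeasure_eq_measure\<close>)
  then have "AE x in Q. x \<notin> D"
  proof eventually_elim
    case (elim x)
    show ?case
    proof
      assume "x \<in> D"
      then have "\<forall>\<^sub>F k in sequentially. x \<in> cylinder (n k) (C k)" by (simp add: D_def)
      with elim have "\<forall>\<^sub>F k in sequentially. False" by eventually_elim simp
      then show False by simp
    qed
  qed
  then have QD: "emeasure Q D = 0"
    using AE_iff_measurable[OF DQ, of "\<lambda>x. x \<notin> D"] space by auto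
  have "space Q - (UNIV - D) = D" using space by auto
  then show ?thesis
    unfolding orthogonal_measures_def using DP PD QD sets_P sets_Q by (intro conjI bexI[of _ "UNIV - D"]) auto
qed

end

lemma
  assumes "drift_walk M e X"
  shows prob_space_walk_law: "prob_space (walk_law M X)"
    and measurable_trajectory: "(\<lambda>\<omega> n. X n \<omega>) \<in> measurable M seq_space"
proof -
  show *: "(\<lambda>\<omega> n. X n \<omega>) \<in> measurable M seq_space"
    by (rule measurable_PiM_single') (use assms in \<open>auto simp: drift_walk_def\<close>)
  have "prob_space M" using assms by (simp add: drift_walk_def)
  from prob_space.prob_space_distr[OF this *] show "prob_space (walk_law M X)" by (simp add: walk_law_def)
qed

lemma sets_walk_law: "sets (walk_law M X) = sets seq_space"
  by (simp add: walk_law_def)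

lemma (in drift_sequence) measure_walk_law_cylinder:
  assumes walk: "drift_walk M e X"
  shows "measure (walk_law M X) (cylinder n C) = event_prob n C"
proof -
  have hX: "history X n \<in> measurable M (count_space UNIV)"
    by (rule measurable_history) (use walk in \<open>simp add: drift_walk_def\<close>)
  have "measure (walk_law M X) (cylinder n C) = measure M ((\<lambda>\<omega> n. X n \<omega>) -` cylinder n C \<inter> space M)"
    unfolding walk_law_def by (rule measure_distr[OF measurable_trajectory[OF walk]]) simp
  also have "(\<lambda>\<omega> n. X n \<omega>) -` cylinder n C \<inter> space M = history X n -` C \<inter> space M"
    by (auto simp: cylinder_def history_def)
  also have "measure M \<dots> = measure (distr M (count_space UNIV) (history X n)) C"
    by (rule measure_distr[OF hX, symmetric]) simp
  also have "\<dots> = event_prob n C" unfolding distr_history[OF walk] by simp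
  finally show ?thesis .
qed

context drift_sequence
begin

theorem walk_law_equivalent:
  assumes X: "drift_walk M e X" and S: "simple_random_walk Q S" and sum: "summable (\<lambda>n. e (Suc n))"
  shows "equivalent_measures (walk_law M X) (walk_law Q S)"
  unfolding equivalent_measures_def
proof (intro conjI)
  show "sets (walk_law M X) = sets (walk_law Q S)" by (simp add: sets_walk_law)
  note px = prob_space_walk_law[OF X] and ps = prob_space_walk_law[OF S]
  show "absolutely_continuous (walk_law M X) (walk_law Q S)"
  proof (rule absolutely_continuous_by_cylinders[OF px ps sets_walk_law sets_walk_law])
    fix \<epsilon> :: real assume \<epsilon>: "\<epsilon> > 0"
    then have "\<epsilon> / 2 > 0" by simp
    from simple_prob_le_event_prob[OF sum this] obtain K where K: "K > 0"
      "\<And>n A. simple_prob n A \<le> \<epsilon> / 2 + K * event_prob n A" by blast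
    show "\<exists>\<delta>>0. \<forall>n C. measure (walk_law M X) (cylinder n C) < \<delta> \<longrightarrow> measure (walk_law Q S) (cylinder n C) \<le> \<epsilon>"
      unfolding measure_walk_law_cylinder[OF X] simple.measure_walk_law_cylinder[OF S]
    proof (intro exI[of _ "\<epsilon> / (2 * K)"] conjI allI impI)
      show "0 < \<epsilon> / (2 * K)" using \<epsilon> K by simp
      fix n C assume "event_prob n C < \<epsilon> / (2 * K)"
      then have "K * event_prob n C < \<epsilon> / 2" using K(1) by (simp add: field_simps)
      then show "simple_prob n C \<le> \<epsilon>" using K(2)[of n C] by linarith
    qed
  qed
  show "absolutely_continuous (walk_law Q S) (walk_law M X)"
  proof (rule absolutely_continuous_by_cylinders[OF ps px sets_walk_law sets_walk_law])
    fix \<epsilon> :: real assume \<epsilon>: "\<epsilon> > 0"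
    from event_prob_le_simple_prob[OF sum] obtain R where R: "0 \<le> R"
      "\<And>n A \<delta>. \<delta> > 0 \<Longrightarrow> event_prob n A \<le> \<delta> * R + simple_prob n A / \<delta>" by blast
    define d where "d = \<epsilon> / 2 / (R + 1)"
    have d: "d > 0" "d * R \<le> \<epsilon> / 2"
    proof -
      show d0: "d > 0" using \<epsilon> R by (simp add: d_def)
      have "d * R \<le> d * (R + 1)" using d0 by simp
      also have "\<dots> = \<epsilon> / 2"
        using nonzero_divide_eq_eq[of "R + 1" "\<epsilon> / 2" d] R(1) by (simp add: d_def)
      finally show "d * R \<le> \<epsilon> / 2" .
    qed
    show "\<exists>\<delta>>0. \<forall>n C. measure (walk_law Q S) (cylinder n C) < \<delta> \<longrightarrow> measure (walk_law M X) (cylinder n C) \<le> \<epsilon>"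
      unfolding measure_walk_law_cylinder[OF X] simple.measure_walk_law_cylinder[OF S]
    proof (intro exI[of _ "\<epsilon> / 2 * d"] conjI allI impI)
      show "0 < \<epsilon> / 2 * d" using \<epsilon> d by simp
      fix n C assume "simple_prob n C < \<epsilon> / 2 * d"
      then have "simple_prob n C / d < \<epsilon> / 2" using d(1) by (simp add: pos_divide_less_eq)
      then show "event_prob n C \<le> \<epsilon>" using R(2)[OF d(1), of n C] d(2) by linarith
    qed
  qed
qed

text \<open>
  The likelihood ratio test separates the laws: both of its error probabilities are at most the mean of
  \<open>\<surd>L\<close>, which is made summable by passing to a subsequence of the times.
\<close>

theorem walk_law_orthogonal:
  assumes X: "drift_walk M e X" and S: "simple_random_walk Q S" and sum: "\<not> summable (\<lambda>n. e (Suc n))"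
  shows "orthogonal_measures (walk_law M X) (walk_law Q S)"
proof -
  let ?L = "\<lambda>n. simple_mean n [0] (\<lambda>h. sqrt (likelihood e h))"
  have "\<exists>n. ?L n < (1 / 2) ^ k" for k :: nat
  proof -
    have "\<forall>\<^sub>F n in sequentially. ?L n < (1 / 2) ^ k"
      by (rule order_tendstoD(2)[OF mean_sqrt_likelihood_tendsto_0[OF sum]]) simp
    then show ?thesis by (auto simp: eventually_sequentially)
  qed
  then obtain r where r: "\<And>k. ?L (r k) < (1 / 2) ^ k" by metis
  let ?C = "{h. 1 \<le> likelihood e h}"
  have geometric: "summable (\<lambda>k. (1 / 2 :: real) ^ k)" by (rule summable_geometric) simp
  have compl: "- cylinder n ?C = cylinder n {h. likelihood e h < 1}" for n
    by (auto simp: cylinder_def)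
  show ?thesis
  proof (rule orthogonal_by_cylinders[OF prob_space_walk_law[OF X] prob_space_walk_law[OF S] sets_walk_law sets_walk_law])
    show "summable (\<lambda>k. measure (walk_law M X) (- cylinder (r k) ?C))"
      unfolding compl measure_walk_law_cylinder[OF X]
    proof (rule summable_comparison_test'[OF geometric])
      fix k :: nat
      have "event_prob (r k) {h. likelihood e h < 1} \<le> (1 / 2) ^ k"
        using event_prob_likelihood_less_1[of "r k"] r[of k] by linarith
      then show "norm (event_prob (r k) {h. likelihood e h < 1}) \<le> (1 / 2) ^ k" by simp
    qed
    show "summable (\<lambda>k. measure (walk_law Q S) (cylinder (r k) ?C))"
      unfolding simple.measure_walk_law_cylinder[OF S]
    proof (rule summable_comparison_test'[OF geometric])
      fix k :: nat
      have "simple_prob (r k) ?C \<le> (1 / 2) ^ k"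
        using simple_prob_likelihood_ge_1[of "r k"] r[of k] by linarith
      then show "norm (simple_prob (r k) ?C) \<le> (1 / 2) ^ k" by simp
    qed
  qed
qed

end

theorem theorem1:
  fixes \<epsilon> :: "nat \<Rightarrow> real"
    and M :: "'a measure" and X :: "nat \<Rightarrow> 'a \<Rightarrow> int"
    and Q :: "'b measure" and S :: "nat \<Rightarrow> 'b \<Rightarrow> int"
    and W :: "'c measure" and B :: "real \<Rightarrow> 'c \<Rightarrow> real"
  assumes "\<And>n. n \<ge> 1 \<Longrightarrow> 0 \<le> \<epsilon> n \<and> \<epsilon> n < 1"
    and "drift_walk M \<epsilon> X"
  shows "((\<lambda>n. real n * \<epsilon> n) \<longlonglongrightarrow> 0 \<longrightarrow> standard_brownian_motion W B \<longrightarrow>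
            converges_in_law M (rescaled_path X) W (\<lambda>\<omega>. to_path (\<lambda>t. B t \<omega>))) \<and>
         (simple_random_walk Q S \<longrightarrow>
            (summable (\<lambda>n. \<epsilon> (Suc n)) \<longrightarrow> equivalent_measures (walk_law M X) (walk_law Q S)) \<and>
            (\<not> summable (\<lambda>n. \<epsilon> (Suc n)) \<longrightarrow> orthogonal_measures (walk_law M X) (walk_law Q S)))"
proof -
  define e where "e = \<epsilon>(0 := 0)"
  interpret drift_sequence e
    by unfold_locales (use assms(1) in \<open>auto simp: e_def\<close>)
  have walk: "drift_walk M e X"
    by (rule drift_walk_cong[OF assms(2)]) (simp add: e_def)
  have "(\<lambda>n. real n * e n) = (\<lambda>n. real n * \<epsilon> n)" "(\<lambda>n. e (Suc n)) = (\<lambda>n. \<epsilon> (Suc n))"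
    by (auto simp: e_def)
  then show ?thesis
    using invariance_principle[OF walk, of W B] walk_law_equivalent[OF walk, of Q S]
      walk_law_orthogonal[OF walk, of Q S] by simp
qed

end
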